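(* Let $\mathcal{L}^W$ be a Gaussian measure satisfying the covariance regularity assumption below for some $\varrho\in[1, 3/2)$ and let $\mathbf{W}$ be the lifted Gaussian rough path. Then for $\tfrac{1}{3} <\alpha<\tfrac{1}{2\varrho}$ we have \[ \mathfrak{B}(\varepsilon):=-\log\Big( \mathbb{P}\Big[ \| \mathbf{W} \|_\alpha <\varepsilon\Big] \Big) \lesssim \varepsilon^{\frac{-1}{\tfrac{1}{2\varrho} - \alpha}}. \]
   Context: $\mathcal{L}^W$ is the law of a $d$-dimensional, continuous, centred Gaussian process $W$ on $[0,T]$ with independent components and covariance $\mathcal{R}^W\begin{pmatrix}s,& t\\ u,& v\end{pmatrix} = \mathbb{E}[ W_{s, t} \otimes W_{u, v}]$, where $W_{s,t}=W_t-W_s$. Covariance regularity assumption: there exist $\varrho \in[1, 3/2)$ and $M<\infty$ such that the two-dimensional $\varrho$-variation of $\mathcal{R}^W$ on $[s,t]^{2}$ satisfies $\| \mathcal{R}^W \|_{\varrho\text{-var}; [s, t]^{\times 2}} \leq M |t-s|^{1/ \varrho}$ for all $s\le t$. Under this assumption $W$ lifts canonically to a Gaussian rough path $\mathbf{W}$ (path plus iterated integrals) taking values in the weakly geometric $\alpha$-rough paths over the step-2 nilpotent group $G^{(2)}(\mathbb{R}^d)$. $\|\mathbf{W}\|_\alpha=\sup_{s,t\in[0,T]}\|\mathbf{W}_{s,t}\|_{cc}/|t-s|^\alpha$ is the homogeneous $\alpha$-Hölder rough path norm, with $\|\cdot\|_{cc}$ the Carnot–Carathéodory (homogeneous) norm.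 $f\lesssim g$ as $\varepsilon\to0$ means $\limsup f/g\le C$ for a positive constant $C$ independent of $\varepsilon$. *)

theory Defs
  imports "HOL-Probability.Probability"
begin

definition outer :: "real^'d \<Rightarrow> real^'d \<Rightarrow> real^'d^'d" where
  "outer a b = (\<chi> i j. a $ i * b $ j)"

definition dyad :: "nat \<Rightarrow> real \<Rightarrow> nat \<Rightarrow> real" where
  "dyad n T k = real k * T / 2 ^ n"

definition dyad_idx :: "nat \<Rightarrow> real \<Rightarrow> real \<Rightarrow> nat" where
  "dyad_idx n T r = min (nat \<lfloor>r * 2 ^ n / T\<rfloor>) (2 ^ n - 1)"

definition pl_approx :: "nat \<Rightarrow> real \<Rightarrow> (real \<Rightarrow> real^'d) \<Rightarrow> real \<Rightarrow> real^'d" where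
  "pl_approx n T x r =
     (let k = dyad_idx n T r in
      x (dyad n T k) + ((r - dyad n T k) * 2 ^ n / T) *\<^sub>R (x (dyad n T (Suc k)) - x (dyad n T k)))"

definition pl_slope :: "nat \<Rightarrow> real \<Rightarrow> (real \<Rightarrow> real^'d) \<Rightarrow> real \<Rightarrow> real^'d" where
  "pl_slope n T x r =
     (let k = dyad_idx n T r in (2 ^ n / T) *\<^sub>R (x (dyad n T (Suc k)) - x (dyad n T k)))"

definition pl_area :: "nat \<Rightarrow> real \<Rightarrow> (real \<Rightarrow> real^'d) \<Rightarrow> real \<Rightarrow> real \<Rightarrow> real^'d^'d" where
  "pl_area n T x s t =
     integral {s..t} (\<lambda>r. outer (pl_approx n T x r - pl_approx n T x s) (pl_slope n T x r))"

text \<open>Absolutely continuous paths started at 0, given by their L1 derivative g on [0,1],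
  whose step-2 signature is (x, A).\<close>
definition cc_paths :: "real^'d \<Rightarrow> real^'d^'d \<Rightarrow> (real \<Rightarrow> real^'d) set" where
  "cc_paths x A = {g. g absolutely_integrable_on {0..1} \<and>
      integral {0..1} g = x \<and>
      integral {0..1} (\<lambda>r. outer (integral {0..r} g) (g r)) = A}"

definition cc_norm :: "real^'d \<Rightarrow> real^'d^'d \<Rightarrow> real" where
  "cc_norm x A = Inf ((\<lambda>g. integral {0..1} (\<lambda>r. norm (g r))) ` cc_paths x A)"

definition centred_normal_rv :: "'a measure \<Rightarrow> ('a \<Rightarrow> real) \<Rightarrow> bool" where
  "centred_normal_rv M X \<longleftrightarrow>
     X \<in> borel_measurable M \<and>
     ((AE \<omega> in M. X \<omega> = 0) \<or> (\<exists>\<sigma>>0. distributed M lborel X (normal_density 0 \<sigma>)))"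

definition cont_centred_gauss_indep :: "'a measure \<Rightarrow> real \<Rightarrow> (real \<Rightarrow> 'a \<Rightarrow> real^'d) \<Rightarrow> bool" where
  "cont_centred_gauss_indep M T W \<longleftrightarrow>
     prob_space M \<and>
     (\<forall>t\<in>{0..T}. W t \<in> borel_measurable M) \<and>
     (\<forall>\<omega>\<in>space M. continuous_on {0..T} (\<lambda>t. W t \<omega>)) \<and>
     (\<forall>(n::nat) (ts::nat \<Rightarrow> real) (is::nat \<Rightarrow> 'd) (c::nat \<Rightarrow> real).
        (\<forall>j<n. ts j \<in> {0..T}) \<longrightarrow>
        centred_normal_rv M (\<lambda>\<omega>. \<Sum>j<n. c j * W (ts j) \<omega> $ is j)) \<and>
     (\<forall>F. finite F \<and> F \<subseteq> {0..T} \<longrightarrow>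
        prob_space.indep_vars M (\<lambda>_. Pi\<^sub>M F (\<lambda>_. borel))
          (\<lambda>i \<omega>. restrict (\<lambda>t. W t \<omega> $ i) F) UNIV)"

definition cov :: "'a measure \<Rightarrow> (real \<Rightarrow> 'a \<Rightarrow> real^'d) \<Rightarrow> real \<Rightarrow> real \<Rightarrow> real \<Rightarrow> real \<Rightarrow> real^'d^'d" where
  "cov M W s t u v =
     (\<chi> i j. integral\<^sup>L M (\<lambda>\<omega>. (W t \<omega> $ i - W s \<omega> $ i) * (W v \<omega> $ j - W u \<omega> $ j)))"

definition is_partition :: "real \<Rightarrow> real \<Rightarrow> nat \<Rightarrow> (nat \<Rightarrow> real) \<Rightarrow> bool" where
  "is_partition a b n p \<longleftrightarrow> p 0 = a \<and> p n = b \<and> (\<forall>i<n. p i \<le> p (Suc i))"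

definition rho_var2 :: "(real \<Rightarrow> real \<Rightarrow> real \<Rightarrow> real \<Rightarrow> real^'d^'d) \<Rightarrow> real \<Rightarrow> real \<Rightarrow> real \<Rightarrow> ereal" where
  "rho_var2 R \<rho> a b =
     (SUP (n, p, m, q) \<in> {(n, p, m, q). is_partition a b n p \<and> is_partition a b m q}.
        ereal ((\<Sum>i<n. \<Sum>j<m. norm (R (p i) (p (Suc i)) (q j) (q (Suc j))) powr \<rho>) powr (1 / \<rho>)))"

definition canonical_lift :: "'a measure \<Rightarrow> real \<Rightarrow> (real \<Rightarrow> 'a \<Rightarrow> real^'d)
     \<Rightarrow> (real \<Rightarrow> real \<Rightarrow> 'a \<Rightarrow> real^'d^'d) \<Rightarrow> bool" where
  "canonical_lift M T W W2 \<longleftrightarrow>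
     (AE \<omega> in M. \<forall>s t. 0 \<le> s \<and> s \<le> t \<and> t \<le> T \<longrightarrow>
        (\<lambda>n. pl_area n T (\<lambda>r. W r \<omega>) s t) \<longlonglongrightarrow> W2 s t \<omega>)"

definition rp_hoelder_norm :: "real \<Rightarrow> real \<Rightarrow> (real \<Rightarrow> 'a \<Rightarrow> real^'d)
     \<Rightarrow> (real \<Rightarrow> real \<Rightarrow> 'a \<Rightarrow> real^'d^'d) \<Rightarrow> 'a \<Rightarrow> ereal" where
  "rp_hoelder_norm T \<alpha> W W2 \<omega> =
     (SUP (s, t) \<in> {(s, t). 0 \<le> s \<and> s < t \<and> t \<le> T}.
        ereal (cc_norm (W t \<omega> - W s \<omega>) (W2 s t \<omega>) / (t - s) powr \<alpha>))"

text \<open>Inner probability (equals the probability for measurable events).\<close>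
definition inner_prob :: "'a measure \<Rightarrow> 'a set \<Rightarrow> real" where
  "inner_prob M A = (SUP B \<in> {B \<in> sets M. B \<subseteq> A}. measure M B)"

end

theory Submission
  imports Defs
begin

text \<open>
  Let \<open>h = 1/(2\<rho>)\<close>, \<open>\<kappa> = h - \<alpha>\<close> and \<open>2^J ~ \<epsilon>^(-1/\<kappa>)\<close>. It suffices to show that with probability at
  least \<open>exp (- C 2^J)\<close> every increment over a dyadic interval of level \<open>j\<close> is of order
  \<open>\<eta>_j = \<epsilon> (T 2^-j)^\<alpha>\<close> and every area of order \<open>\<eta>_j^2\<close>: Chen's relation then gives the same bounds on
  all intervals, and the Carnot--Caratheodory norm is estimated by explicit piecewise linear paths.

  No correlation inequality is used. The increments and areas are rounded to multiples of \<open>\<eta>_j\<close> and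
  \<open>\<eta>_j^2\<close>. They have standard deviation of order \<open>2^(-jh)\<close> and \<open>2^(-2jh)\<close> and moments of all orders, so
  the rounded values carry entropy of order \<open>J - j\<close> each for \<open>j < J\<close>, and exponentially small in \<open>j - J\<close>
  for \<open>j \<ge> J\<close>; the total is \<open>O(2^J)\<close>. By the pigeonhole principle a single code has
  probability at least \<open>exp (- C 2^J)\<close>. Take two independent copies of the path. By repeated use of
  Cauchy--Schwarz, all \<open>2^d\<close> paths obtained by choosing each component from one of the copies have this
  code with probability at least \<open>exp (- 2^d C 2^J)\<close>. Areas of distinct components are bilinear, so
  then the difference of the copies divided by \<open>\<surd>2\<close>, which has the law of the original path, has
  small increments and areas.

  All of this is done for the piecewise linear approximations of a fixed level with constants that do
  not depend on the level; the bounds pass to the limit along a subsequence.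
\<close>

section \<open>Gaussian vectors and their differences\<close>

text \<open>A small area is a quadratic, non-convex condition on the path, so inequalities for
  symmetric convex sets do not reach it. A likely code only places increments and areas near an
  unknown centre \<open>z\<close>, and subtracting two copies with the same code removes the centre.
  For areas the bilinear expansion of the difference also contains mixed terms, which are areas of
  paths with components from different copies: all choices of components must share the code, and
  the resulting power 2^d enters only the constant. The scale J is where the standard deviation of
  an increment meets its width \<eta>_j: their quotient is of order 2^(-j \<kappa>) / \<epsilon>,
  hence of order one when 2^(J \<kappa>) = 1 / \<epsilon>. Beyond J a level has 2^j variables, whose
  normalised variance decays only like 2^(-2 \<kappa> (j - J)) with \<kappa> possibly small; a
  moment of high order is needed to make the rounded values vanish often enough, and this is what
  the hypercontractive bound on areas supplies. The good events of different levels n are not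
  compared with each other; the limit is taken on the event that infinitely many of them
  occur.\<close>

lemma weighted_law_unique:
  fixes X Y :: "_ \<Rightarrow> real" and g :: "'a \<Rightarrow> real" and h :: "'b \<Rightarrow> real"
  assumes "prob_space P" "prob_space Q"
    and [measurable]: "X \<in> borel_measurable P" "Y \<in> borel_measurable Q"
      "g \<in> borel_measurable P" "h \<in> borel_measurable Q"
    and g: "\<And>x. 0 \<le> g x" "\<And>x. g x \<le> c" and h: "\<And>x. 0 \<le> h x" "\<And>x. h x \<le> c"
    and eq: "\<And>u::real. (CLINT x|P. g x *\<^sub>R iexp (u * X x)) = (CLINT x|Q. h x *\<^sub>R iexp (u * Y x))"
    and B [measurable]: "B \<in> sets borel"
  shows "(\<integral>x. g x * indicator B (X x) \<partial>P) = (\<integral>x. h x * indicator B (Y x) \<partial>Q)"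
proof -
  interpret P: prob_space P by fact
  interpret Q: prob_space Q by fact
  have ig: "integrable P g" using g by (intro P.integrable_const_bound[where B=c]) auto
  have ih: "integrable Q h" using h by (intro Q.integrable_const_bound[where B=c]) auto
  \<comment> \<open>The case u = 0 of the hypothesis gives both weights the same mass m. If m
    vanishes, so do the weights almost everywhere; otherwise division by m yields probability
    densities, and Levy's uniqueness theorem applies to the laws of X and Y under them.\<close>
  define m where "m = (\<integral>x. g x \<partial>P)"
  have m2: "m = (\<integral>x. h x \<partial>Q)"
    using eq[of 0] unfolding m_def by (simp add: scaleR_conv_of_real)
  have m0: "0 \<le> m" unfolding m_def using g by simp
  show ?thesis
  proof (cases "m = 0")
    case True
    have "AE x in P. g x = 0"
      using integral_nonneg_eq_0_iff_AE[OF ig] g True m_def by auto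
    then have "(\<integral>x. g x * indicator B (X x) \<partial>P) = (\<integral>x. 0 \<partial>P)"
      by (intro integral_cong_AE) auto
    moreover have "AE x in Q. h x = 0"
      using integral_nonneg_eq_0_iff_AE[OF ih] h True m2 by auto
    then have "(\<integral>x. h x * indicator B (Y x) \<partial>Q) = (\<integral>x. 0 \<partial>Q)"
      by (intro integral_cong_AE) auto
    ultimately show ?thesis by simp
  next
    case False
    then have m: "m > 0" using m0 by simp
    define D where "D = density P (\<lambda>x. ennreal (g x / m))"
    define E where "E = density Q (\<lambda>x. ennreal (h x / m))"
    have pD: "prob_space D"
    proof
      have "emeasure D (space D) = (\<integral>\<^sup>+x. ennreal (g x / m) \<partial>P)"
        by (auto simp: D_def emeasure_density intro!: nn_integral_cong)
      also have "\<dots> = ennreal (\<integral>x. g x / m \<partial>P)"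
        using m g ig by (intro nn_integral_eq_integral) auto
      finally show "emeasure D (space D) = 1" using m by (simp add: m_def[symmetric])
    qed
    have pE: "prob_space E"
    proof
      have "emeasure E (space E) = (\<integral>\<^sup>+x. ennreal (h x / m) \<partial>Q)"
        by (auto simp: E_def emeasure_density intro!: nn_integral_cong)
      also have "\<dots> = ennreal (\<integral>x. h x / m \<partial>Q)"
        using m h ih by (intro nn_integral_eq_integral) auto
      finally show "emeasure E (space E) = 1" using m by (simp add: m2[symmetric])
    qed
    have mD [measurable]: "X \<in> borel_measurable D" by (simp add: D_def)
    have mE [measurable]: "Y \<in> borel_measurable E" by (simp add: E_def)
    have "distr D borel X = distr E borel Y"
    proof (rule Levy_uniqueness)
      show "real_distribution (distr D borel X)" using pD by (intro prob_space.real_distribution_distr) auto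
      show "real_distribution (distr E borel Y)" using pE by (intro prob_space.real_distribution_distr) auto
      show "char (distr D borel X) = char (distr E borel Y)"
      proof
        fix u :: real
        have "char (distr D borel X) u = (CLINT x|D. iexp (u * X x))"
          unfolding char_def by (subst integral_distr) auto
        also have "\<dots> = (CLINT x|P. (g x / m) *\<^sub>R iexp (u * X x))"
          unfolding D_def using m g by (subst integral_density) auto
        also have "\<dots> = (1 / m) *\<^sub>R (CLINT x|P. g x *\<^sub>R iexp (u * X x))"
          by (subst integral_scaleR_right[symmetric]) (simp)
        also have "\<dots> = (1 / m) *\<^sub>R (CLINT x|Q. h x *\<^sub>R iexp (u * Y x))" by (simp only: eq)
        also have "\<dots> = (CLINT x|Q. (h x / m) *\<^sub>R iexp (u * Y x))"
          by (subst integral_scaleR_right[symmetric]) (simp)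
        also have "\<dots> = (CLINT x|E. iexp (u * Y x))"
          unfolding E_def using m h by (subst integral_density) auto
        also have "\<dots> = char (distr E borel Y) u"
          unfolding char_def by (subst integral_distr) auto
        finally show "char (distr D borel X) u = char (distr E borel Y) u" .
      qed
    qed
    then have "(\<integral>y. indicator B y \<partial>distr D borel X) = (\<integral>y. indicator B y \<partial>distr E borel Y :: real)" by simp
    then have "(\<integral>x. indicator B (X x) \<partial>D) = (\<integral>x. indicator B (Y x) \<partial>E :: real)"
      by (subst (asm) (1 2) integral_distr) auto
    then have "(\<integral>x. (g x / m) *\<^sub>R indicator B (X x) \<partial>P) = (\<integral>x. (h x / m) *\<^sub>R indicator B (Y x) \<partial>Q :: real)"
      unfolding D_def E_def using m g h by (subst (asm) (1 2) integral_density) auto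
    then show ?thesis using m by simp
  qed
qed

text \<open>Coordinates are moved one by one from the exponential to indicators of Borel sets. The weights
  \<open>1 + cos\<close> and \<open>1 + sin\<close> replace the complex exponential of the remaining coordinates, because
  the one-dimensional uniqueness theorem needs a nonnegative weight.\<close>

lemma distr_PiM_eqI_cf:
  fixes X :: "'i \<Rightarrow> 'a \<Rightarrow> real" and Y :: "'i \<Rightarrow> 'b \<Rightarrow> real"
  assumes "prob_space P" "prob_space Q" and K: "finite K"
    and mX [measurable]: "\<And>a. a \<in> K \<Longrightarrow> X a \<in> borel_measurable P"
    and mY [measurable]: "\<And>a. a \<in> K \<Longrightarrow> Y a \<in> borel_measurable Q"
    and eq: "\<And>u. (CLINT x|P. iexp (\<Sum>a\<in>K. u a * X a x)) = (CLINT x|Q. iexp (\<Sum>a\<in>K. u a * Y a x))"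
  shows "distr P (\<Pi>\<^sub>M a\<in>K. borel) (\<lambda>x. \<lambda>a\<in>K. X a x) = distr Q (\<Pi>\<^sub>M a\<in>K. borel) (\<lambda>x. \<lambda>a\<in>K. Y a x)"
proof -
  interpret P: prob_space P by fact
  interpret Q: prob_space Q by fact
  \<comment> \<open>Coordinates in S are tested by indicators, the others by the phase
    \<open>th S u\<close>. For S = {} the identity \<open>main\<close> is the hypothesis on
    characteristic functions, for S = K it compares the probabilities of boxes.\<close>
  define I where "I S A x = (\<Prod>a\<in>S. indicator (A a) (X a x) :: real)" for S A x
  define I' where "I' S A x = (\<Prod>a\<in>S. indicator (A a) (Y a x) :: real)" for S A x
  define th where "th S u x = (\<Sum>a\<in>K - S. u a * X a x)" for S x and u :: "'i \<Rightarrow> real"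
  define th' where "th' S u x = (\<Sum>a\<in>K - S. u a * Y a x)" for S x and u :: "'i \<Rightarrow> real"
  have I01: "0 \<le> I S A x" "I S A x \<le> 1" "0 \<le> I' S A y" "I' S A y \<le> 1" for S A x y
    unfolding I_def I'_def by (auto intro!: prod_nonneg prod_le_1 simp: indicator_def)
  have mI: "I S A \<in> borel_measurable P" "I' S A \<in> borel_measurable Q"
    if "S \<subseteq> K" "\<And>a. A a \<in> sets borel" for S A
    using that unfolding I_def I'_def
    by (auto intro!: borel_measurable_prod measurable_compose[OF mX borel_measurable_indicator]
        measurable_compose[OF mY borel_measurable_indicator])
  have mth [measurable]: "th S u \<in> borel_measurable P" "th' S u \<in> borel_measurable Q" for S u
    unfolding th_def th'_def by auto
  have main: "(CLINT x|P. I S A x *\<^sub>R iexp (th S u x)) = (CLINT x|Q. I' S A x *\<^sub>R iexp (th' S u x))"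
    if "finite S" "S \<subseteq> K" "\<And>a. A a \<in> sets borel" for S A u
    using that
  proof (induction S arbitrary: u rule: finite_induct)
    case empty
    then show ?case using eq by (simp add: I_def I'_def th_def th'_def)
  next
    case (insert b S)
    then have S: "S \<subseteq> K" "b \<in> K" "b \<notin> S" "finite S" and A [measurable]: "\<And>a. A a \<in> sets borel" by auto
    note IH = insert.IH[OF S(1) A]
    have [measurable]: "I S A \<in> borel_measurable P" "I' S A \<in> borel_measurable Q"
      "X b \<in> borel_measurable P" "Y b \<in> borel_measurable Q"
      using mI[OF S(1) A] mX mY S by auto
    have KS: "K - S = insert b (K - insert b S)" using S by auto
    \<comment> \<open>The frequency at b becomes v and the remaining ones are scaled by c, so the
      induction hypothesis covers the phases with c = 0, 1, -1 that arise from \<open>cosid\<close>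
      and \<open>sinid\<close>.\<close>
    have th: "th S (\<lambda>a. if a = b then v else c * u a) x = v * X b x + c * th (insert b S) u x"
      and th': "th' S (\<lambda>a. if a = b then v else c * u a) y = v * Y b y + c * th' (insert b S) u y" for v c x y
      unfolding th_def th'_def KS using K
      by (subst sum.insert; auto simp: sum_distrib_left mult_ac intro!: sum.cong)+
    let ?t = "th (insert b S) u" and ?t' = "th' (insert b S) u"
    have intP: "integrable P (\<lambda>x. I S A x *\<^sub>R iexp (f x))" if [measurable]: "f \<in> borel_measurable P" for f
      using I01 by (intro P.integrable_const_bound[where B=1]) (auto)
    have intQ: "integrable Q (\<lambda>x. I' S A x *\<^sub>R iexp (f x))" if [measurable]: "f \<in> borel_measurable Q" for f
      using I01 by (intro Q.integrable_const_bound[where B=1]) (auto)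
    have e: "(CLINT x|P. I S A x *\<^sub>R iexp (v * X b x + c * ?t x)) = (CLINT x|Q. I' S A x *\<^sub>R iexp (v * Y b x + c * ?t' x))" for v c
      using IH[of "\<lambda>a. if a = b then v else c * u a"] unfolding th th' .
    have cosid: "(p * (1 + cos t)) *\<^sub>R iexp w = p *\<^sub>R iexp (w + 0 * t) + (p *\<^sub>R iexp (w + 1 * t) + p *\<^sub>R iexp (w + (-1) * t)) / 2"
      for p t w :: real
      by (simp add: complex_eq_iff exp_add cos_add sin_add scaleR_conv_of_real algebra_simps Re_exp Im_exp cos_diff sin_diff)
    have sinid: "(p * (1 + sin t)) *\<^sub>R iexp w = p *\<^sub>R iexp (w + 0 * t) + (p *\<^sub>R iexp (w + 1 * t) - p *\<^sub>R iexp (w + (-1) * t)) / (2 * \<i>)"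
      for p t w :: real
      by (simp add: complex_eq_iff exp_add cos_add sin_add scaleR_conv_of_real algebra_simps Re_exp Im_exp cos_diff sin_diff Re_divide Im_divide power2_eq_square)
    define EP where "EP v c x = I S A x *\<^sub>R iexp (v * X b x + c * ?t x)" for v c x
    define EQ where "EQ v c x = I' S A x *\<^sub>R iexp (v * Y b x + c * ?t' x)" for v c x
    have iE: "integrable P (EP v c)" "integrable Q (EQ v c)" for v c
      unfolding EP_def EQ_def by (rule intP intQ; measurable)+
    have eE: "(CLINT x|P. EP v c x) = (CLINT x|Q. EQ v c x)" for v c
      unfolding EP_def EQ_def by (rule e)
    have ec: "(CLINT x|P. (I S A x * (1 + cos (?t x))) *\<^sub>R iexp (v * X b x)) = (CLINT x|Q. (I' S A x * (1 + cos (?t' x))) *\<^sub>R iexp (v * Y b x))" for v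
      unfolding cosid EP_def[symmetric] EQ_def[symmetric] using iE by (simp add: eE)
    have es: "(CLINT x|P. (I S A x * (1 + sin (?t x))) *\<^sub>R iexp (v * X b x)) = (CLINT x|Q. (I' S A x * (1 + sin (?t' x))) *\<^sub>R iexp (v * Y b x))" for v
      unfolding sinid EP_def[symmetric] EQ_def[symmetric] using iE by (simp add: eE)
    have bd: "0 \<le> p * (1 + cos t)" "p * (1 + cos t) \<le> 2" "0 \<le> p * (1 + sin t)" "p * (1 + sin t) \<le> 2"
      if "0 \<le> p" "p \<le> 1" for p t :: real
    proof -
      have "-1 \<le> cos t" "cos t \<le> 1" "-1 \<le> sin t" "sin t \<le> 1" by auto
      then have "0 \<le> 1 + cos t" "1 + cos t \<le> 2" "0 \<le> 1 + sin t" "1 + sin t \<le> 2" by linarith+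
      then show "0 \<le> p * (1 + cos t)" "0 \<le> p * (1 + sin t)" "p * (1 + cos t) \<le> 2" "p * (1 + sin t) \<le> 2"
        using that mult_mono[of p 1 "1 + cos t" 2] mult_mono[of p 1 "1 + sin t" 2] by (auto intro!: mult_nonneg_nonneg)
    qed
    have c1: "(\<integral>x. (I S A x * (1 + cos (?t x))) * indicator (A b) (X b x) \<partial>P) = (\<integral>x. (I' S A x * (1 + cos (?t' x))) * indicator (A b) (Y b x) \<partial>Q)"
      by (rule weighted_law_unique[where c=2]) (use assms(1,2) bd I01 ec A in auto)
    have s1: "(\<integral>x. (I S A x * (1 + sin (?t x))) * indicator (A b) (X b x) \<partial>P) = (\<integral>x. (I' S A x * (1 + sin (?t' x))) * indicator (A b) (Y b x) \<partial>Q)"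
      by (rule weighted_law_unique[where c=2]) (use assms(1,2) bd I01 es A in auto)
    have n1: "(\<integral>x. I S A x * indicator (A b) (X b x) \<partial>P) = (\<integral>x. I' S A x * indicator (A b) (Y b x) \<partial>Q)"
      by (rule weighted_law_unique[where c=1]) (use assms(1,2) I01 e[of _ 0] A in auto)
    have Ii: "I (insert b S) A x = I S A x * indicator (A b) (X b x)"
      "I' (insert b S) A y = I' S A y * indicator (A b) (Y b y)" for x y
      unfolding I_def I'_def using S by auto
    have [measurable]: "I (insert b S) A \<in> borel_measurable P" "I' (insert b S) A \<in> borel_measurable Q"
      using mI[OF insert.prems(1) A] by auto
    have bP: "integrable P (\<lambda>x. I (insert b S) A x * f x)" if [measurable]: "f \<in> borel_measurable P" and "\<And>x. \<bar>f x\<bar> \<le> 1" for f :: "_ \<Rightarrow> real"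
      using I01 that by (intro P.integrable_const_bound[where B=1]) (auto simp: abs_mult intro!: mult_le_one)
    have bQ: "integrable Q (\<lambda>x. I' (insert b S) A x * f x)" if [measurable]: "f \<in> borel_measurable Q" and "\<And>x. \<bar>f x\<bar> \<le> 1" for f :: "_ \<Rightarrow> real"
      using I01 that by (intro Q.integrable_const_bound[where B=1]) (auto simp: abs_mult intro!: mult_le_one)
    have P1: "integrable P (I (insert b S) A)" using bP[of "\<lambda>_. 1"] by simp
    have Q1: "integrable Q (I' (insert b S) A)" using bQ[of "\<lambda>_. 1"] by simp
    \<comment> \<open>The weight 1 alone is covered as well. Subtracting its contribution leaves the
      pure cosine and sine, that is, the real and imaginary parts of the remaining
      exponential.\<close>
    have n2: "(\<integral>x. I (insert b S) A x \<partial>P) = (\<integral>x. I' (insert b S) A x \<partial>Q)"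
      using n1 unfolding Ii .
    have "(\<integral>x. I (insert b S) A x + I (insert b S) A x * cos (?t x) \<partial>P) = (\<integral>x. I' (insert b S) A x + I' (insert b S) A x * cos (?t' x) \<partial>Q)"
      using c1 unfolding Ii by (simp add: algebra_simps)
    then have c2: "(\<integral>x. I (insert b S) A x * cos (?t x) \<partial>P) = (\<integral>x. I' (insert b S) A x * cos (?t' x) \<partial>Q)"
      using n2 P1 Q1 bP bQ by (subst (asm) (1 2) Bochner_Integration.integral_add) auto
    have "(\<integral>x. I (insert b S) A x + I (insert b S) A x * sin (?t x) \<partial>P) = (\<integral>x. I' (insert b S) A x + I' (insert b S) A x * sin (?t' x) \<partial>Q)"
      using s1 unfolding Ii by (simp add: algebra_simps)
    then have s2: "(\<integral>x. I (insert b S) A x * sin (?t x) \<partial>P) = (\<integral>x. I' (insert b S) A x * sin (?t' x) \<partial>Q)"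
      using n2 P1 Q1 bP bQ by (subst (asm) (1 2) Bochner_Integration.integral_add) auto
    have ex: "p *\<^sub>R iexp t = complex_of_real (p * cos t) + \<i> * complex_of_real (p * sin t)" for p t :: real
      by (simp add: complex_eq_iff Re_exp Im_exp)
    show ?case unfolding ex
      using bP bQ c2 s2
      by (subst (1 2) Bochner_Integration.integral_add) (auto intro!: integrable_of_real integrable_mult_right simp del: of_real_mult)
  qed
  show ?thesis
  proof (rule measure_eqI_PiM_finite[OF K, where A = "\<lambda>_::nat. Pi\<^sub>E K (\<lambda>_. UNIV)"])
    fix A assume A: "\<And>i. i \<in> K \<Longrightarrow> A i \<in> sets (borel :: real measure)"
    \<comment> \<open>\<open>main\<close> wants a Borel set for every index, hence the default {}
      outside K.\<close>
    define A' where "A' i = (if i \<in> K then A i else {})" for i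
    have A' [measurable]: "A' i \<in> sets borel" for i using A by (auto simp: A'_def)
    have mm [measurable]: "(\<lambda>x. \<lambda>a\<in>K. X a x) \<in> measurable P (\<Pi>\<^sub>M a\<in>K. borel)" "(\<lambda>x. \<lambda>a\<in>K. Y a x) \<in> measurable Q (\<Pi>\<^sub>M a\<in>K. borel)"
      by (auto intro!: measurable_restrict)
    have sA: "Pi\<^sub>E K A \<in> sets (\<Pi>\<^sub>M a\<in>K. borel)" using K A by (auto intro!: sets_PiM_I_finite)
    have i1: "indicator ((\<lambda>x. \<lambda>a\<in>K. X a x) -` Pi\<^sub>E K A \<inter> space P) x = I K A' x" if "x \<in> space P" for x
    proof (cases "\<forall>a\<in>K. X a x \<in> A a")
      case True then show ?thesis using that by (auto simp: I_def A'_def indicator_def)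
    next
      case False then show ?thesis using that K by (auto simp: I_def A'_def indicator_def)
    qed
    have i2: "indicator ((\<lambda>x. \<lambda>a\<in>K. Y a x) -` Pi\<^sub>E K A \<inter> space Q) x = I' K A' x" if "x \<in> space Q" for x
    proof (cases "\<forall>a\<in>K. Y a x \<in> A a")
      case True then show ?thesis using that by (auto simp: I'_def A'_def indicator_def)
    next
      case False then show ?thesis using that K by (auto simp: I'_def A'_def indicator_def)
    qed
    have h1: "P.prob ((\<lambda>x. \<lambda>a\<in>K. X a x) -` Pi\<^sub>E K A \<inter> space P) = (\<integral>x. I K A' x \<partial>P)"
      using i1 measurable_sets[OF mm(1) sA] by (subst Bochner_Integration.integral_cong[OF refl i1[symmetric]]) auto
    have "complex_of_real (\<integral>x. I K A' x \<partial>P) = (CLINT x|P. I K A' x *\<^sub>R iexp (th K (\<lambda>_. 0) x))"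
      by (simp add: th_def scaleR_conv_of_real)
    also have "\<dots> = (CLINT x|Q. I' K A' x *\<^sub>R iexp (th' K (\<lambda>_. 0) x))" using main[OF K order_refl A'] .
    also have "\<dots> = complex_of_real (\<integral>x. I' K A' x \<partial>Q)"
      by (simp add: th'_def scaleR_conv_of_real)
    finally have h2: "(\<integral>x. I K A' x \<partial>P) = (\<integral>x. I' K A' x \<partial>Q)" by simp
    have h3: "(\<integral>x. I' K A' x \<partial>Q) = Q.prob ((\<lambda>x. \<lambda>a\<in>K. Y a x) -` Pi\<^sub>E K A \<inter> space Q)"
      using i2 measurable_sets[OF mm(2) sA] by (subst Bochner_Integration.integral_cong[OF refl i2[symmetric]]) auto
    show "emeasure (distr P (\<Pi>\<^sub>M a\<in>K. borel) (\<lambda>x. \<lambda>a\<in>K. X a x)) (Pi\<^sub>E K A) = emeasure (distr Q (\<Pi>\<^sub>M a\<in>K. borel) (\<lambda>x. \<lambda>a\<in>K. Y a x)) (Pi\<^sub>E K A)"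
      unfolding emeasure_distr[OF mm(1) sA] emeasure_distr[OF mm(2) sA] P.emeasure_eq_measure Q.emeasure_eq_measure
        h1 h2 h3 ..
  next
    show "range (\<lambda>_::nat. Pi\<^sub>E K (\<lambda>_. UNIV :: real set)) \<subseteq> prod_algebra K (\<lambda>_. borel)"
      using K by (auto intro!: prod_algebraI_finite)
    show "(\<Union>i::nat. Pi\<^sub>E K (\<lambda>_. UNIV :: real set)) = space (\<Pi>\<^sub>M a\<in>K. borel)"
      by (auto simp: space_PiM)
    have "prob_space (distr P (\<Pi>\<^sub>M a\<in>K. borel) (\<lambda>x. \<lambda>a\<in>K. X a x))"
      by (intro P.prob_space_distr) (auto intro!: measurable_restrict)
    then show "emeasure (distr P (\<Pi>\<^sub>M a\<in>K. borel) (\<lambda>x. \<lambda>a\<in>K. X a x)) (Pi\<^sub>E K (\<lambda>_. UNIV)) \<noteq> \<infinity>" for i :: nat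
      by (metis finite_measure.emeasure_finite infinity_ennreal_def prob_space.finite_measure)
  qed simp_all
qed

text \<open>The factor (2p)! / (2^p p!) is the moment of order 2p of a standard normal variable.
  Writing the moment through the variance makes the formula hold for the degenerate variable 0 too,
  including p = 0.\<close>

lemma centred_normal_rv_moment:
  assumes "prob_space P" "centred_normal_rv P Z"
  shows "integrable P (\<lambda>x. Z x ^ (2 * p))"
    and "(\<integral>x. Z x ^ (2 * p) \<partial>P) = fact (2 * p) / (2 ^ p * fact p) * (\<integral>x. (Z x)\<^sup>2 \<partial>P) ^ p"
proof -
  interpret prob_space P by fact
  have [measurable]: "Z \<in> borel_measurable P" using assms(2) by (simp add: centred_normal_rv_def)
  have "integrable P (\<lambda>x. Z x ^ (2 * p)) \<and>
    (\<integral>x. Z x ^ (2 * p) \<partial>P) = fact (2 * p) / (2 ^ p * fact p) * (\<integral>x. (Z x)\<^sup>2 \<partial>P) ^ p"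
    using assms(2) unfolding centred_normal_rv_def
  proof (elim conjE disjE exE)
    assume z: "AE x in P. Z x = 0"
    have 1: "integrable P (\<lambda>x. Z x ^ (2 * p)) \<longleftrightarrow> integrable P (\<lambda>x. 0 ^ (2 * p) :: real)"
      using z by (intro integrable_cong_AE) auto
    have 2: "(\<integral>x. Z x ^ (2 * p) \<partial>P) = (\<integral>x. 0 ^ (2 * p) \<partial>P)"
      using z by (intro integral_cong_AE) auto
    have 3: "(\<integral>x. (Z x)\<^sup>2 \<partial>P) = (\<integral>x. 0 \<partial>P)"
      using z by (intro integral_cong_AE) auto
    show ?thesis unfolding 1 2 3 by (cases "p = 0") (auto simp: prob_space power_0_left)
  next
    fix \<sigma> :: real assume \<sigma>: "0 < \<sigma>" and D: "distributed P lborel Z (normal_density 0 \<sigma>)"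
    have m: "integrable P (\<lambda>x. Z x ^ (2 * q))" "(\<integral>x. Z x ^ (2 * q) \<partial>P) = fact (2 * q) / ((2 / \<sigma>\<^sup>2)^q * fact q)" for q
    proof -
      have "integrable lborel (\<lambda>x. normal_density 0 \<sigma> x * x ^ (2 * q))"
        using integrable_normal_moment[OF \<sigma>, of 0 "2 * q"] by simp
      then show "integrable P (\<lambda>x. Z x ^ (2 * q))"
        using distributed_integrable[OF D, of "\<lambda>x. x ^ (2 * q)"] by simp
      show "(\<integral>x. Z x ^ (2 * q) \<partial>P) = fact (2 * q) / ((2 / \<sigma>\<^sup>2)^q * fact q)"
        using distributed_integral[OF D, of "\<lambda>x. x ^ (2 * q)"] integral_normal_moment_even[OF \<sigma>, of 0 q] by simp
    qed
    have "(\<integral>x. (Z x)\<^sup>2 \<partial>P) = \<sigma>\<^sup>2" using m(2)[of 1] by (simp add: power2_eq_square)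
    then show ?thesis using m[of p] by (simp add: power_divide field_simps)
  qed
  then show "integrable P (\<lambda>x. Z x ^ (2 * p))"
    and "(\<integral>x. Z x ^ (2 * p) \<partial>P) = fact (2 * p) / (2 ^ p * fact p) * (\<integral>x. (Z x)\<^sup>2 \<partial>P) ^ p" by auto
qed

lemma centred_normal_rv_cf:
  assumes "prob_space P" "centred_normal_rv P Z"
  shows "(CLINT x|P. iexp (Z x)) = complex_of_real (exp (- (\<integral>x. (Z x)\<^sup>2 \<partial>P) / 2))"
proof -
  interpret prob_space P by fact
  have [measurable]: "Z \<in> borel_measurable P" using assms(2) by (simp add: centred_normal_rv_def)
  show ?thesis
    using assms(2) unfolding centred_normal_rv_def
  proof (elim conjE disjE exE)
    assume z: "AE x in P. Z x = 0"
    have 2: "(CLINT x|P. iexp (Z x)) = (CLINT x|P. 1)"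
      using z by (intro integral_cong_AE) auto
    have 3: "(\<integral>x. (Z x)\<^sup>2 \<partial>P) = (\<integral>x. 0 \<partial>P)"
      using z by (intro integral_cong_AE) auto
    show ?thesis unfolding 2 3 by (auto simp: prob_space)
  next
    fix \<sigma> :: real assume \<sigma>: "0 < \<sigma>" and D: "distributed P lborel Z (normal_density 0 \<sigma>)"
    have v: "(\<integral>x. (Z x)\<^sup>2 \<partial>P) = \<sigma>\<^sup>2"
      using distributed_integral[OF D, of "\<lambda>x. x\<^sup>2"] integral_normal_moment_even[OF \<sigma>, of 0 1] by (simp add: power2_eq_square)
    have D': "distributed P lborel (\<lambda>x. Z x / \<sigma>) std_normal_density"
      using normal_standard_normal_convert[OF \<sigma>, of Z 0] D by simp
    have "(CLINT x|P. iexp (Z x)) = (CLINT x|P. iexp (\<sigma> * (Z x / \<sigma>)))" using \<sigma> by simp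
    also have "\<dots> = (CLINT y|distr P lborel (\<lambda>x. Z x / \<sigma>). iexp (\<sigma> * y))"
      by (subst integral_distr) auto
    also have "\<dots> = char std_normal_distribution \<sigma>"
      using D' by (simp add: distributed_def char_def)
    also have "\<dots> = complex_of_real (exp (- \<sigma>\<^sup>2 / 2))" by (simp add: char_std_normal_distribution)
    finally show ?thesis by (simp add: v)
  qed
qed

text \<open>If a linear functional Z has variance v, the characteristic function of (Z(x) - Z(y)) /
  sqrt 2 at 1 is exp(-v/4) exp(-v/4) = exp(-v/2), as for Z itself; these values for all functionals
  determine the joint law.\<close>

lemma gaussian_difference_law:
  fixes X :: "'i \<Rightarrow> 'a \<Rightarrow> real"
  assumes P: "prob_space P" and K: "finite K"
    and G: "\<And>u. centred_normal_rv P (\<lambda>x. \<Sum>a\<in>K. u a * X a x)"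
  shows "distr P (\<Pi>\<^sub>M a\<in>K. borel) (\<lambda>x. \<lambda>a\<in>K. X a x)
    = distr (P \<Otimes>\<^sub>M P) (\<Pi>\<^sub>M a\<in>K. borel) (\<lambda>(x, y). \<lambda>a\<in>K. (X a x - X a y) / sqrt 2)"
proof -
  interpret P: prob_space P by fact
  interpret PP: pair_prob_space P P ..
  have mX [measurable]: "X a \<in> borel_measurable P" if "a \<in> K" for a
  proof -
    have "(\<lambda>x. \<Sum>b\<in>K. (if b = a then 1 else 0) * X b x) = X a"
      using that K by (simp add: if_distrib[of "\<lambda>c. c * _"] sum.delta cong: if_cong)
    with G[of "\<lambda>b. if b = a then 1 else 0"] show ?thesis by (simp add: centred_normal_rv_def)
  qed
  define Y where "Y a p = (X a (fst p) - X a (snd p)) / sqrt 2" for a p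
  have "distr P (\<Pi>\<^sub>M a\<in>K. borel) (\<lambda>x. \<lambda>a\<in>K. X a x) = distr (P \<Otimes>\<^sub>M P) (\<Pi>\<^sub>M a\<in>K. borel) (\<lambda>x. \<lambda>a\<in>K. Y a x)"
  proof (rule distr_PiM_eqI_cf[OF P _ K])
    show "prob_space (P \<Otimes>\<^sub>M P)" by (rule PP.prob_space_axioms)
    fix u :: "'i \<Rightarrow> real"
    define Z where "Z x = (\<Sum>a\<in>K. u a * X a x)" for x
    have Zm [measurable]: "Z \<in> borel_measurable P" unfolding Z_def by measurable
    define v where "v = (\<integral>x. (Z x)\<^sup>2 \<partial>P)"
    have cf: "(CLINT x|P. iexp (c * Z x)) = complex_of_real (exp (- (c\<^sup>2 * v) / 2))" for c
    proof -
      have "centred_normal_rv P (\<lambda>x. c * Z x)"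
        using G[of "\<lambda>a. c * u a"] by (simp add: Z_def sum_distrib_left mult.assoc)
      from centred_normal_rv_cf[OF P this] show ?thesis by (simp add: power_mult_distrib v_def)
    qed
    let ?s = "1 / sqrt 2"
    have iexp_add: "iexp (r + t) = iexp r * iexp t" for r t :: real
      by (simp add: exp_add distrib_left)
    have int: "integrable (P \<Otimes>\<^sub>M P) (\<lambda>(x, y). iexp (?s * Z x) * iexp (- ?s * Z y))"
      by (intro PP.integrable_const_bound[where B=1]) (auto simp: case_prod_beta norm_mult)
    have "(CLINT p|P \<Otimes>\<^sub>M P. iexp (\<Sum>a\<in>K. u a * Y a p)) = (CLINT p|P \<Otimes>\<^sub>M P. (case p of (x, y) \<Rightarrow> iexp (?s * Z x) * iexp (- ?s * Z y)))"
    proof (intro Bochner_Integration.integral_cong refl)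
      fix p
      have "(\<Sum>a\<in>K. u a * Y a p) = ?s * Z (fst p) + - ?s * Z (snd p)"
        by (simp add: Y_def Z_def sum_distrib_left sum_subtractf diff_divide_distrib right_diff_distrib sum_divide_distrib sum_negf)
      then show "iexp (\<Sum>a\<in>K. u a * Y a p) = (case p of (x, y) \<Rightarrow> iexp (?s * Z x) * iexp (- ?s * Z y))"
        by (simp only: case_prod_beta iexp_add)
    qed
    also have "\<dots> = (CLINT y|P. CLINT x|P. iexp (?s * Z x) * iexp (- ?s * Z y))"
      using PP.integral_snd[OF int] by simp
    also have "\<dots> = (CLINT x|P. iexp (?s * Z x)) * (CLINT x|P. iexp (- ?s * Z x))"
      by simp
    also have "\<dots> = complex_of_real (exp (- v / 2))"
      unfolding cf by (simp add: of_real_mult[symmetric] exp_add[symmetric] power_divide del: of_real_mult)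
    also have "\<dots> = (CLINT x|P. iexp (\<Sum>a\<in>K. u a * X a x))"
      using cf[of 1] by (simp add: Z_def)
    finally show "(CLINT x|P. iexp (\<Sum>a\<in>K. u a * X a x)) = (CLINT p|P \<Otimes>\<^sub>M P. iexp (\<Sum>a\<in>K. u a * Y a p))" ..
  qed (auto simp: Y_def)
  then show ?thesis by (simp add: Y_def case_prod_beta')
qed

section \<open>Duplication of independent components\<close>

lemma prob_square_integral_le:
  fixes f :: "'a \<Rightarrow> real"
  assumes "prob_space P" and [measurable]: "f \<in> borel_measurable P" and f: "\<And>x. \<bar>f x\<bar> \<le> B"
  shows "(\<integral>x. f x \<partial>P)\<^sup>2 \<le> (\<integral>x. (f x)\<^sup>2 \<partial>P)"
proof -
  interpret prob_space P by fact
  have i1: "integrable P f" using f by (intro integrable_const_bound[where B=B]) auto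
  have i2: "integrable P (\<lambda>x. (f x)\<^sup>2)"
    using f by (intro integrable_const_bound[where B="B\<^sup>2"]) (auto simp: abs_le_square_iff[symmetric] intro: order_trans abs_ge_self)
  have "0 \<le> variance f" by (intro Bochner_Integration.integral_nonneg) auto
  then show ?thesis using variance_eq[OF i1 i2] by simp
qed

definition mix :: "'i set \<Rightarrow> ('i \<Rightarrow> 'b) \<Rightarrow> ('i \<Rightarrow> 'b) \<Rightarrow> 'i \<Rightarrow> 'b" where
  "mix a w w' = (\<lambda>i. if i \<in> a then w' i else w i)"

context
  fixes \<mu> :: "'i::finite \<Rightarrow> 'b measure" and N
  assumes \<mu>: "\<And>i. prob_space (\<mu> i)"
  defines "N \<equiv> PiM UNIV \<mu>"
begin

lemma prob_space_N: "prob_space N"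
  unfolding N_def by (intro prob_space_PiM \<mu>)

lemma upd_measurable [measurable]: "(\<lambda>(w, v). w(i := v)) \<in> measurable (N \<Otimes>\<^sub>M \<mu> i) N"
  using measurable_add_dim[of i UNIV \<mu>] by (simp add: N_def)

text \<open>A product measure does not change when coordinate i is redrawn independently of the
  others.\<close>

lemma resample_eq:
  fixes f :: "('i \<Rightarrow> 'b) \<Rightarrow> real"
  assumes [measurable]: "f \<in> borel_measurable N" and f: "\<And>w. \<bar>f w\<bar> \<le> B"
  shows "(\<integral>w. f w \<partial>N) = (\<integral>w. (\<integral>v. f (w(i := v)) \<partial>\<mu> i) \<partial>N)"
proof -
  interpret N: prob_space N by (rule prob_space_N)
  interpret mi: prob_space "\<mu> i" by (rule \<mu>)
  interpret pair_prob_space "\<mu> i" N ..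
  have m [measurable]: "(\<lambda>(v, w). w(i := v)) \<in> measurable (\<mu> i \<Otimes>\<^sub>M N) N"
    using measurable_compose[OF measurable_pair_swap' upd_measurable] by (simp add: case_prod_beta comp_def)
  have d: "distr (\<mu> i \<Otimes>\<^sub>M N) N (\<lambda>(v, w). w(i := v)) = N"
    using distr_pair_PiM_eq_PiM[of UNIV \<mu> i] \<mu> by (simp add: N_def)
  have int: "integrable (\<mu> i \<Otimes>\<^sub>M N) (\<lambda>(v, w). f (w(i := v)))"
  proof (rule integrable_const_bound[where B=B])
    show "AE x in \<mu> i \<Otimes>\<^sub>M N. norm (case x of (v, w) \<Rightarrow> f (w(i := v))) \<le> B" using f by auto
    show "(\<lambda>(v, w). f (w(i := v))) \<in> borel_measurable (\<mu> i \<Otimes>\<^sub>M N)"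
      using measurable_compose[OF m assms(1)] by (simp add: case_prod_beta)
  qed
  have "(\<integral>w. f w \<partial>N) = (\<integral>w. f w \<partial>distr (\<mu> i \<Otimes>\<^sub>M N) N (\<lambda>(v, w). w(i := v)))" by (simp only: d)
  also have "\<dots> = (\<integral>x. (case x of (v, w) \<Rightarrow> f (w(i := v))) \<partial>(\<mu> i \<Otimes>\<^sub>M N))"
    by (subst integral_distr[OF m]) (auto simp: case_prod_beta')
  also have "\<dots> = (\<integral>w. (\<integral>v. f (w(i := v)) \<partial>\<mu> i) \<partial>N)"
    using integral_snd[OF int] by simp
  finally show ?thesis .
qed

text \<open>Let h be the mean of f over coordinate i. By invariance f and h have the same integral,
  and (E h)^2 \<le> E h^2. Since h no longer depends on coordinate i, E h^2 = E (f h), which is the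
  right-hand side.\<close>

lemma resample_ge:
  fixes f :: "('i \<Rightarrow> 'b) \<Rightarrow> real"
  assumes [measurable]: "f \<in> borel_measurable N" and f: "\<And>w. \<bar>f w\<bar> \<le> 1"
  shows "(\<integral>w. f w \<partial>N)\<^sup>2 \<le> (\<integral>w. (\<integral>v. f w * f (w(i := v)) \<partial>\<mu> i) \<partial>N)"
proof -
  interpret N: prob_space N by (rule prob_space_N)
  interpret mi: prob_space "\<mu> i" by (rule \<mu>)
  define h where "h w = (\<integral>v. f (w(i := v)) \<partial>\<mu> i)" for w
  have fm: "(\<lambda>(w, v). f (w(i := v))) \<in> borel_measurable (N \<Otimes>\<^sub>M \<mu> i)"
    using measurable_compose[OF upd_measurable assms(1)] by (simp add: case_prod_beta)
  have hm [measurable]: "h \<in> borel_measurable N"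
    unfolding h_def using mi.borel_measurable_lebesgue_integral[OF fm] by simp
  have h1: "\<bar>h w\<bar> \<le> 1" for w
  proof (cases "integrable (\<mu> i) (\<lambda>v. f (w(i := v)))")
    case True
    then have "\<bar>h w\<bar> \<le> (\<integral>v. \<bar>f (w(i := v))\<bar> \<partial>\<mu> i)" unfolding h_def by (intro integral_abs_bound)
    also have "\<dots> \<le> (\<integral>v. 1 \<partial>\<mu> i)" using f True by (intro integral_mono) auto
    finally show ?thesis by (simp add: mi.prob_space)
  next
    case False then show ?thesis by (simp add: h_def not_integrable_integral_eq)
  qed
  have "(\<integral>w. f w \<partial>N)\<^sup>2 = (\<integral>w. h w \<partial>N)\<^sup>2"
    using resample_eq[OF assms(1), of 1 i] f by (simp add: h_def)
  also have "\<dots> \<le> (\<integral>w. (h w)\<^sup>2 \<partial>N)"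
    by (rule prob_square_integral_le[OF prob_space_N hm h1])
  also have "\<dots> = (\<integral>w. (\<integral>v. f (w(i := v)) * h (w(i := v)) \<partial>\<mu> i) \<partial>N)"
    by (intro Bochner_Integration.integral_cong refl) (simp add: h_def power2_eq_square)
  also have "\<dots> = (\<integral>w. f w * h w \<partial>N)"
    using f h1 by (subst resample_eq[of _ 1 i]) (auto simp: abs_mult intro!: mult_le_one)
  also have "\<dots> = (\<integral>w. (\<integral>v. f w * f (w(i := v)) \<partial>\<mu> i) \<partial>N)"
    unfolding h_def by simp
  finally show ?thesis .
qed

lemma mix_measurable [measurable]: "(\<lambda>(w, w'). mix a w w') \<in> measurable (N \<Otimes>\<^sub>M N) N"
proof -
  have "(\<lambda>p. \<lambda>i\<in>UNIV. if i \<in> a then snd p i else fst p i) \<in> measurable (N \<Otimes>\<^sub>M N) (PiM UNIV \<mu>)"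
  proof (rule measurable_restrict)
    fix i
    have "(\<lambda>w. w i) \<in> measurable N (\<mu> i)" unfolding N_def by (rule measurable_component_singleton) simp
    from measurable_compose[OF measurable_fst this, of N] measurable_compose[OF measurable_snd this, of N]
    show "(\<lambda>p. if i \<in> a then snd p i else fst p i) \<in> measurable (N \<Otimes>\<^sub>M N) (\<mu> i)" by auto
  qed
  then show ?thesis by (simp add: N_def mix_def case_prod_beta restrict_def)
qed

text \<open>Duplicating one coordinate at a time, each step is Cauchy--Schwarz.\<close>

lemma box_inequality:
  fixes f :: "('i \<Rightarrow> 'b) \<Rightarrow> real"
  assumes fm [measurable]: "f \<in> borel_measurable N" and f: "\<And>w. 0 \<le> f w" "\<And>w. f w \<le> 1"
  shows "(\<integral>w. f w \<partial>N) ^ (2 ^ card S) \<le> (\<integral>w'. (\<integral>w. (\<Prod>a\<in>Pow S. f (mix a w w')) \<partial>N) \<partial>N)"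
proof -
  interpret N: prob_space N by (rule prob_space_N)
  interpret NN: pair_prob_space N N ..
  have "finite S" by simp
  then show ?thesis
  proof (induction S rule: finite_induct)
    case empty
    then show ?case by (simp add: mix_def N.prob_space)
  next
    case (insert i S)
    interpret mi: prob_space "\<mu> i" by (rule \<mu>)
    define G where "G w w' = (\<Prod>a\<in>Pow S. f (mix a w w'))" for w w'
    have G01: "0 \<le> G w w'" "G w w' \<le> 1" for w w'
      unfolding G_def using f by (auto intro!: prod_nonneg prod_le_1)
    have Gm [measurable]: "(\<lambda>(w, w'). G w w') \<in> borel_measurable (N \<Otimes>\<^sub>M N)"
      unfolding G_def using measurable_compose[OF mix_measurable fm] by (simp add: case_prod_beta)
    \<comment> \<open>A subset of S never contains i, so the mixtures in G ignore coordinate i of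
      w'. This leaves that coordinate free to store the fresh sample for coordinate i of w.\<close>
    have Gupd: "G w (w'(i := v)) = G w w'" for w w' v
      unfolding G_def using insert by (intro prod.cong refl arg_cong[where f=f]) (auto simp: mix_def fun_eq_iff)
    have prod: "(\<Prod>a\<in>Pow (insert i S). f (mix a w w')) = G w w' * G (w(i := w' i)) w'" for w w'
    proof -
      have "(\<Prod>a\<in>Pow (insert i S). f (mix a w w')) = (\<Prod>a\<in>Pow S. f (mix a w w')) * (\<Prod>a\<in>insert i ` Pow S. f (mix a w w'))"
        unfolding Pow_insert using insert by (intro prod.union_disjoint) auto
      also have "(\<Prod>a\<in>insert i ` Pow S. f (mix a w w')) = (\<Prod>a\<in>Pow S. f (mix (insert i a) w w'))"
        using insert by (subst prod.reindex) (auto simp: inj_on_def)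
      also have "\<dots> = G (w(i := w' i)) w'"
        unfolding G_def using insert by (intro prod.cong refl arg_cong[where f=f]) (auto simp: mix_def fun_eq_iff)
      finally show ?thesis by (simp add: G_def)
    qed
    have im: "(\<lambda>w. \<integral>x. g w x \<partial>N) \<in> borel_measurable N" if "(\<lambda>(w, x). g w x) \<in> borel_measurable (N \<Otimes>\<^sub>M N)" for g :: "_ \<Rightarrow> _ \<Rightarrow> real"
      using N.borel_measurable_lebesgue_integral[OF that] .
    have Gm': "(\<lambda>(w', w). G w w') \<in> borel_measurable (N \<Otimes>\<^sub>M N)"
      using measurable_compose[OF measurable_pair_swap' Gm] by (simp add: case_prod_beta)
    have cm: "(\<lambda>w. w i) \<in> measurable N (\<mu> i)" unfolding N_def by (rule measurable_component_singleton) simp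
    have um: "(\<lambda>(w, w'). w(i := w' i)) \<in> measurable (N \<Otimes>\<^sub>M N) N"
    proof -
      have "(\<lambda>(w, w'). (w, w' i)) \<in> measurable (N \<Otimes>\<^sub>M N) (N \<Otimes>\<^sub>M \<mu> i)"
        using measurable_compose[OF measurable_snd cm, of N] by (auto simp: case_prod_beta intro!: measurable_Pair)
      from measurable_compose[OF this upd_measurable] show ?thesis by (simp add: case_prod_beta)
    qed
    have Gm2: "(\<lambda>(w, w'). G (w(i := w' i)) w') \<in> borel_measurable (N \<Otimes>\<^sub>M N)"
    proof -
      have "(\<lambda>(w, w'). (w(i := w' i), w')) \<in> measurable (N \<Otimes>\<^sub>M N) (N \<Otimes>\<^sub>M N)"
        using um by (auto simp: case_prod_beta intro!: measurable_Pair)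
      from measurable_compose[OF this Gm] show ?thesis by (simp add: case_prod_beta)
    qed
    have Gm2': "(\<lambda>(w', w). G (w(i := w' i)) w') \<in> borel_measurable (N \<Otimes>\<^sub>M N)"
      using measurable_compose[OF measurable_pair_swap' Gm2] by (simp add: case_prod_beta)
    define H where "H w' = (\<integral>w. G w w' * G (w(i := w' i)) w' \<partial>N)" for w'
    have Hm [measurable]: "H \<in> borel_measurable N"
      unfolding H_def using Gm' Gm2' by (intro im) (auto simp: case_prod_beta)
    have ib: "0 \<le> (\<integral>w. g w \<partial>N) \<and> (\<integral>w. g w \<partial>N) \<le> 1" if "\<And>w. 0 \<le> g w" "\<And>w. g w \<le> 1" for g :: "_ \<Rightarrow> real"
    proof (cases "integrable N g")
      case True
      then have "(\<integral>w. g w \<partial>N) \<le> (\<integral>w. 1 \<partial>N)" using that by (intro integral_mono) auto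
      then show ?thesis using that by (simp add: N.prob_space)
    next
      case False then show ?thesis by (simp add: not_integrable_integral_eq)
    qed
    have H01: "0 \<le> H w'" "H w' \<le> 1" for w' unfolding H_def
      using ib[of "\<lambda>w. G w w' * G (w(i := w' i)) w'"] G01 by (auto intro!: mult_le_one)
    define Q where "Q w' = (\<integral>w. G w w' \<partial>N)" for w'
    have Qm [measurable]: "Q \<in> borel_measurable N" unfolding Q_def using Gm' by (intro im)
    have Q01: "0 \<le> Q w'" "Q w' \<le> 1" for w' unfolding Q_def using ib G01 by auto
    have Gs: "(\<lambda>w. G w w') \<in> borel_measurable N" if "w' \<in> space N" for w'
    proof -
      have "(\<lambda>w. (w, w')) \<in> measurable N (N \<Otimes>\<^sub>M N)" using that by auto
      from measurable_compose[OF this Gm] show ?thesis by simp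
    qed
    have key: "(Q w')\<^sup>2 \<le> (\<integral>v. H (w'(i := v)) \<partial>\<mu> i)" if w': "w' \<in> space N" for w'
    proof -
      interpret pair_prob_space N "\<mu> i" ..
      have "(Q w')\<^sup>2 \<le> (\<integral>w. (\<integral>v. G w w' * G (w(i := v)) w' \<partial>\<mu> i) \<partial>N)"
        unfolding Q_def using Gs[OF w'] G01 by (intro resample_ge) auto
      also have "\<dots> = (\<integral>v. (\<integral>w. G w w' * G (w(i := v)) w' \<partial>N) \<partial>\<mu> i)"
      proof (rule Fubini_integral[symmetric])
        have "(\<lambda>(w, v). G w w' * G (w(i := v)) w') \<in> borel_measurable (N \<Otimes>\<^sub>M \<mu> i)"
          using measurable_compose[OF upd_measurable Gs[OF w']] measurable_compose[OF measurable_fst Gs[OF w'], of "\<mu> i"]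
          by (auto simp: case_prod_beta)
        then show "integrable (N \<Otimes>\<^sub>M \<mu> i) (\<lambda>(w, v). G w w' * G (w(i := v)) w')"
          using G01 by (intro integrable_const_bound[where B=1]) (auto simp: abs_mult intro!: mult_le_one AE_I2)
      qed
      also have "\<dots> = (\<integral>v. H (w'(i := v)) \<partial>\<mu> i)" unfolding H_def by (simp add: Gupd)
      finally show ?thesis .
    qed
    \<comment> \<open>One more coordinate doubles the exponent: the induction hypothesis is squared,
      and the square passes under both integrals, once by Jensen in w' and once by
      \<open>key\<close> in w.\<close>
    have "(\<integral>w. f w \<partial>N) ^ (2 ^ card (insert i S)) = ((\<integral>w. f w \<partial>N) ^ (2 ^ card S))\<^sup>2"
      using insert by (simp add: power_mult[symmetric] mult.commute)
    also have "\<dots> \<le> (\<integral>w'. Q w' \<partial>N)\<^sup>2"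
      using insert.IH f unfolding Q_def G_def by (intro power_mono) auto
    also have "\<dots> \<le> (\<integral>w'. (Q w')\<^sup>2 \<partial>N)"
      using Q01 by (intro prob_square_integral_le[where B=1] prob_space_N) auto
    also have "\<dots> \<le> (\<integral>w'. (\<integral>v. H (w'(i := v)) \<partial>\<mu> i) \<partial>N)"
    proof (rule integral_mono)
      show "integrable N (\<lambda>w'. (Q w')\<^sup>2)"
        using Q01 by (intro N.integrable_const_bound[where B=1]) (auto simp: power_le_one)
      have fm: "(\<lambda>(w, v). H (w(i := v))) \<in> borel_measurable (N \<Otimes>\<^sub>M \<mu> i)"
        using measurable_compose[OF upd_measurable Hm] by (simp add: case_prod_beta)
      have b: "0 \<le> (\<integral>v. H (w(i := v)) \<partial>\<mu> i) \<and> (\<integral>v. H (w(i := v)) \<partial>\<mu> i) \<le> 1" for w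
      proof (cases "integrable (\<mu> i) (\<lambda>v. H (w(i := v)))")
        case True
        then have "(\<integral>v. H (w(i := v)) \<partial>\<mu> i) \<le> (\<integral>v. 1 \<partial>\<mu> i)" using H01 by (intro integral_mono) auto
        then show ?thesis using H01 by (simp add: mi.prob_space)
      next
        case False then show ?thesis by (simp add: not_integrable_integral_eq)
      qed
      show "integrable N (\<lambda>w'. \<integral>v. H (w'(i := v)) \<partial>\<mu> i)"
        using mi.borel_measurable_lebesgue_integral[OF fm] b
        by (intro N.integrable_const_bound[where B=1]) auto
    qed (rule key)
    also have "\<dots> = (\<integral>w'. H w' \<partial>N)"
      using H01 by (intro resample_eq[of H 1 i, symmetric]) auto
    finally show ?case unfolding H_def prod .
  qed
qed

end

section \<open>A code of large probability\<close>

text \<open>The weights \<open>exp (- L |z|)\<close> bound the number of codes with small cost \<open>\<Sum>\<theta>. L \<theta> |z \<theta>|\<close>, and by Markov's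
  inequality the cost is small with probability more than one half.\<close>

lemma pigeonhole_code:
  fixes Z :: "'k \<Rightarrow> 'a \<Rightarrow> int" and L a b :: "'k \<Rightarrow> real"
  assumes "prob_space P" and fin: "finite \<Theta>"
    and Zm [measurable]: "\<And>\<theta>. \<theta> \<in> \<Theta> \<Longrightarrow> Z \<theta> \<in> measurable P (count_space UNIV)"
    and L: "\<And>\<theta>. \<theta> \<in> \<Theta> \<Longrightarrow> 0 < L \<theta>"
    and int: "\<And>\<theta>. \<theta> \<in> \<Theta> \<Longrightarrow> integrable P (\<lambda>x. real_of_int \<bar>Z \<theta> x\<bar>)"
    and a: "\<And>\<theta>. \<theta> \<in> \<Theta> \<Longrightarrow> L \<theta> * (\<integral>x. real_of_int \<bar>Z \<theta> x\<bar> \<partial>P) \<le> a \<theta>"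
    and b: "\<And>\<theta> m. \<theta> \<in> \<Theta> \<Longrightarrow> (\<Sum>z\<in>{- int m..int m}. exp (- L \<theta> * real_of_int \<bar>z\<bar>)) \<le> exp (b \<theta>)"
  shows "\<exists>z. exp (- (\<Sum>\<theta>\<in>\<Theta>. 2 * a \<theta> + b \<theta>) - 2) \<le> measure P {x \<in> space P. \<forall>\<theta>\<in>\<Theta>. Z \<theta> x = z \<theta>}"
proof (rule ccontr)
  interpret prob_space P by fact
  \<comment> \<open>Markov's inequality is used at K, twice the bound on the mean cost; the added 1
    keeps K positive and makes the resulting probability strictly less than one half.\<close>
  define K where "K = 2 * (\<Sum>\<theta>\<in>\<Theta>. a \<theta>) + 1"
  have a0: "0 \<le> a \<theta>" if "\<theta> \<in> \<Theta>" for \<theta>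
    using a[OF that] L[OF that] by (smt (verit) integral_nonneg_AE AE_I2 mult_nonneg_nonneg of_int_0_le_iff abs_ge_zero)
  then have sa: "0 \<le> (\<Sum>\<theta>\<in>\<Theta>. a \<theta>)" by (intro sum_nonneg)
  then have K: "0 < K" unfolding K_def by simp
  define c where "c = exp (- (\<Sum>\<theta>\<in>\<Theta>. 2 * a \<theta> + b \<theta>) - 2)"
  assume "\<not> (\<exists>z. exp (- (\<Sum>\<theta>\<in>\<Theta>. 2 * a \<theta> + b \<theta>) - 2) \<le> measure P {x \<in> space P. \<forall>\<theta>\<in>\<Theta>. Z \<theta> x = z \<theta>})"
  then have small: "measure P {x \<in> space P. \<forall>\<theta>\<in>\<Theta>. Z \<theta> x = z \<theta>} < c" for z by (auto simp: c_def not_le)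
  define X where "X x = (\<Sum>\<theta>\<in>\<Theta>. L \<theta> * real_of_int \<bar>Z \<theta> x\<bar>)" for x
  have Xi: "integrable P X" unfolding X_def using int by auto
  have [measurable]: "X \<in> borel_measurable P" using Xi by auto
  have "(\<integral>x. X x \<partial>P) = (\<Sum>\<theta>\<in>\<Theta>. L \<theta> * (\<integral>x. real_of_int \<bar>Z \<theta> x\<bar> \<partial>P))"
    unfolding X_def using int by (subst Bochner_Integration.integral_sum) auto
  also have "\<dots> \<le> (\<Sum>\<theta>\<in>\<Theta>. a \<theta>)" using a by (intro sum_mono)
  finally have EX: "(\<integral>x. X x \<partial>P) \<le> (\<Sum>\<theta>\<in>\<Theta>. a \<theta>)" .
  have X0: "0 \<le> X x" for x unfolding X_def using L by (intro sum_nonneg mult_nonneg_nonneg) (auto intro: less_imp_le)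
  have "prob {x \<in> space P. K \<le> X x} \<le> (\<integral>x. X x \<partial>P) / K"
    using integral_Markov_inequality_measure[OF Xi, of "{}" K] X0 K by simp
  also have "\<dots> \<le> (\<Sum>\<theta>\<in>\<Theta>. a \<theta>) / K" using EX K by (intro divide_right_mono) auto
  also have "\<dots> < 1 / 2" using sa by (auto simp: K_def field_simps)
  finally have "prob {x \<in> space P. K \<le> X x} < 1 / 2" .
  moreover have "prob {x \<in> space P. X x < K} = 1 - prob {x \<in> space P. K \<le> X x}"
    by (subst prob_compl[symmetric]) (auto intro!: arg_cong[where f=prob])
  ultimately have big: "1 / 2 < prob {x \<in> space P. X x < K}" by simp
  \<comment> \<open>All entries of a code of cost below K are at most K / L \<theta> in modulus, so
    this cutoff loses nothing and leaves finitely many codes.\<close>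
  define m where "m = nat (\<Sum>\<theta>\<in>\<Theta>. \<lceil>K / L \<theta>\<rceil>)"
  have m: "K / L \<theta> \<le> real m" if "\<theta> \<in> \<Theta>" for \<theta>
  proof -
    have n: "0 \<le> \<lceil>K / L \<theta>'\<rceil>" if "\<theta>' \<in> \<Theta>" for \<theta>'
    proof -
      have "0 < K / L \<theta>'" using K L[OF that] by simp
      then show ?thesis by linarith
    qed
    have "\<lceil>K / L \<theta>\<rceil> \<le> (\<Sum>\<theta>\<in>\<Theta>. \<lceil>K / L \<theta>\<rceil>)" using n that fin by (intro member_le_sum) auto
    also have "\<dots> \<le> int m" unfolding m_def by simp
    finally have "\<lceil>K / L \<theta>\<rceil> \<le> int m" .
    then show ?thesis by (simp add: ceiling_le_iff)
  qed
  define S where "S = {z \<in> Pi\<^sub>E \<Theta> (\<lambda>_. {- int m..int m}). (\<Sum>\<theta>\<in>\<Theta>. L \<theta> * real_of_int \<bar>z \<theta>\<bar>) \<le> K}"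
  have "finite (Pi\<^sub>E \<Theta> (\<lambda>_. {- int m..int m}))" using fin by (intro finite_PiE) auto
  then have finS: "finite S" by (rule finite_subset[rotated]) (auto simp: S_def)
  have "{x \<in> space P. X x < K} \<subseteq> (\<Union>z\<in>S. {x \<in> space P. \<forall>\<theta>\<in>\<Theta>. Z \<theta> x = z \<theta>})"
  proof
    fix x assume x: "x \<in> {x \<in> space P. X x < K}"
    define z where "z = (\<lambda>\<theta>\<in>\<Theta>. Z \<theta> x)"
    have "\<bar>Z \<theta> x\<bar> \<le> int m" if "\<theta> \<in> \<Theta>" for \<theta>
    proof -
      have "L \<theta> * real_of_int \<bar>Z \<theta> x\<bar> \<le> X x"
        unfolding X_def using that fin L by (intro member_le_sum[of \<theta> \<Theta> "\<lambda>\<theta>. L \<theta> * real_of_int \<bar>Z \<theta> x\<bar>"] mult_nonneg_nonneg) (auto intro: less_imp_le)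
      also have "\<dots> \<le> K" using x by simp
      finally have "real_of_int \<bar>Z \<theta> x\<bar> \<le> K / L \<theta>" using L[OF that] by (simp add: field_simps)
      also have "\<dots> \<le> real m" by (rule m[OF that])
      finally show ?thesis by linarith
    qed
    then have "z \<in> S" using x unfolding S_def z_def X_def by (auto simp: abs_le_iff minus_le_iff)
    moreover have "\<forall>\<theta>\<in>\<Theta>. Z \<theta> x = z \<theta>" by (simp add: z_def)
    ultimately show "x \<in> (\<Union>z\<in>S. {x \<in> space P. \<forall>\<theta>\<in>\<Theta>. Z \<theta> x = z \<theta>})" using x by blast
  qed
  moreover have ms: "{x \<in> space P. \<forall>\<theta>\<in>\<Theta>. Z \<theta> x = z \<theta>} \<in> sets P" for z
  proof -
    have "{x \<in> space P. Z \<theta> x = z \<theta>} \<in> sets P" if "\<theta> \<in> \<Theta>" for \<theta>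
      using measurable_sets[OF Zm[OF that], of "{z \<theta>}"] by (simp add: vimage_def Int_def conj_commute)
    then show ?thesis using fin by (intro sets.sets_Collect_finite_All)
  qed
  ultimately have "prob {x \<in> space P. X x < K} \<le> prob (\<Union>z\<in>S. {x \<in> space P. \<forall>\<theta>\<in>\<Theta>. Z \<theta> x = z \<theta>})"
    using finS by (intro finite_measure_mono) auto
  also have "\<dots> \<le> (\<Sum>z\<in>S. prob {x \<in> space P. \<forall>\<theta>\<in>\<Theta>. Z \<theta> x = z \<theta>})"
    using finS ms by (intro finite_measure_subadditive_finite) auto
  also have "\<dots> \<le> (\<Sum>z\<in>S. c)" using small by (intro sum_mono less_imp_le)
  also have "\<dots> = c * real (card S)" by simp
  \<comment> \<open>Each code in S has weight at least exp(-K), and the total weight of all codes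
    factorises over \<theta>.\<close>
  also have "real (card S) \<le> exp (K + (\<Sum>\<theta>\<in>\<Theta>. b \<theta>))"
  proof -
    have "real (card S) * exp (- K) = (\<Sum>z\<in>S. exp (- K))" by simp
    also have "\<dots> \<le> (\<Sum>z\<in>S. \<Prod>\<theta>\<in>\<Theta>. exp (- L \<theta> * real_of_int \<bar>z \<theta>\<bar>))"
      by (intro sum_mono) (auto simp: S_def exp_sum[OF fin, symmetric] sum_negf)
    also have "\<dots> \<le> (\<Sum>z\<in>Pi\<^sub>E \<Theta> (\<lambda>_. {- int m..int m}). \<Prod>\<theta>\<in>\<Theta>. exp (- L \<theta> * real_of_int \<bar>z \<theta>\<bar>))"
      using fin by (intro sum_mono2) (auto simp: S_def intro!: finite_PiE prod_nonneg)
    also have "\<dots> = (\<Prod>\<theta>\<in>\<Theta>. \<Sum>z\<in>{- int m..int m}. exp (- L \<theta> * real_of_int \<bar>z\<bar>))"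
      using fin by (subst prod_sum_PiE) auto
    also have "\<dots> \<le> (\<Prod>\<theta>\<in>\<Theta>. exp (b \<theta>))" using b by (intro prod_mono) (auto intro!: sum_nonneg)
    also have "\<dots> = exp (\<Sum>\<theta>\<in>\<Theta>. b \<theta>)" using fin by (simp add: exp_sum)
    finally show ?thesis by (simp add: exp_add exp_minus field_simps)
  qed
  \<comment> \<open>The 2 in the exponent of c absorbs the 1 in K and leaves exp(-1), which is at
    most 1/2 and contradicts \<open>big\<close>.\<close>
  also have "c * exp (K + (\<Sum>\<theta>\<in>\<Theta>. b \<theta>)) = exp (-1)"
    unfolding c_def K_def by (simp add: exp_add[symmetric] sum.distrib sum_distrib_left)
  also have "exp (-1) \<le> (1 / 2 :: real)"
    using exp_ge_add_one_self[of 1] by (simp add: exp_minus field_simps)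
  finally show False using big c_def by simp
qed

text \<open>A two-sided geometric series with ratio exp(-L), whose partial sums are computed
  exactly. The bound does not depend on the cutoff m, as the counting of codes requires.\<close>

lemma sum_exp_abs_le:
  fixes L :: real assumes L: "0 < L"
  shows "(\<Sum>z\<in>{- int m..int m}. exp (- L * real_of_int \<bar>z\<bar>)) \<le> 1 + 2 / (exp L - 1)"
proof -
  define q where "q = exp (- L)"
  have q: "q > 0" "exp L = 1 / q" "q < 1" using L by (auto simp: q_def exp_minus field_simps)
  have "(\<Sum>z\<in>{- int m..int m}. exp (- L * real_of_int \<bar>z\<bar>)) = 1 + 2 * (1 - q ^ m) / (exp L - 1)"
  proof (induction m)
    case (Suc m)
    have "{- int (Suc m)..int (Suc m)} = insert (- int (Suc m)) (insert (int (Suc m)) {- int m..int m})" by auto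
    then have "(\<Sum>z\<in>{- int (Suc m)..int (Suc m)}. exp (- L * real_of_int \<bar>z\<bar>))
      = 2 * exp (- L * real (Suc m)) + (\<Sum>z\<in>{- int m..int m}. exp (- L * real_of_int \<bar>z\<bar>))"
      by simp
    also have "exp (- L * real (Suc m)) = q ^ Suc m"
      unfolding q_def by (subst exp_of_nat_mult[symmetric]) (simp add: mult.commute)
    also have "2 * q ^ Suc m + (\<Sum>z\<in>{- int m..int m}. exp (- L * real_of_int \<bar>z\<bar>)) = 1 + 2 * (1 - q ^ Suc m) / (exp L - 1)"
    proof -
      have E: "exp L - 1 = (1 - q) / q" using q by (simp add: diff_divide_distrib)
      have "1 - q \<noteq> 0" using q by simp
      then show ?thesis unfolding Suc E using q(1) by (simp add: divide_simps) (simp add: algebra_simps)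
    qed
    finally show ?case .
  qed simp
  also have "\<dots> \<le> 1 + 2 / (exp L - 1)" using q L by (auto intro!: divide_right_mono)
  finally show ?thesis .
qed

lemma abs_round_le: "\<bar>real_of_int (round y)\<bar> \<le> 2 * \<bar>y\<bar>" for y :: real
proof (cases "round y = 0")
  case False
  then have "1 \<le> \<bar>real_of_int (round y)\<bar>" by linarith
  moreover have "\<bar>real_of_int (round y) - y\<bar> \<le> 1 / 2" by (rule of_int_round_abs_le)
  ultimately show ?thesis by linarith
qed simp

text \<open>A nonzero integer has modulus at least 1, so its modulus is bounded by any positive
  power of it. In this way small high moments of y give a small mean of the rounded value at fine
  levels.\<close>

lemma abs_round_le_power:
  fixes y :: real
  assumes "0 < p"
  shows "\<bar>real_of_int (round y)\<bar> \<le> (2 * y) ^ (2 * p)"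
proof (cases "round y = 0")
  case True
  have "0 \<le> (2 * y) ^ (2 * p)" by (simp only: power_mult) simp
  then show ?thesis using True by simp
next
  case False
  then have 1: "1 \<le> \<bar>real_of_int (round y)\<bar>" by linarith
  have "\<bar>real_of_int (round y)\<bar> ^ 1 \<le> \<bar>real_of_int (round y)\<bar> ^ (2 * p)"
    using 1 assms by (intro power_increasing) auto
  also have "\<dots> \<le> (2 * \<bar>y\<bar>) ^ (2 * p)" by (intro power_mono abs_round_le) auto
  also have "\<dots> = (2 * y) ^ (2 * p)" by (simp add: power_mult power_mult_distrib)
  finally show ?thesis by simp
qed

text \<open>Total entropy of 2^j variables with entropy J - j + 1 each. Geometric growth lets only
  the levels near J matter: raising J by one adds 2^J - 1 from the old terms and 2 * 2^J from the
  new one.\<close>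

lemma coarse_level_sum: "(\<Sum>j<J. 2 ^ j * (real (J - j) + 1)) \<le> 6 * 2 ^ J"
proof (induction J)
  case (Suc J)
  have "(\<Sum>j<Suc J. 2 ^ j * (real (Suc J - j) + 1)) = (\<Sum>j<J. 2 ^ j * (real (J - j) + 1) + 2 ^ j) + 2 ^ J * 2"
    by (auto intro!: sum.cong simp: Suc_diff_le algebra_simps)
  also have "\<dots> = (\<Sum>j<J. 2 ^ j * (real (J - j) + 1)) + (2 ^ J - 1) + 2 ^ J * 2"
    by (simp add: sum.distrib geometric_sum)
  also have "\<dots> \<le> 6 * 2 ^ Suc J"
  proof -
    have "(0::real) \<le> 2 ^ J" by simp
    then have "x + (2 ^ J - 1) + 2 ^ J * 2 \<le> 6 * 2 ^ Suc J" if "x \<le> 6 * 2 ^ J" for x :: real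
      using that unfolding power_Suc by linarith
    from this[OF Suc] show ?thesis .
  qed
  finally show ?case .
qed simp

text \<open>The number 2^j of variables is outweighed by the factor 4^(-(j - J)): starting from 2^J
  the terms are halved at each level.\<close>

lemma fine_level_sum: "(\<Sum>j\<in>{J..n}. 2 ^ j * (1 / 4 ^ (j - J))) \<le> (2 * 2 ^ J :: real)"
proof (cases "J \<le> n")
  case True
  then have "(\<Sum>j\<in>{J..n}. 2 ^ j * (1 / 4 ^ (j - J))) = (\<Sum>i\<in>{0..n - J}. 2 ^ (i + J) * (1 / 4 ^ i) :: real)"
    by (intro sum.reindex_bij_witness[of _ "\<lambda>i. i + J" "\<lambda>j. j - J"]) auto
  also have "\<dots> = 2 ^ J * (\<Sum>i\<in>{0..n - J}. (1 / 2) ^ i)"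
  proof -
    have "(4::real) ^ i = 2 ^ i * 2 ^ i" for i by (simp add: power_mult_distrib[symmetric])
    then show ?thesis by (auto simp: sum_distrib_left power_add power_divide intro!: sum.cong)
  qed
  also have "(\<Sum>i\<in>{0..n - J}. (1 / 2) ^ i) \<le> (2 :: real)"
    by (subst atLeast0AtMost, subst sum_gp0) (auto simp: field_simps)
  finally show ?thesis by simp
qed simp

text \<open>The hypotheses describe variables in units of their rounding width: standard deviation
  of order 2^(J - j) on coarse levels, moments of order 2p decaying like 8^(-(j - J)) on fine ones.
  Their rounded values have entropy of order 2^J in total, whatever the number of levels.\<close>

lemma multilevel_code:
  fixes y :: "'k \<Rightarrow> 'a \<Rightarrow> real" and lev :: "'k \<Rightarrow> nat" and c \<Lambda> :: real
  assumes P: "prob_space P" and fin: "finite \<Theta>"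
    and ym [measurable]: "\<And>\<theta>. \<theta> \<in> \<Theta> \<Longrightarrow> y \<theta> \<in> borel_measurable P"
    and p: "0 < p" and \<Lambda>: "0 \<le> \<Lambda>" and c: "0 \<le> c"
    and card: "\<And>j. real (card {\<theta> \<in> \<Theta>. lev \<theta> = j}) \<le> c * 2 ^ j"
    and int: "\<And>\<theta>. \<theta> \<in> \<Theta> \<Longrightarrow> integrable P (\<lambda>x. (y \<theta> x)\<^sup>2)" "\<And>\<theta>. \<theta> \<in> \<Theta> \<Longrightarrow> integrable P (\<lambda>x. y \<theta> x ^ (2 * p))"
    and coarse: "\<And>\<theta>. \<theta> \<in> \<Theta> \<Longrightarrow> lev \<theta> < J \<Longrightarrow> (\<integral>x. (y \<theta> x)\<^sup>2 \<partial>P) \<le> \<Lambda> * 4 ^ (J - lev \<theta>)"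
    and fine: "\<And>\<theta>. \<theta> \<in> \<Theta> \<Longrightarrow> J \<le> lev \<theta> \<Longrightarrow> (\<integral>x. y \<theta> x ^ (2 * p) \<partial>P) \<le> \<Lambda> / 8 ^ (lev \<theta> - J)"
  shows "\<exists>z. exp (- (8 * c * (4 * 4 ^ p * \<Lambda> + 4) + 2) * 2 ^ J)
      \<le> measure P {x \<in> space P. \<forall>\<theta>\<in>\<Theta>. round (y \<theta> x) = z \<theta>}"
proof -
  interpret prob_space P by fact
  \<comment> \<open>A coarse weight is the inverse of the standard deviation, so the mean cost is
    bounded, and the normalising sum is of order 2^(J - j), with logarithm of order J - j. A fine
    weight grows linearly in j - J: this makes b exponentially small, while in a the decay of the
    moments still wins.\<close>
  define L where "L \<theta> = (if lev \<theta> < J then 1 / 2 ^ (J - lev \<theta>) else 2 * real (lev \<theta> - J) + 1)" for \<theta>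
  define a where "a \<theta> = (if lev \<theta> < J then 1 + \<Lambda> else 2 * 4 ^ p * \<Lambda> / 4 ^ (lev \<theta> - J))" for \<theta>
  define b where "b \<theta> = (if lev \<theta> < J then 2 * (real (J - lev \<theta>) + 1) else 4 / 4 ^ (lev \<theta> - J))" for \<theta>
  define B where "B = 4 * 4 ^ p * \<Lambda> + 4"
  define g where "g j = (if j < J then real (J - j) + 1 else 1 / 4 ^ (j - J))" for j
  have L0: "0 < L \<theta>" for \<theta> by (simp add: L_def add_pos_nonneg)
  have rm [measurable]: "(\<lambda>x. round (y \<theta> x)) \<in> measurable P (count_space UNIV)" if "\<theta> \<in> \<Theta>" for \<theta>
    using ym[OF that] unfolding round_def by measurable
  have ri: "integrable P (\<lambda>x. real_of_int \<bar>round (y \<theta> x)\<bar>)" if t: "\<theta> \<in> \<Theta>" for \<theta>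
  proof (rule Bochner_Integration.integrable_bound)
    show "integrable P (\<lambda>x. 4 ^ p * y \<theta> x ^ (2 * p))" using int(2)[OF t] by simp
    show "(\<lambda>x. real_of_int \<bar>round (y \<theta> x)\<bar>) \<in> borel_measurable P" using rm[OF t] by measurable
    show "AE x in P. norm (real_of_int \<bar>round (y \<theta> x)\<bar>) \<le> norm (4 ^ p * y \<theta> x ^ (2 * p))"
      using abs_round_le_power[OF p] by (auto simp: power_mult power_mult_distrib abs_mult)
  qed
  have fb: "L \<theta> * (\<integral>x. real_of_int \<bar>round (y \<theta> x)\<bar> \<partial>P) \<le> a \<theta>" if t: "\<theta> \<in> \<Theta>" for \<theta>
  proof (cases "lev \<theta> < J")
    case True
    define i where "i = J - lev \<theta>"
    have "L \<theta> * (\<integral>x. real_of_int \<bar>round (y \<theta> x)\<bar> \<partial>P) = (\<integral>x. L \<theta> * real_of_int \<bar>round (y \<theta> x)\<bar> \<partial>P)" by simp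
    also have "\<dots> \<le> (\<integral>x. 1 + (L \<theta>)\<^sup>2 * (y \<theta> x)\<^sup>2 \<partial>P)"
    proof (rule integral_mono)
      fix x
      have "L \<theta> * real_of_int \<bar>round (y \<theta> x)\<bar> \<le> L \<theta> * (2 * \<bar>y \<theta> x\<bar>)"
        using abs_round_le[of "y \<theta> x"] L0[of \<theta>] by (intro mult_left_mono) auto
      also have "\<dots> \<le> 1 + (L \<theta> * \<bar>y \<theta> x\<bar>)\<^sup>2"
        using zero_le_power2[of "L \<theta> * \<bar>y \<theta> x\<bar> - 1"] by (simp add: power2_eq_square algebra_simps)
      finally show "L \<theta> * real_of_int \<bar>round (y \<theta> x)\<bar> \<le> 1 + (L \<theta>)\<^sup>2 * (y \<theta> x)\<^sup>2"
        by (simp add: power_mult_distrib)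
    qed (use ri[OF t] int(1)[OF t] in auto)
    also have "\<dots> = 1 + (L \<theta>)\<^sup>2 * (\<integral>x. (y \<theta> x)\<^sup>2 \<partial>P)"
      using int(1)[OF t] by (simp add: prob_space)
    also have "\<dots> \<le> 1 + (L \<theta>)\<^sup>2 * (\<Lambda> * 4 ^ i)"
      using coarse[OF t True] unfolding i_def by (intro add_left_mono mult_left_mono) auto
    also have "(L \<theta>)\<^sup>2 * (\<Lambda> * 4 ^ i) = \<Lambda>"
    proof -
      have "(4::real) ^ i = (2 ^ i)\<^sup>2" by (simp add: power_mult[symmetric] mult.commute[of i 2] power_mult)
      then show ?thesis using True by (simp add: L_def i_def power_divide)
    qed
    finally show ?thesis using True by (simp add: a_def)
  next
    case False
    define i where "i = lev \<theta> - J"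
    have "(\<integral>x. real_of_int \<bar>round (y \<theta> x)\<bar> \<partial>P) \<le> (\<integral>x. 4 ^ p * y \<theta> x ^ (2 * p) \<partial>P)"
    proof (rule integral_mono)
      show "real_of_int \<bar>round (y \<theta> x)\<bar> \<le> 4 ^ p * y \<theta> x ^ (2 * p)" for x
        using abs_round_le_power[OF p, of "y \<theta> x"] by (simp add: power_mult power_mult_distrib)
    qed (use ri[OF t] int(2)[OF t] in auto)
    also have "\<dots> \<le> 4 ^ p * (\<Lambda> / 8 ^ i)"
      using mult_left_mono[OF fine[OF t], of "4 ^ p"] False unfolding i_def by simp
    finally have "L \<theta> * (\<integral>x. real_of_int \<bar>round (y \<theta> x)\<bar> \<partial>P) \<le> (2 * real i + 1) * (4 ^ p * (\<Lambda> / 8 ^ i))"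
      using False by (simp only: L_def i_def if_False) (rule mult_left_mono, auto)
    \<comment> \<open>The linear weight is bounded by 2 * 2^i, which uses up a factor 2^i of the
      decay 8^(-i) and leaves 4^(-i).\<close>
    also have "\<dots> \<le> (2 * 2 ^ i) * (4 ^ p * (\<Lambda> / 8 ^ i))"
    proof (intro mult_right_mono)
      have "2 * i + 1 \<le> 2 * 2 ^ i"
        using less_exp[of i] by linarith
      then have "real (2 * i + 1) \<le> real (2 * 2 ^ i)" by (subst of_nat_le_iff)
      then show "2 * real i + 1 \<le> 2 * 2 ^ i" by simp
    qed (use \<Lambda> in auto)
    also have "(8::real) ^ i = 2 ^ i * 4 ^ i" by (simp add: power_mult_distrib[symmetric])
    finally show ?thesis using False by (simp add: a_def i_def)
  qed
  have bb: "(\<Sum>z\<in>{- int m..int m}. exp (- L \<theta> * real_of_int \<bar>z\<bar>)) \<le> exp (b \<theta>)" for \<theta> m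
  proof (cases "lev \<theta> < J")
    case True
    define i where "i = J - lev \<theta>"
    have "L \<theta> \<le> exp (L \<theta>) - 1" using exp_ge_add_one_self[of "L \<theta>"] by linarith
    then have "1 + 2 / (exp (L \<theta>) - 1) \<le> 1 + 2 / L \<theta>" using L0[of \<theta>] by (auto intro!: divide_left_mono)
    also have "\<dots> = 1 + 2 * 2 ^ i" using True by (simp add: L_def i_def)
    \<comment> \<open>With u = 2^i this is 1 + 2u \<le> 4u^2; the inequality 4 \<le> exp 2 then
      brings it to the form exp (b \<theta>).\<close>
    also have "\<dots> \<le> 4 ^ (i + 1)"
    proof -
      have u: "1 + 2 * u \<le> 4 * (u * u)" if "1 \<le> u" for u :: real
        using mult_mono[OF that that] mult_left_mono[OF that, of u] that by linarith
      have "(4::real) ^ i = 2 ^ i * 2 ^ i" by (simp add: power_mult_distrib[symmetric])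
      then show ?thesis using u[of "2 ^ i"] by simp
    qed
    also have "\<dots> \<le> exp 2 ^ (i + 1)"
    proof (rule power_mono)
      have "(2::real) \<le> exp 1" using exp_ge_add_one_self[of 1] by simp
      then have "2 * 2 \<le> exp 1 * exp (1::real)" by (intro mult_mono) auto
      then show "4 \<le> exp (2::real)" by (simp add: exp_add[symmetric])
    qed simp
    also have "\<dots> = exp (b \<theta>)" using True by (simp add: b_def i_def exp_of_nat_mult[symmetric] exp_add[symmetric] algebra_simps)
    finally show ?thesis using sum_exp_abs_le[OF L0, where m=m, of \<theta>] by linarith
  next
    case False
    define i where "i = lev \<theta> - J"
    have L1: "1 \<le> L \<theta>" using False by (simp add: L_def)
    have e2: "2 \<le> exp (L \<theta>)" using exp_ge_add_one_self[of "L \<theta>"] L1 by linarith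
    \<comment> \<open>Since exp (L \<theta>) is at least 2, subtracting 1 at most halves it.\<close>
    have "2 / (exp (L \<theta>) - 1) \<le> 2 / (exp (L \<theta>) / 2)" using e2 L1 by (intro divide_left_mono mult_pos_pos) auto
    also have "\<dots> = 4 * exp (- L \<theta>)" by (simp add: exp_minus field_simps)
    also have "\<dots> \<le> 4 * (1 / 4 ^ i)"
    proof (intro mult_left_mono)
      have "(2::real) \<le> exp 1" using exp_ge_add_one_self[of 1] by simp
      then have "2 * 2 \<le> exp 1 * exp (1::real)" by (intro mult_mono) auto
      then have "4 ^ i \<le> exp (2::real) ^ i" by (intro power_mono) (auto simp: exp_add[symmetric])
      also have "\<dots> \<le> exp (L \<theta>)" using False by (simp add: L_def i_def exp_of_nat_mult[symmetric])
      finally show "exp (- L \<theta>) \<le> 1 / 4 ^ i" by (simp add: exp_minus field_simps)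
    qed simp
    finally have "1 + 2 / (exp (L \<theta>) - 1) \<le> 1 + b \<theta>" using False by (simp add: b_def i_def)
    also have "\<dots> \<le> exp (b \<theta>)" by (rule exp_ge_add_one_self)
    finally show ?thesis using sum_exp_abs_le[OF L0, where m=m, of \<theta>] by linarith
  qed
  obtain z where z: "exp (- (\<Sum>\<theta>\<in>\<Theta>. 2 * a \<theta> + b \<theta>) - 2) \<le> measure P {x \<in> space P. \<forall>\<theta>\<in>\<Theta>. round (y \<theta> x) = z \<theta>}"
    using pigeonhole_code[where Z = "\<lambda>\<theta> x. round (y \<theta> x)" and L = L and a = a and b = b, OF P fin rm L0 ri fb bb] by auto
  have B0: "0 \<le> B" using \<Lambda> by (simp add: B_def)
  have ab: "2 * a \<theta> + b \<theta> \<le> B * g (lev \<theta>)" for \<theta>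
  proof (cases "lev \<theta> < J")
    case True
    have "\<Lambda> \<le> 4 ^ p * \<Lambda>" using \<Lambda> mult_right_mono[of 1 "4 ^ p" \<Lambda>] by simp
    then have B1: "2 + 2 * \<Lambda> \<le> B - 2" unfolding B_def using \<Lambda> by linarith
    have "2 * a \<theta> + b \<theta> = (2 + 2 * \<Lambda>) * 1 + 2 * g (lev \<theta>)" using True by (simp add: a_def b_def g_def)
    also have "\<dots> \<le> (B - 2) * g (lev \<theta>) + 2 * g (lev \<theta>)"
      using B1 True \<Lambda> by (intro add_right_mono mult_mono) (auto simp: g_def)
    finally show ?thesis by (simp add: algebra_simps)
  next
    case False
    then show ?thesis by (simp add: a_def b_def g_def B_def field_simps)
  qed
  have "(\<Sum>\<theta>\<in>\<Theta>. 2 * a \<theta> + b \<theta>) \<le> (\<Sum>\<theta>\<in>\<Theta>. B * g (lev \<theta>))" by (intro sum_mono ab)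
  also have "\<dots> = (\<Sum>j\<in>lev ` \<Theta>. \<Sum>\<theta>\<in>{\<theta> \<in> \<Theta>. lev \<theta> = j}. B * g (lev \<theta>))"
    using fin by (rule sum.image_gen)
  also have "\<dots> = (\<Sum>j\<in>lev ` \<Theta>. real (card {\<theta> \<in> \<Theta>. lev \<theta> = j}) * (B * g j))"
    by (intro sum.cong refl) simp
  also have "\<dots> \<le> (\<Sum>j\<in>lev ` \<Theta>. c * 2 ^ j * (B * g j))"
    using B0 by (intro sum_mono mult_right_mono card) (auto simp: g_def)
  also have "\<dots> \<le> (\<Sum>j\<in>{..<J} \<union> {J..Max (insert 0 (lev ` \<Theta>))}. c * 2 ^ j * (B * g j))"
    using B0 c fin by (intro sum_mono2) (auto simp: g_def not_less)
  also have "\<dots> = (\<Sum>j<J. c * 2 ^ j * (B * g j)) + (\<Sum>j\<in>{J..Max (insert 0 (lev ` \<Theta>))}. c * 2 ^ j * (B * g j))"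
    by (intro sum.union_disjoint) auto
  also have "\<dots> = c * B * ((\<Sum>j<J. 2 ^ j * (real (J - j) + 1)) + (\<Sum>j\<in>{J..Max (insert 0 (lev ` \<Theta>))}. 2 ^ j * (1 / 4 ^ (j - J))))"
    unfolding distrib_left[of "c * B"] sum_distrib_left[of "c * B"]
    by (intro arg_cong2[where f="(+)"] sum.cong refl) (auto simp: g_def mult_ac)
  also have "\<dots> \<le> c * B * (6 * 2 ^ J + 2 * 2 ^ J)"
    using c B0 by (intro mult_left_mono add_mono coarse_level_sum fine_level_sum) auto
  finally have S: "(\<Sum>\<theta>\<in>\<Theta>. 2 * a \<theta> + b \<theta>) \<le> c * B * (6 * 2 ^ J + 2 * 2 ^ J)" .
  \<comment> \<open>Here 8 = 6 + 2 collects the coarse and the fine sum, and the additive 2 of the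
    pigeonhole bound is absorbed by 2^J \<ge> 1.\<close>
  have "(\<Sum>\<theta>\<in>\<Theta>. 2 * a \<theta> + b \<theta>) + 2 \<le> (8 * c * B + 2) * 2 ^ J"
  proof -
    have "(1::real) \<le> 2 ^ J" by simp
    moreover have "c * B * (6 * 2 ^ J + 2 * 2 ^ J) + 2 * 2 ^ J = (8 * c * B + 2) * 2 ^ J" by (simp add: algebra_simps)
    ultimately show ?thesis using S by linarith
  qed
  then have "exp (- (8 * c * B + 2) * 2 ^ J) \<le> exp (- (\<Sum>\<theta>\<in>\<Theta>. 2 * a \<theta> + b \<theta>) - 2)"
    by (simp only: exp_le_cancel_iff mult_minus_left)
  then show ?thesis using z unfolding B_def by (meson order_trans)
qed

section \<open>Moments of the area\<close>

text \<open>The graph of x^(n+1) lies above its tangent at y; integrated, this gives Jensen's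
  inequality for powers. In the induction, multiplying the previous case by y leaves the defect (x -
  y)(x^(n+1) - y^(n+1)), which is nonnegative.\<close>

lemma power_tangent_le:
  fixes x y :: real
  assumes "0 \<le> x" "0 \<le> y"
  shows "real (Suc n) * x * y ^ n \<le> x ^ Suc n + real n * y ^ Suc n"
proof (induction n)
  case (Suc n)
  have "0 \<le> (x - y) * (x ^ Suc n - y ^ Suc n)"
  proof (cases "x \<le> y")
    case True
    then have "x ^ Suc n \<le> y ^ Suc n" using assms by (intro power_mono)
    then show ?thesis using True by (intro mult_nonpos_nonpos) auto
  next
    case False
    then have "y ^ Suc n \<le> x ^ Suc n" using assms by (intro power_mono) auto
    then show ?thesis using False by (intro mult_nonneg_nonneg) auto
  qed
  moreover have "real (Suc n) * x * y ^ n * y \<le> (x ^ Suc n + real n * y ^ Suc n) * y"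
    using Suc assms by (intro mult_right_mono)
  ultimately show ?case by (simp add: algebra_simps)
qed simp

lemma centred_normal_family_member:
  assumes "finite K" "\<And>u. centred_normal_rv P (\<lambda>x. \<Sum>a\<in>K. u a * X a x)" "a \<in> K"
  shows "centred_normal_rv P (X a)"
proof -
  have "(\<lambda>x. \<Sum>b\<in>K. (if b = a then 1 else 0) * X b x) = X a"
    using assms(1,3) by (simp add: if_distrib[of "\<lambda>c. c * _"] sum.delta cong: if_cong)
  with assms(2)[of "\<lambda>b. if b = a then 1 else 0"] show ?thesis by simp
qed

lemma (in pair_sigma_finite) pair_product_integral:
  fixes f g :: "_ \<Rightarrow> real"
  assumes f: "integrable M1 f" and g: "integrable M2 g"
  shows "integrable (M1 \<Otimes>\<^sub>M M2) (\<lambda>(x, y). f x * g y)"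
    and "(\<integral>(x, y). f x * g y \<partial>(M1 \<Otimes>\<^sub>M M2)) = (\<integral>x. f x \<partial>M1) * (\<integral>y. g y \<partial>M2)"
proof -
  have [measurable]: "f \<in> borel_measurable M1" "g \<in> borel_measurable M2" using f g by auto
  show *: "integrable (M1 \<Otimes>\<^sub>M M2) (\<lambda>(x, y). f x * g y)"
    using f g by (intro Fubini_integrable) (auto simp: abs_mult)
  show "(\<integral>(x, y). f x * g y \<partial>(M1 \<Otimes>\<^sub>M M2)) = (\<integral>x. f x \<partial>M1) * (\<integral>y. g y \<partial>M2)"
    using integral_fst'[OF *] by simp
qed

text \<open>Hypercontractivity for decoupled second-order chaos. Given the second variable the form is
  Gaussian in the first one, so the moments of the conditional variance have to be estimated;
  this is Jensen's inequality for the measure with density \<open>w + \<eta>\<close>, where \<open>w\<close> is the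
  conditional variance in the other order and \<open>\<eta>\<close> avoids division by zero.\<close>

lemma decoupled_chaos_moment:
  fixes f :: "'k \<Rightarrow> 'a \<Rightarrow> real" and g :: "'k \<Rightarrow> 'b \<Rightarrow> real"
  assumes P: "prob_space P" and Q: "prob_space Q" and K: "finite K"
    and f: "\<And>u. centred_normal_rv P (\<lambda>x. \<Sum>a\<in>K. u a * f a x)"
    and g: "\<And>u. centred_normal_rv Q (\<lambda>y. \<Sum>a\<in>K. u a * g a y)"
  defines "A \<equiv> \<lambda>(x, y). \<Sum>a\<in>K. f a x * g a y"
  shows "integrable (P \<Otimes>\<^sub>M Q) (\<lambda>z. (A z)\<^sup>2)"
    and "integrable (P \<Otimes>\<^sub>M Q) (\<lambda>z. A z ^ (2 * Suc p))"
    and "(\<integral>z. A z ^ (2 * Suc p) \<partial>(P \<Otimes>\<^sub>M Q))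
      \<le> (fact (2 * Suc p) / (2 ^ Suc p * fact (Suc p)))\<^sup>2 * (\<integral>z. (A z)\<^sup>2 \<partial>(P \<Otimes>\<^sub>M Q)) ^ Suc p"
proof -
  interpret P: prob_space P by fact
  interpret Q: prob_space Q by fact
  interpret PQ: pair_prob_space P Q ..
  have fn: "centred_normal_rv P (f a)" if "a \<in> K" for a using centred_normal_family_member[OF K f that] .
  have gn: "centred_normal_rv Q (g a)" if "a \<in> K" for a using centred_normal_family_member[OF K g that] .
  have fm [measurable]: "f a \<in> borel_measurable P" if "a \<in> K" for a using fn[OF that] by (simp add: centred_normal_rv_def)
  have gm [measurable]: "g a \<in> borel_measurable Q" if "a \<in> K" for a using gn[OF that] by (simp add: centred_normal_rv_def)
  have Am [measurable]: "A \<in> borel_measurable (P \<Otimes>\<^sub>M Q)" unfolding A_def by measurable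
  have A1: "centred_normal_rv P (\<lambda>x. A (x, y))" for y
    using f[of "\<lambda>a. g a y"] by (simp add: A_def mult.commute)
  have A2: "centred_normal_rv Q (\<lambda>y. A (x, y))" for x
    using g[of "\<lambda>a. f a x"] by (simp add: A_def)
  define c where "c q = (fact (2 * q) / (2 ^ q * fact q) :: real)" for q
  have c0: "0 \<le> c q" for q by (simp add: c_def)
  \<comment> \<open>q y and w x are the conditional variances of A given the second and the first
    variable; by \<open>n1\<close> and \<open>n2\<close> every even conditional moment is a power of
    them up to the factor \<open>c n\<close>.\<close>
  define q where "q y = (\<integral>x. (A (x, y))\<^sup>2 \<partial>P)" for y
  define w where "w x = (\<integral>y. (A (x, y))\<^sup>2 \<partial>Q)" for x
  have q0: "0 \<le> q y" and w0: "0 \<le> w x" for x y by (simp_all add: q_def w_def)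
  have qm [measurable]: "q \<in> borel_measurable Q"
  proof -
    have "(\<lambda>(y, x). A (x, y)) \<in> borel_measurable (Q \<Otimes>\<^sub>M P)"
      using measurable_compose[OF measurable_pair_swap' Am] by (simp add: case_prod_beta)
    then have "(\<lambda>(y, x). (A (x, y))\<^sup>2) \<in> borel_measurable (Q \<Otimes>\<^sub>M P)" by (simp add: case_prod_beta)
    then show ?thesis unfolding q_def by (rule P.borel_measurable_lebesgue_integral)
  qed
  have wm [measurable]: "w \<in> borel_measurable P"
  proof -
    have "(\<lambda>(x, y). (A (x, y))\<^sup>2) \<in> borel_measurable (P \<Otimes>\<^sub>M Q)" by (simp add: case_prod_beta)
    then show ?thesis unfolding w_def by (rule Q.borel_measurable_lebesgue_integral)
  qed
  have e: "0 \<le> (r::real) ^ (2 * n)" for r n by (simp only: power_mult) simp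
  have n1: "(\<integral>\<^sup>+x. ennreal (A (x, y) ^ (2 * n)) \<partial>P) = ennreal (c n * q y ^ n)" for y n
    using nn_integral_eq_integral[OF centred_normal_rv_moment(1)[OF P A1]] e
    by (simp add: centred_normal_rv_moment(2)[OF P A1] c_def q_def)
  have n2: "(\<integral>\<^sup>+y. ennreal (A (x, y) ^ (2 * n)) \<partial>Q) = ennreal (c n * w x ^ n)" for x n
    using nn_integral_eq_integral[OF centred_normal_rv_moment(1)[OF Q A2]] e
    by (simp add: centred_normal_rv_moment(2)[OF Q A2] c_def w_def)
  have c1: "c 1 = 1" by (simp add: c_def)
  define B where "B = (\<integral>z. (A z)\<^sup>2 \<partial>(P \<Otimes>\<^sub>M Q))"
  show i2: "integrable (P \<Otimes>\<^sub>M Q) (\<lambda>z. (A z)\<^sup>2)"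
  proof (rule Bochner_Integration.integrable_bound)
    have "integrable (P \<Otimes>\<^sub>M Q) (\<lambda>z. (f a (fst z))\<^sup>2 * (g a (snd z))\<^sup>2)" if "a \<in> K" for a
      using PQ.pair_product_integral(1)[OF centred_normal_rv_moment(1)[OF P fn[OF that], of 1] centred_normal_rv_moment(1)[OF Q gn[OF that], of 1]]
      by (simp add: case_prod_beta')
    then show "integrable (P \<Otimes>\<^sub>M Q) (\<lambda>(x, y). real (card K) * (\<Sum>a\<in>K. (f a x)\<^sup>2 * (g a y)\<^sup>2))"
      by (auto simp: case_prod_beta' simp del: mult_cancel_left)
    show "AE z in P \<Otimes>\<^sub>M Q. norm ((A z)\<^sup>2) \<le> norm (case z of (x, y) \<Rightarrow> real (card K) * (\<Sum>a\<in>K. (f a x)\<^sup>2 * (g a y)\<^sup>2))"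
    proof (rule AE_I2)
      fix z
      show "norm ((A z)\<^sup>2) \<le> norm (case z of (x, y) \<Rightarrow> real (card K) * (\<Sum>a\<in>K. (f a x)\<^sup>2 * (g a y)\<^sup>2))"
        using sum_squared_le_sum_of_squares[of "\<lambda>a. f a (fst z) * g a (snd z)" K]
        by (simp add: A_def case_prod_beta power_mult_distrib mult.commute sum_nonneg)
    qed
  qed simp
  have B0: "0 \<le> B" by (simp add: B_def)
  have Bw: "(\<integral>\<^sup>+x. ennreal (w x) \<partial>P) = ennreal B"
  proof -
    have "ennreal B = (\<integral>\<^sup>+z. ennreal ((A z)\<^sup>2) \<partial>(P \<Otimes>\<^sub>M Q))"
      unfolding B_def using i2 by (intro nn_integral_eq_integral[symmetric]) auto
    also have "\<dots> = (\<integral>\<^sup>+x. \<integral>\<^sup>+y. ennreal ((A (x, y))\<^sup>2) \<partial>Q \<partial>P)"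
      by (subst Q.nn_integral_fst[symmetric]) auto
    also have "\<dots> = (\<integral>\<^sup>+x. ennreal (w x) \<partial>P)"
      using n2[of _ 1] c1 by simp
    finally show ?thesis ..
  qed
  let ?V = "\<integral>\<^sup>+z. ennreal (A z ^ (2 * Suc p)) \<partial>(P \<Otimes>\<^sub>M Q)"
  have V: "?V \<le> ennreal ((c (Suc p))\<^sup>2 * (B + \<eta>) ^ Suc p)" if \<eta>: "0 < \<eta>" for \<eta>
  proof -
    define T where "T y = (\<integral>\<^sup>+x. ennreal (A (x, y) ^ (2 * Suc p) / (w x + \<eta>) ^ p) \<partial>P)" for y
    have w\<eta>: "0 < w x + \<eta>" for x using w0[of x] \<eta> by linarith
    have B\<eta>: "0 < B + \<eta>" using B0 \<eta> by linarith
    have key: "ennreal (q y ^ Suc p) \<le> ennreal ((B + \<eta>) ^ p) * T y" if y: "y \<in> space Q" for y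
    proof -
      define Y where "Y = q y / (B + \<eta>)"
      have Y0: "0 \<le> Y" using q0 B\<eta> by (simp add: Y_def)
      have Am' [measurable]: "(\<lambda>x. A (x, y)) \<in> borel_measurable P" using A1 by (simp add: centred_normal_rv_def)
      \<comment> \<open>The tangent inequality at Y for the ratio A^2 / (w + \<eta>), multiplied by
        w + \<eta>. Since w + \<eta> has integral B + \<eta>, the choice Y = q y / (B + \<eta>) is
        the mean of the ratio under the normalised density.\<close>
      have pt: "real (Suc p) * Y ^ p * (A (x, y))\<^sup>2 \<le> A (x, y) ^ (2 * Suc p) / (w x + \<eta>) ^ p + real p * Y ^ Suc p * (w x + \<eta>)" for x
      proof -
        let ?s = "w x + \<eta>"
        have "real (Suc p) * ((A (x, y))\<^sup>2 / ?s) * Y ^ p \<le> ((A (x, y))\<^sup>2 / ?s) ^ Suc p + real p * Y ^ Suc p"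
          using w\<eta>[of x] Y0 by (intro power_tangent_le) auto
        then have "(real (Suc p) * ((A (x, y))\<^sup>2 / ?s) * Y ^ p) * ?s \<le> (((A (x, y))\<^sup>2 / ?s) ^ Suc p + real p * Y ^ Suc p) * ?s"
          using w\<eta>[of x] by (intro mult_right_mono) auto
        also have "(((A (x, y))\<^sup>2 / ?s) ^ Suc p + real p * Y ^ Suc p) * ?s = A (x, y) ^ (2 * Suc p) / ?s ^ p + real p * Y ^ Suc p * ?s"
        proof -
          have "(z / ?s) ^ Suc p * ?s = z ^ Suc p / ?s ^ p" for z using w\<eta>[of x] by (simp add: power_divide)
          then show ?thesis by (simp only: distrib_right power_mult)
        qed
        also have "(real (Suc p) * ((A (x, y))\<^sup>2 / ?s) * Y ^ p) * ?s = real (Suc p) * Y ^ p * (A (x, y))\<^sup>2"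
          using w\<eta>[of x] by (simp add: field_simps)
        finally show ?thesis .
      qed
      have "ennreal (real (Suc p) * Y ^ p * q y) = (\<integral>\<^sup>+x. ennreal (real (Suc p) * Y ^ p * (A (x, y))\<^sup>2) \<partial>P)"
        using n1[of y 1] Y0 c1 by (simp add: ennreal_mult nn_integral_cmult q0)
      also have "\<dots> \<le> (\<integral>\<^sup>+x. ennreal (A (x, y) ^ (2 * Suc p) / (w x + \<eta>) ^ p + real p * Y ^ Suc p * (w x + \<eta>)) \<partial>P)"
        using pt by (intro nn_integral_mono ennreal_leI)
      also have "\<dots> = (\<integral>\<^sup>+x. ennreal (A (x, y) ^ (2 * Suc p) / (w x + \<eta>) ^ p) + ennreal (real p * Y ^ Suc p) * (ennreal (w x) + ennreal \<eta>) \<partial>P)"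
        using e w\<eta> w0 Y0 \<eta>
        by (intro nn_integral_cong)
          (simp add: ennreal_plus[symmetric] ennreal_mult[symmetric] zero_le_power less_imp_le del: ennreal_plus power_Suc mult_Suc_right)
      also have "\<dots> = T y + ennreal (real p * Y ^ Suc p) * (ennreal B + ennreal \<eta>)"
        unfolding T_def by (simp add: nn_integral_add nn_integral_cmult Bw P.emeasure_space_1 del: power_Suc mult_Suc_right)
      also have "ennreal (real p * Y ^ Suc p) * (ennreal B + ennreal \<eta>) = ennreal (real p * Y ^ Suc p * (B + \<eta>))"
        using B0 \<eta> Y0 by (simp add: ennreal_plus[symmetric] ennreal_mult[symmetric] del: ennreal_plus power_Suc)
      also have "real (Suc p) * Y ^ p * q y = Y ^ Suc p * (B + \<eta>) + real p * Y ^ Suc p * (B + \<eta>)"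
      proof -
        have "q y = Y * (B + \<eta>)" using B\<eta> by (simp add: Y_def)
        then show ?thesis by (simp add: algebra_simps)
      qed
      finally have "ennreal (Y ^ Suc p * (B + \<eta>)) + ennreal (real p * Y ^ Suc p * (B + \<eta>)) \<le> T y + ennreal (real p * Y ^ Suc p * (B + \<eta>))"
        using Y0 B\<eta> by (simp add: ennreal_plus[symmetric] del: ennreal_plus power_Suc)
      then have "ennreal (Y ^ Suc p * (B + \<eta>)) \<le> T y"
        by (subst (asm) (1 2) add.commute) (simp add: ennreal_add_left_cancel_le del: power_Suc)
      then have "ennreal ((B + \<eta>) ^ p) * ennreal (Y ^ Suc p * (B + \<eta>)) \<le> ennreal ((B + \<eta>) ^ p) * T y"
        by (rule mult_left_mono) simp
      also have "ennreal ((B + \<eta>) ^ p) * ennreal (Y ^ Suc p * (B + \<eta>)) = ennreal (q y ^ Suc p)"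
      proof -
        have "(B + \<eta>) ^ p * (Y ^ Suc p * (B + \<eta>)) = q y ^ Suc p"
          using B\<eta> by (simp add: Y_def power_divide)
        then show ?thesis using B\<eta> Y0 by (simp only: ennreal_mult'[OF zero_le_power[OF less_imp_le[OF B\<eta>]], symmetric])
      qed
      finally show ?thesis .
    qed
    have Fm [measurable]: "(\<lambda>z. ennreal (A z ^ (2 * Suc p) / (w (fst z) + \<eta>) ^ p)) \<in> borel_measurable (P \<Otimes>\<^sub>M Q)"
      by measurable
    have "?V = (\<integral>\<^sup>+y. \<integral>\<^sup>+x. ennreal (A (x, y) ^ (2 * Suc p)) \<partial>P \<partial>Q)"
      by (subst PQ.nn_integral_snd[symmetric]) auto
    also have "\<dots> = (\<integral>\<^sup>+y. ennreal (c (Suc p) * q y ^ Suc p) \<partial>Q)"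
      unfolding n1 ..
    also have "\<dots> = ennreal (c (Suc p)) * (\<integral>\<^sup>+y. ennreal (q y ^ Suc p) \<partial>Q)"
      using q0 c0 by (simp add: ennreal_mult nn_integral_cmult del: power_Suc)
    also have "\<dots> \<le> ennreal (c (Suc p)) * (\<integral>\<^sup>+y. ennreal ((B + \<eta>) ^ p) * T y \<partial>Q)"
      using key by (intro mult_left_mono nn_integral_mono) auto
    also have "(\<integral>\<^sup>+y. ennreal ((B + \<eta>) ^ p) * T y \<partial>Q) = ennreal ((B + \<eta>) ^ p) * (\<integral>\<^sup>+y. T y \<partial>Q)"
    proof (rule nn_integral_cmult)
      have "(\<lambda>(y, x). ennreal (A (x, y) ^ (2 * Suc p) / (w x + \<eta>) ^ p)) \<in> borel_measurable (Q \<Otimes>\<^sub>M P)"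
        using measurable_compose[OF measurable_pair_swap' Fm] by (simp add: case_prod_beta)
      then show "T \<in> borel_measurable Q" unfolding T_def by (rule P.borel_measurable_nn_integral)
    qed
    \<comment> \<open>Now x is held fixed and A is Gaussian in y with variance w x. Its moment c
      w^(p+1) is divided by (w + \<eta>)^p, so at most c w remains, whose integral is c B.\<close>
    also have "(\<integral>\<^sup>+y. T y \<partial>Q) = (\<integral>\<^sup>+x. \<integral>\<^sup>+y. ennreal (A (x, y) ^ (2 * Suc p) / (w x + \<eta>) ^ p) \<partial>Q \<partial>P)"
      unfolding T_def by (rule PQ.Fubini') (simp add: case_prod_beta del: power_Suc mult_Suc_right)
    also have "\<dots> \<le> (\<integral>\<^sup>+x. ennreal (c (Suc p)) * ennreal (w x) \<partial>P)"
    proof (rule nn_integral_mono)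
      fix x assume "x \<in> space P"
      have [measurable]: "(\<lambda>y. A (x, y)) \<in> borel_measurable Q" using A2 by (simp add: centred_normal_rv_def)
      have "(\<integral>\<^sup>+y. ennreal (A (x, y) ^ (2 * Suc p) / (w x + \<eta>) ^ p) \<partial>Q) = (\<integral>\<^sup>+y. ennreal (1 / (w x + \<eta>) ^ p) * ennreal (A (x, y) ^ (2 * Suc p)) \<partial>Q)"
        using w\<eta>[of x] by (intro nn_integral_cong) (simp add: ennreal_mult'[symmetric] zero_le_power less_imp_le del: power_Suc mult_Suc_right)
      also have "\<dots> = ennreal (1 / (w x + \<eta>) ^ p) * ennreal (c (Suc p) * w x ^ Suc p)"
        by (simp add: nn_integral_cmult n2 del: power_Suc mult_Suc_right)
      also have "\<dots> = ennreal (c (Suc p) * (w x * (w x ^ p / (w x + \<eta>) ^ p)))"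
        using w\<eta>[of x] by (simp add: ennreal_mult'[symmetric] zero_le_power less_imp_le)
      also have "\<dots> \<le> ennreal (c (Suc p) * (w x * 1))"
        using w\<eta>[of x] w0[of x] c0 \<eta> by (intro ennreal_leI mult_left_mono) (auto simp: divide_le_eq intro!: power_mono)
      finally show "(\<integral>\<^sup>+y. ennreal (A (x, y) ^ (2 * Suc p) / (w x + \<eta>) ^ p) \<partial>Q) \<le> ennreal (c (Suc p)) * ennreal (w x)"
        using w0 c0 by (simp add: ennreal_mult)
    qed
    also have "\<dots> = ennreal (c (Suc p)) * ennreal B" by (simp add: nn_integral_cmult Bw)
    also have "ennreal (c (Suc p)) * (ennreal ((B + \<eta>) ^ p) * (ennreal (c (Suc p)) * ennreal B)) = ennreal ((c (Suc p))\<^sup>2 * ((B + \<eta>) ^ p * B))"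
      using c0 B0 B\<eta> by (simp add: ennreal_mult[symmetric] power2_eq_square mult_ac)
    also have "\<dots> \<le> ennreal ((c (Suc p))\<^sup>2 * (B + \<eta>) ^ Suc p)"
      using B\<eta> B0 \<eta> by (auto intro!: ennreal_leI mult_left_mono)
    finally show ?thesis by (simp add: mult_left_mono)
  qed
  have fin: "?V < \<infinity>" using V[of 1] by (auto intro: le_less_trans simp del: power_Suc mult_Suc_right)
  show i3: "integrable (P \<Otimes>\<^sub>M Q) (\<lambda>z. A z ^ (2 * Suc p))"
    using fin e by (intro integrableI_nonneg) (auto simp del: power_Suc mult_Suc_right)
  have "?V = ennreal (\<integral>z. A z ^ (2 * Suc p) \<partial>(P \<Otimes>\<^sub>M Q))"
    using i3 e by (intro nn_integral_eq_integral) (auto simp del: power_Suc mult_Suc_right)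
  then have le: "(\<integral>z. A z ^ (2 * Suc p) \<partial>(P \<Otimes>\<^sub>M Q)) \<le> (c (Suc p))\<^sup>2 * (B + \<eta>) ^ Suc p" if "0 < \<eta>" for \<eta>
    using V[OF that] B0 that by (simp del: power_Suc mult_Suc_right)
  have lim: "((\<lambda>\<eta>. (c (Suc p))\<^sup>2 * (B + \<eta>) ^ Suc p) \<longlongrightarrow> (c (Suc p))\<^sup>2 * (B + 0) ^ Suc p) (at_right 0)"
    by (intro tendsto_intros)
  have "(\<integral>z. A z ^ (2 * Suc p) \<partial>(P \<Otimes>\<^sub>M Q)) \<le> (c (Suc p))\<^sup>2 * (B + 0) ^ Suc p"
    by (rule tendsto_lowerbound[OF lim]) (auto simp: eventually_at_right_field le intro!: exI[of _ 1] simp del: power_Suc mult_Suc_right)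
  then show "(\<integral>z. A z ^ (2 * Suc p) \<partial>(P \<Otimes>\<^sub>M Q))
      \<le> (fact (2 * Suc p) / (2 ^ Suc p * fact (Suc p)))\<^sup>2 * (\<integral>z. (A z)\<^sup>2 \<partial>(P \<Otimes>\<^sub>M Q)) ^ Suc p"
    by (simp add: c_def B_def del: power_Suc mult_Suc_right fact_Suc)
qed

text \<open>For the piecewise linear interpolations of \<open>f\<close> and \<open>g\<close> on the grid of level \<open>m\<close>,
  \<open>grid_area m T a b f g\<close> is the iterated integral between the grid points \<open>a\<close> and \<open>b\<close>
  (lemma \<open>pl_area_grid\<close> below).\<close>

definition grid_inc :: "nat \<Rightarrow> real \<Rightarrow> (real \<Rightarrow> real) \<Rightarrow> nat \<Rightarrow> real" where
  "grid_inc m T f l = f (dyad m T (Suc l)) - f (dyad m T l)"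

definition grid_area :: "nat \<Rightarrow> real \<Rightarrow> nat \<Rightarrow> nat \<Rightarrow> (real \<Rightarrow> real) \<Rightarrow> (real \<Rightarrow> real) \<Rightarrow> real" where
  "grid_area m T a b f g =
     (\<Sum>l\<in>{a..<b}. ((f (dyad m T l) + f (dyad m T (Suc l))) / 2 - f (dyad m T a)) * grid_inc m T g l)"

section \<open>Grid areas: refinement and second moments\<close>

lemma dyad_Suc_double: "dyad (Suc m) T (2 * l) = dyad m T l"
  by (simp add: dyad_def)

lemma dyad_scale: "dyad (m + i) T (l * 2 ^ i) = dyad m T l"
  by (simp add: dyad_def power_add)

lemma sum_double_interval:
  fixes F :: "nat \<Rightarrow> real"
  shows "(\<Sum>l\<in>{2 * a..<2 * b}. F l) = (\<Sum>l\<in>{a..<b}. F (2 * l) + F (Suc (2 * l)))"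
proof (cases "a \<le> b")
  case True
  then show ?thesis by (induction b rule: dec_induct) (auto simp: sum.atLeastLessThan_Suc)
qed simp

text \<open>Halving a cell replaces its chord by two edges. The iterated integral changes by the
  signed area of the triangle between them, half of the antisymmetric product of the two half-cell
  increments.\<close>

lemma grid_area_refine:
  "grid_area (Suc m) T (2 * a) (2 * b) f g = grid_area m T a b f g
    + (\<Sum>l\<in>{a..<b}. (grid_inc (Suc m) T f (2 * l) * grid_inc (Suc m) T g (Suc (2 * l))
        - grid_inc (Suc m) T f (Suc (2 * l)) * grid_inc (Suc m) T g (2 * l)) / 2)"
proof -
  have d: "dyad (Suc m) T (Suc (Suc (2 * l))) = dyad m T (Suc l)" for l
    using dyad_Suc_double[of m T "Suc l"] by simp
  show ?thesis
    unfolding grid_area_def sum_double_interval sum.distrib[symmetric]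
    unfolding grid_inc_def dyad_Suc_double d by (intro sum.cong refl) (simp add: field_simps)
qed

text \<open>Cauchy--Schwarz with geometric weights s^i. It turns geometrically decaying second
  moments of the terms into a bound for their sum that does not depend on the number of
  terms.\<close>

lemma weighted_sum_square_le:
  fixes a :: "nat \<Rightarrow> real"
  assumes "0 < s" "s < 1"
  shows "(\<Sum>i\<le>n. a i)\<^sup>2 \<le> 1 / (1 - s) * (\<Sum>i\<le>n. (a i)\<^sup>2 / s ^ i)"
proof -
  have sq: "sqrt (s ^ i) * (a i / sqrt (s ^ i)) = a i" "(sqrt (s ^ i))\<^sup>2 = s ^ i"
    "(a i / sqrt (s ^ i))\<^sup>2 = (a i)\<^sup>2 / s ^ i" for i
    using assms by (auto simp: power_divide)
  have "(\<Sum>i\<le>n. a i)\<^sup>2 \<le> (\<Sum>i\<le>n. s ^ i) * (\<Sum>i\<le>n. (a i)\<^sup>2 / s ^ i)"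
    using Cauchy_Schwarz_ineq_sum[of "\<lambda>i. sqrt (s ^ i)" "\<lambda>i. a i / sqrt (s ^ i)" "{..n}"] by (simp only: sq)
  also have "\<dots> \<le> 1 / (1 - s) * (\<Sum>i\<le>n. (a i)\<^sup>2 / s ^ i)"
  proof (rule mult_right_mono)
    show "(\<Sum>i\<le>n. s ^ i) \<le> 1 / (1 - s)" using assms by (simp add: sum_gp0 divide_right_mono)
  qed (use assms in \<open>auto intro!: sum_nonneg\<close>)
  finally show ?thesis .
qed

lemma integrable_mult_of_squares:
  fixes X Y :: "'a \<Rightarrow> real"
  assumes [measurable]: "X \<in> borel_measurable P" "Y \<in> borel_measurable P"
    and "integrable P (\<lambda>x. (X x)\<^sup>2)" "integrable P (\<lambda>x. (Y x)\<^sup>2)"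
  shows "integrable P (\<lambda>x. X x * Y x)"
proof (rule Bochner_Integration.integrable_bound)
  show "integrable P (\<lambda>x. (X x)\<^sup>2 + (Y x)\<^sup>2)" using assms by auto
  show "AE x in P. norm (X x * Y x) \<le> norm ((X x)\<^sup>2 + (Y x)\<^sup>2)"
  proof (rule AE_I2)
    fix x
    have "2 * \<bar>X x\<bar> * \<bar>Y x\<bar> \<le> (X x)\<^sup>2 + (Y x)\<^sup>2"
      using sum_squares_bound[of "\<bar>X x\<bar>" "\<bar>Y x\<bar>"] by simp
    moreover have "0 \<le> \<bar>X x\<bar> * \<bar>Y x\<bar>" by simp
    ultimately show "norm (X x * Y x) \<le> norm ((X x)\<^sup>2 + (Y x)\<^sup>2)"
      unfolding real_norm_def abs_mult by linarith
  qed
qed simp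

text \<open>By independence the second moment is the sum over a, b of products of two covariances;
  the arithmetic-geometric mean inequality separates them, so that each family is estimated from its
  own covariance.\<close>

lemma bilinear_sum_second_moment:
  fixes X :: "'k \<Rightarrow> 'a \<Rightarrow> real" and Y :: "'k \<Rightarrow> 'b \<Rightarrow> real"
  assumes P: "prob_space P" and Q: "prob_space Q" and K: "finite K"
    and X: "\<And>a. a \<in> K \<Longrightarrow> X a \<in> borel_measurable P" "\<And>a. a \<in> K \<Longrightarrow> integrable P (\<lambda>x. (X a x)\<^sup>2)"
    and Y: "\<And>a. a \<in> K \<Longrightarrow> Y a \<in> borel_measurable Q" "\<And>a. a \<in> K \<Longrightarrow> integrable Q (\<lambda>x. (Y a x)\<^sup>2)"
  shows "integrable (P \<Otimes>\<^sub>M Q) (\<lambda>(x, y). (\<Sum>a\<in>K. X a x * Y a y)\<^sup>2)"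
    and "(\<integral>(x, y). (\<Sum>a\<in>K. X a x * Y a y)\<^sup>2 \<partial>(P \<Otimes>\<^sub>M Q))
      \<le> ((\<Sum>a\<in>K. \<Sum>b\<in>K. (\<integral>x. X a x * X b x \<partial>P)\<^sup>2) + (\<Sum>a\<in>K. \<Sum>b\<in>K. (\<integral>y. Y a y * Y b y \<partial>Q)\<^sup>2)) / 2"
proof -
  interpret P: prob_space P by fact
  interpret Q: prob_space Q by fact
  interpret PQ: pair_prob_space P Q ..
  have iX: "integrable P (\<lambda>x. X a x * X b x)" if "a \<in> K" "b \<in> K" for a b
    using that X by (intro integrable_mult_of_squares)
  have iY: "integrable Q (\<lambda>x. Y a x * Y b x)" if "a \<in> K" "b \<in> K" for a b
    using that Y by (intro integrable_mult_of_squares)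
  have ex: "(\<lambda>(x, y). (\<Sum>a\<in>K. X a x * Y a y)\<^sup>2) = (\<lambda>z. \<Sum>a\<in>K. \<Sum>b\<in>K. case z of (x, y) \<Rightarrow> (X a x * X b x) * (Y a y * Y b y))"
    by (auto simp: fun_eq_iff power2_eq_square sum_product mult_ac intro!: sum.cong)
  have i: "integrable (P \<Otimes>\<^sub>M Q) (\<lambda>(x, y). (X a x * X b x) * (Y a y * Y b y))" if "a \<in> K" "b \<in> K" for a b
    using PQ.pair_product_integral(1)[OF iX[OF that] iY[OF that]] .
  show "integrable (P \<Otimes>\<^sub>M Q) (\<lambda>(x, y). (\<Sum>a\<in>K. X a x * Y a y)\<^sup>2)"
    unfolding ex using i by (intro Bochner_Integration.integrable_sum)
  have "(\<integral>(x, y). (\<Sum>a\<in>K. X a x * Y a y)\<^sup>2 \<partial>(P \<Otimes>\<^sub>M Q)) = (\<Sum>a\<in>K. \<Sum>b\<in>K. (\<integral>x. X a x * X b x \<partial>P) * (\<integral>y. Y a y * Y b y \<partial>Q))"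
    unfolding ex using i PQ.pair_product_integral(2)[OF iX iY]
    by (subst Bochner_Integration.integral_sum, intro Bochner_Integration.integrable_sum, simp, intro sum.cong refl)
      (subst Bochner_Integration.integral_sum, auto)
  also have "\<dots> \<le> (\<Sum>a\<in>K. \<Sum>b\<in>K. ((\<integral>x. X a x * X b x \<partial>P)\<^sup>2 + (\<integral>y. Y a y * Y b y \<partial>Q)\<^sup>2) / 2)"
  proof (intro sum_mono)
    fix a b
    show "(\<integral>x. X a x * X b x \<partial>P) * (\<integral>y. Y a y * Y b y \<partial>Q) \<le> ((\<integral>x. X a x * X b x \<partial>P)\<^sup>2 + (\<integral>y. Y a y * Y b y \<partial>Q)\<^sup>2) / 2"
      using sum_squares_bound[of "\<integral>x. X a x * X b x \<partial>P" "\<integral>y. Y a y * Y b y \<partial>Q"] by simp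
  qed
  also have "\<dots> = ((\<Sum>a\<in>K. \<Sum>b\<in>K. (\<integral>x. X a x * X b x \<partial>P)\<^sup>2) + (\<Sum>a\<in>K. \<Sum>b\<in>K. (\<integral>y. Y a y * Y b y \<partial>Q)\<^sup>2)) / 2"
    by (simp add: sum.distrib sum_divide_distrib add_divide_distrib)
  finally show "(\<integral>(x, y). (\<Sum>a\<in>K. X a x * Y a y)\<^sup>2 \<partial>(P \<Otimes>\<^sub>M Q))
      \<le> ((\<Sum>a\<in>K. \<Sum>b\<in>K. (\<integral>x. X a x * X b x \<partial>P)\<^sup>2) + (\<Sum>a\<in>K. \<Sum>b\<in>K. (\<integral>y. Y a y * Y b y \<partial>Q)\<^sup>2)) / 2" .
qed

text \<open>Refining the grid once changes the area by a sum of products over half cells, and its second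
  moment is controlled by squares of covariances of disjoint increments; these gains are summed
  over all refinements with geometric weights.\<close>

lemma grid_area_second_moment:
  fixes f :: "real \<Rightarrow> 'a \<Rightarrow> real" and g :: "real \<Rightarrow> 'b \<Rightarrow> real" and q E :: real
  assumes P: "prob_space P" and Q: "prob_space Q" and k: "k < 2 ^ j"
    and f: "\<And>l. l \<le> 2 ^ (j + i) \<Longrightarrow> f (dyad (j + i) T l) \<in> borel_measurable P"
      "\<And>l. l \<le> 2 ^ (j + i) \<Longrightarrow> integrable P (\<lambda>x. (f (dyad (j + i) T l) x)\<^sup>2)"
    and g: "\<And>l. l \<le> 2 ^ (j + i) \<Longrightarrow> g (dyad (j + i) T l) \<in> borel_measurable Q"
      "\<And>l. l \<le> 2 ^ (j + i) \<Longrightarrow> integrable Q (\<lambda>x. (g (dyad (j + i) T l) x)\<^sup>2)"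
    and q: "0 < q" "q < 1"
    and Rf: "\<And>i'. i' \<le> i \<Longrightarrow> (\<Sum>l\<in>{k * 2 ^ i'..<Suc k * 2 ^ i'}. \<Sum>l'\<in>{k * 2 ^ i'..<Suc k * 2 ^ i'}.
        (\<integral>x. grid_inc (j + i') T (\<lambda>t. f t x) l * grid_inc (j + i') T (\<lambda>t. f t x) l' \<partial>P)\<^sup>2) \<le> E * q ^ i'"
    and Rg: "\<And>i'. i' \<le> i \<Longrightarrow> (\<Sum>l\<in>{k * 2 ^ i'..<Suc k * 2 ^ i'}. \<Sum>l'\<in>{k * 2 ^ i'..<Suc k * 2 ^ i'}.
        (\<integral>x. grid_inc (j + i') T (\<lambda>t. g t x) l * grid_inc (j + i') T (\<lambda>t. g t x) l' \<partial>Q)\<^sup>2) \<le> E * q ^ i'"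
  shows "(\<integral>(x, y). (grid_area (j + i) T (k * 2 ^ i) (Suc k * 2 ^ i) (\<lambda>t. f t x) (\<lambda>t. g t y))\<^sup>2 \<partial>(P \<Otimes>\<^sub>M Q))
     \<le> E / (1 - sqrt q)\<^sup>2"
proof -
  interpret P: prob_space P by fact
  interpret Q: prob_space Q by fact
  interpret PQ: pair_prob_space P Q ..
  define X where "X i l x = grid_inc (j + i) T (\<lambda>t. f t x) l" for i l x
  define Y where "Y i l y = grid_inc (j + i) T (\<lambda>t. g t y) l" for i l y
  define C where "C i = {k * 2 ^ i..<Suc k * 2 ^ i}" for i :: nat
  \<comment> \<open>Measurability and integrability are assumed only on the finest grid, so points
    of coarser grids are rewritten as points of that grid.\<close>
  have grid: "dyad (j + i') T l = dyad (j + i) T (l * 2 ^ (i - i'))" "l * 2 ^ (i - i') \<le> 2 ^ (j + i)"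
    if "i' \<le> i" "l \<le> 2 ^ (j + i')" for i' l
  proof -
    show "dyad (j + i') T l = dyad (j + i) T (l * 2 ^ (i - i'))"
      using dyad_scale[of "j + i'" "i - i'" T l] that by simp
    have "l * 2 ^ (i - i') \<le> 2 ^ (j + i') * 2 ^ (i - i')" using that by simp
    also have "\<dots> = 2 ^ (j + i)" using that by (simp add: power_add[symmetric])
    finally show "l * 2 ^ (i - i') \<le> 2 ^ (j + i)" .
  qed
  have C: "Suc l \<le> 2 ^ (j + i')" if "l \<in> C i'" for l i'
  proof -
    have "Suc k * 2 ^ i' \<le> 2 ^ j * 2 ^ i'" using k by (intro mult_right_mono) auto
    then show ?thesis using that by (simp add: C_def power_add)
  qed
  have diff2: "integrable R (\<lambda>x. (u x - v x)\<^sup>2)"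
    if "u \<in> borel_measurable R" "v \<in> borel_measurable R" "integrable R (\<lambda>x. (u x)\<^sup>2)" "integrable R (\<lambda>x. (v x)\<^sup>2)"
    for R :: "'z measure" and u v :: "'z \<Rightarrow> real"
  proof -
    have "integrable R (\<lambda>x. (u x)\<^sup>2 - 2 * (u x * v x) + (v x)\<^sup>2)"
      using that integrable_mult_of_squares[OF that] by (intro Bochner_Integration.integrable_add Bochner_Integration.integrable_diff integrable_mult_right)
    then show ?thesis by (simp add: power2_diff algebra_simps)
  qed
  have fg: "f (dyad (j + i') T l) \<in> borel_measurable P" "integrable P (\<lambda>x. (f (dyad (j + i') T l) x)\<^sup>2)"
    "g (dyad (j + i') T l) \<in> borel_measurable Q" "integrable Q (\<lambda>y. (g (dyad (j + i') T l) y)\<^sup>2)"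
    if "i' \<le> i" "l \<le> 2 ^ (j + i')" for i' l
    unfolding grid(1)[OF that] using f[OF grid(2)[OF that]] g[OF grid(2)[OF that]] by auto
  have Xm: "X i' l \<in> borel_measurable P" "integrable P (\<lambda>x. (X i' l x)\<^sup>2)"
    and Ym: "Y i' l \<in> borel_measurable Q" "integrable Q (\<lambda>x. (Y i' l x)\<^sup>2)" if "i' \<le> i" "l \<in> C i'" for i' l
    using fg[OF that(1), of l] fg[OF that(1) C[OF that(2)]] C[OF that(2)]
    unfolding X_def[abs_def] Y_def[abs_def] grid_inc_def by (auto intro!: borel_measurable_diff diff2)
  define G where "G i' z = grid_area (j + i') T (k * 2 ^ i') (Suc k * 2 ^ i') (\<lambda>t. f t (fst z)) (\<lambda>t. g t (snd z))" for i' z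
  define U where "U i' z = (\<Sum>l\<in>C i'. X (Suc i') (2 * l) (fst z) * Y (Suc i') (Suc (2 * l)) (snd z))" for i' z
  define V where "V i' z = (\<Sum>l\<in>C i'. X (Suc i') (Suc (2 * l)) (fst z) * Y (Suc i') (2 * l) (snd z))" for i' z
  \<comment> \<open>The telescoping series of the area: the term for interpolation by a single
    chord, followed by the changes caused by the successive refinements.\<close>
  define a where "a i' z = (case i' of 0 \<Rightarrow> G 0 z | Suc i' \<Rightarrow> (U i' z - V i' z) / 2)" for i' z
  have Gs: "G (Suc i') z = G i' z + (U i' z - V i' z) / 2" for i' z
  proof -
    have 1: "k * 2 ^ Suc i' = 2 * (k * 2 ^ i')" "Suc k * 2 ^ Suc i' = 2 * (Suc k * 2 ^ i')" by auto
    show ?thesis unfolding G_def U_def V_def C_def X_def Y_def 1 add_Suc_right grid_area_refine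
      by (simp add: sum_subtractf sum_divide_distrib diff_divide_distrib)
  qed
  have Ga: "G i' z = (\<Sum>r\<le>i'. a r z)" for i' z
    by (induction i') (auto simp: a_def Gs)
  have E0: "0 \<le> E" using order_trans[OF _ Rf[of 0]] by (auto intro!: sum_nonneg)
  have Cd: "2 * l \<in> C (Suc r)" "Suc (2 * l) \<in> C (Suc r)" if "l \<in> C r" for l r
    using that by (auto simp: C_def)
  \<comment> \<open>Even and odd half cells form subsets of the cells of the next level, so
    restricting a nonnegative double sum to them can only decrease it.\<close>
  have sub: "(\<Sum>l\<in>C r. \<Sum>l'\<in>C r. F (\<phi> l) (\<phi> l')) \<le> (\<Sum>l\<in>C (Suc r). \<Sum>l'\<in>C (Suc r). F l l')"
    if "\<And>l l'. 0 \<le> F l l'" "inj \<phi>" "\<And>l. l \<in> C r \<Longrightarrow> \<phi> l \<in> C (Suc r)" for F :: "nat \<Rightarrow> nat \<Rightarrow> real" and \<phi> r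
  proof -
    have "(\<Sum>l\<in>C r. \<Sum>l'\<in>C r. F (\<phi> l) (\<phi> l')) = (\<Sum>l\<in>\<phi> ` C r. \<Sum>l'\<in>\<phi> ` C r. F l l')"
      using that(2) by (simp add: sum.reindex inj_on_subset[OF that(2)])
    also have "\<dots> \<le> (\<Sum>l\<in>C (Suc r). \<Sum>l'\<in>\<phi> ` C r. F l l')"
      using that by (intro sum_mono2) (auto simp: C_def intro!: sum_nonneg)
    also have "\<dots> \<le> (\<Sum>l\<in>C (Suc r). \<Sum>l'\<in>C (Suc r). F l l')"
      using that by (intro sum_mono sum_mono2) (auto simp: C_def)
    finally show ?thesis .
  qed
  have sX: "(\<Sum>l\<in>C r. \<Sum>l'\<in>C r. (\<integral>x. X (Suc r) (\<phi> l) x * X (Suc r) (\<phi> l') x \<partial>P)\<^sup>2) \<le> E * q ^ Suc r"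
    and sY: "(\<Sum>l\<in>C r. \<Sum>l'\<in>C r. (\<integral>x. Y (Suc r) (\<phi> l) x * Y (Suc r) (\<phi> l') x \<partial>Q)\<^sup>2) \<le> E * q ^ Suc r"
    if "Suc r \<le> i" "inj \<phi>" "\<And>l. l \<in> C r \<Longrightarrow> \<phi> l \<in> C (Suc r)" for r \<phi>
    using sub[of "\<lambda>l l'. (\<integral>x. X (Suc r) l x * X (Suc r) l' x \<partial>P)\<^sup>2" \<phi> r] Rf[of "Suc r"]
      sub[of "\<lambda>l l'. (\<integral>x. Y (Suc r) l x * Y (Suc r) l' x \<partial>Q)\<^sup>2" \<phi> r] Rg[of "Suc r"] that
    unfolding X_def Y_def C_def by (auto simp del: power_Suc mult_Suc intro: order_trans)
  have inj2: "inj (\<lambda>l::nat. 2 * l)" "inj (\<lambda>l::nat. Suc (2 * l))" by (auto simp: inj_def)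
  have bs: "integrable (P \<Otimes>\<^sub>M Q) (\<lambda>z. (\<Sum>l\<in>C r. X (Suc r) (\<phi> l) (fst z) * Y (Suc r) (\<psi> l) (snd z))\<^sup>2) \<and>
      (\<integral>z. (\<Sum>l\<in>C r. X (Suc r) (\<phi> l) (fst z) * Y (Suc r) (\<psi> l) (snd z))\<^sup>2 \<partial>(P \<Otimes>\<^sub>M Q)) \<le> E * q ^ Suc r"
    if r: "Suc r \<le> i" and \<phi>: "inj \<phi>" "\<And>l. l \<in> C r \<Longrightarrow> \<phi> l \<in> C (Suc r)"
      and \<psi>: "inj \<psi>" "\<And>l. l \<in> C r \<Longrightarrow> \<psi> l \<in> C (Suc r)" for r \<phi> \<psi>
    using bilinear_sum_second_moment[OF P Q, of "C r" "\<lambda>l. X (Suc r) (\<phi> l)" "\<lambda>l. Y (Suc r) (\<psi> l)"]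
      Xm[OF r \<phi>(2)] Ym[OF r \<psi>(2)] sX[OF r \<phi>] sY[OF r \<psi>]
    by (auto simp: C_def case_prod_beta' simp del: power_Suc)
  have Us: "integrable (P \<Otimes>\<^sub>M Q) (\<lambda>z. (U r z)\<^sup>2)" "(\<integral>z. (U r z)\<^sup>2 \<partial>(P \<Otimes>\<^sub>M Q)) \<le> E * q ^ Suc r"
    and Vs: "integrable (P \<Otimes>\<^sub>M Q) (\<lambda>z. (V r z)\<^sup>2)" "(\<integral>z. (V r z)\<^sup>2 \<partial>(P \<Otimes>\<^sub>M Q)) \<le> E * q ^ Suc r" if "Suc r \<le> i" for r
    using bs[OF that inj2(1) Cd(1) inj2(2) Cd(2)] bs[OF that inj2(2) Cd(2) inj2(1) Cd(1)]
    unfolding U_def V_def by auto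
  have XYm: "(\<lambda>z. X r l (fst z)) \<in> borel_measurable (P \<Otimes>\<^sub>M Q)" "(\<lambda>z. Y r l (snd z)) \<in> borel_measurable (P \<Otimes>\<^sub>M Q)"
    if "r \<le> i" "l \<in> C r" for r l
    using measurable_compose[OF measurable_fst Xm(1)[OF that]] measurable_compose[OF measurable_snd Ym(1)[OF that]] by auto
  have Um: "U r \<in> borel_measurable (P \<Otimes>\<^sub>M Q)" "V r \<in> borel_measurable (P \<Otimes>\<^sub>M Q)" if "Suc r \<le> i" for r
    unfolding U_def[abs_def] V_def[abs_def] using that Cd
    by (auto intro!: borel_measurable_sum borel_measurable_times XYm)
  have as: "integrable (P \<Otimes>\<^sub>M Q) (\<lambda>z. (a r z)\<^sup>2) \<and> (\<integral>z. (a r z)\<^sup>2 \<partial>(P \<Otimes>\<^sub>M Q)) \<le> E * q ^ r" if "r \<le> i" for r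
  proof (cases r)
    case 0
    have G0: "G 0 = (\<lambda>z. (\<Sum>l\<in>C 0. X 0 l (fst z) * Y 0 l (snd z)) / 2)"
      by (auto simp: G_def grid_area_def C_def X_def Y_def fun_eq_iff grid_inc_def field_simps)
    have b: "integrable (P \<Otimes>\<^sub>M Q) (\<lambda>z. (\<Sum>l\<in>C 0. X 0 l (fst z) * Y 0 l (snd z))\<^sup>2)"
      "(\<integral>z. (\<Sum>l\<in>C 0. X 0 l (fst z) * Y 0 l (snd z))\<^sup>2 \<partial>(P \<Otimes>\<^sub>M Q)) \<le> E"
      using bilinear_sum_second_moment[OF P Q, of "C 0" "X 0" "Y 0"] Xm[of 0] Ym[of 0] Rf[of 0] Rg[of 0]
      unfolding X_def Y_def C_def by (auto simp: case_prod_beta')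
    have "(\<integral>z. (a r z)\<^sup>2 \<partial>(P \<Otimes>\<^sub>M Q)) = (\<integral>z. (\<Sum>l\<in>C 0. X 0 l (fst z) * Y 0 l (snd z))\<^sup>2 \<partial>(P \<Otimes>\<^sub>M Q)) / 4"
      by (simp add: a_def 0 G0 power_divide)
    then show ?thesis using b E0 by (auto simp: a_def 0 G0 power_divide)
  next
    case (Suc r')
    with that have r': "Suc r' \<le> i" by simp
    note [measurable] = Um[OF r']
    have le: "(a r z)\<^sup>2 \<le> ((U r' z)\<^sup>2 + (V r' z)\<^sup>2) / 2" for z
      using zero_le_power2[of "U r' z + V r' z"] by (simp add: a_def Suc power_divide power2_eq_square algebra_simps)
    have ii: "integrable (P \<Otimes>\<^sub>M Q) (\<lambda>z. ((U r' z)\<^sup>2 + (V r' z)\<^sup>2) / 2)" using Us[OF r'] Vs[OF r'] by auto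
    have i: "integrable (P \<Otimes>\<^sub>M Q) (\<lambda>z. (a r z)\<^sup>2)"
      by (rule Bochner_Integration.integrable_bound[OF ii]) (use le in \<open>auto simp: a_def Suc\<close>)
    have "(\<integral>z. (a r z)\<^sup>2 \<partial>(P \<Otimes>\<^sub>M Q)) \<le> (\<integral>z. ((U r' z)\<^sup>2 + (V r' z)\<^sup>2) / 2 \<partial>(P \<Otimes>\<^sub>M Q))"
      using i ii le by (intro integral_mono) auto
    also have "\<dots> \<le> E * q ^ r" using Us[OF r'] Vs[OF r'] by (simp add: Suc)
    finally show ?thesis using i by simp
  qed
  have am: "a r \<in> borel_measurable (P \<Otimes>\<^sub>M Q)" if "r \<le> i" for r
  proof (cases r)
    case 0
    have "a r = (\<lambda>z. (\<Sum>l\<in>C 0. X 0 l (fst z) * Y 0 l (snd z)) / 2)"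
      by (auto simp: a_def 0 G_def grid_area_def C_def X_def Y_def fun_eq_iff grid_inc_def field_simps)
    then show ?thesis using XYm[of 0] by (auto intro!: borel_measurable_sum borel_measurable_times borel_measurable_divide)
  next
    case (Suc r')
    then show ?thesis using that Um[of r'] by (auto simp: a_def[abs_def])
  qed
  \<comment> \<open>The square root balances the two sums: q^r / s^r = s^r, and the weights s^r
    themselves sum to at most 1 / (1 - s), whence the square in the result.\<close>
  define s where "s = sqrt q"
  have s: "0 < s" "s < 1" "s * s = q" using q by (auto simp: s_def)
  have le: "(G i z)\<^sup>2 \<le> 1 / (1 - s) * (\<Sum>r\<le>i. (a r z)\<^sup>2 / s ^ r)" for z
    unfolding Ga by (rule weighted_sum_square_le[OF s(1,2)])
  have iR: "integrable (P \<Otimes>\<^sub>M Q) (\<lambda>z. 1 / (1 - s) * (\<Sum>r\<le>i. (a r z)\<^sup>2 / s ^ r))"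
    by (intro integrable_mult_right Bochner_Integration.integrable_sum Bochner_Integration.integrable_divide) (use as in auto)
  have iG: "integrable (P \<Otimes>\<^sub>M Q) (\<lambda>z. (G i z)\<^sup>2)"
  proof (rule Bochner_Integration.integrable_bound[OF iR])
    show "(\<lambda>z. (G i z)\<^sup>2) \<in> borel_measurable (P \<Otimes>\<^sub>M Q)" unfolding Ga using am by auto
    have "norm ((G i z)\<^sup>2) \<le> norm (1 / (1 - s) * (\<Sum>r\<le>i. (a r z)\<^sup>2 / s ^ r))" for z
      using le[of z] unfolding real_norm_def by (subst abs_of_nonneg[OF zero_le_power2]) linarith
    then show "AE z in P \<Otimes>\<^sub>M Q. norm ((G i z)\<^sup>2) \<le> norm (1 / (1 - s) * (\<Sum>r\<le>i. (a r z)\<^sup>2 / s ^ r))" by simp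
  qed
  have "(\<integral>z. (G i z)\<^sup>2 \<partial>(P \<Otimes>\<^sub>M Q)) \<le> (\<integral>z. 1 / (1 - s) * (\<Sum>r\<le>i. (a r z)\<^sup>2 / s ^ r) \<partial>(P \<Otimes>\<^sub>M Q))"
    using iR iG le by (intro integral_mono)
  also have "\<dots> = 1 / (1 - s) * (\<Sum>r\<le>i. (\<integral>z. (a r z)\<^sup>2 \<partial>(P \<Otimes>\<^sub>M Q)) / s ^ r)"
    using as by (simp add: Bochner_Integration.integral_sum)
  also have "\<dots> \<le> 1 / (1 - s) * (\<Sum>r\<le>i. E * q ^ r / s ^ r)"
    using as s by (intro mult_left_mono sum_mono divide_right_mono) auto
  also have "(\<Sum>r\<le>i. E * q ^ r / s ^ r) = E * (\<Sum>r\<le>i. s ^ r)"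
    using s unfolding s(3)[symmetric] by (simp add: sum_distrib_left power_mult_distrib)
  also have "(\<Sum>r\<le>i. s ^ r) \<le> 1 / (1 - s)" using s by (simp add: sum_gp0 divide_right_mono)
  finally have "(\<integral>z. (G i z)\<^sup>2 \<partial>(P \<Otimes>\<^sub>M Q)) \<le> 1 / (1 - s) * (E * (1 / (1 - s)))"
    using s E0 by (simp add: mult_left_mono divide_right_mono)
  then show ?thesis by (simp add: G_def case_prod_beta' s_def power2_eq_square)
qed

section \<open>Piecewise linear paths and dyadic chaining\<close>

lemma outer_algebra:
  "outer (a + b) c = outer a c + outer b c" "outer (a - b) c = outer a c - outer b c"
  "outer a (b + c) = outer a b + outer a c" "outer a (b - c) = outer a b - outer a c"
  "outer (r *\<^sub>R a) c = r *\<^sub>R outer a c" "outer a (r *\<^sub>R c) = r *\<^sub>R outer a c"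
  "outer 0 c = 0" "outer a 0 = 0"
  by (simp_all add: outer_def vec_eq_iff algebra_simps)

lemma norm_outer: "norm (outer a b) = norm a * norm b"
proof -
  have row: "outer a b $ i = (a $ i) *\<^sub>R b" for i by (simp add: outer_def vec_eq_iff)
  have "norm (outer a b) = L2_set (\<lambda>i. \<bar>a $ i\<bar> * norm b) UNIV"
    by (simp only: norm_vec_def[of "outer a b"] row norm_scaleR)
  also have "\<dots> = norm a * norm b"
    unfolding norm_vec_def[of a] by (simp add: L2_set_left_distrib[symmetric])
  finally show ?thesis .
qed

lemma bounded_linear_outer_right: "bounded_linear (outer a)"
proof (rule bounded_linear_intro)
  show "norm (outer a x) \<le> norm x * norm a" for x by (simp add: norm_outer mult.commute)
qed (simp_all add: outer_algebra)

context
  fixes T :: real and n :: nat and x :: "real \<Rightarrow> real^'d"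
  assumes T: "0 < T"
begin

lemma dyad_idx_cell:
  assumes "k < 2 ^ n" "dyad n T k \<le> r" "r < dyad n T (Suc k)"
  shows "dyad_idx n T r = k"
proof -
  have "real k \<le> r * 2 ^ n / T" "r * 2 ^ n / T < real k + 1"
    using assms T by (auto simp: dyad_def field_simps)
  then have "\<lfloor>r * 2 ^ n / T\<rfloor> = int k" by linarith
  then show ?thesis using assms(1) by (simp add: dyad_idx_def)
qed

lemma pl_slope_cell:
  assumes "k < 2 ^ n" "dyad n T k \<le> r" "r < dyad n T (Suc k)"
  shows "pl_slope n T x r = (2 ^ n / T) *\<^sub>R (x (dyad n T (Suc k)) - x (dyad n T k))"
  by (simp add: pl_slope_def dyad_idx_cell[OF assms] Let_def)

lemma dyad_Suc_diff: "dyad n T (Suc k) - dyad n T k = T / 2 ^ n"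
  by (simp add: dyad_def field_simps)

lemma dyad_strict_mono: "dyad n T k < dyad n T l \<longleftrightarrow> k < l"
  using T by (simp add: dyad_def field_simps)

text \<open>The formula extends to the closed cell. At its right end \<open>dyad_idx\<close> already
  selects the next cell, whose left value agrees; at T it is clamped to the last cell.\<close>

lemma pl_approx_cell:
  assumes k: "k < 2 ^ n" and r: "dyad n T k \<le> r" "r \<le> dyad n T (Suc k)"
  shows "pl_approx n T x r = x (dyad n T k) + ((r - dyad n T k) * 2 ^ n / T) *\<^sub>R (x (dyad n T (Suc k)) - x (dyad n T k))"
proof (cases "r < dyad n T (Suc k)")
  case True
  then show ?thesis by (simp add: pl_approx_def dyad_idx_cell[OF k r(1)] Let_def)
next
  case False
  then have r': "r = dyad n T (Suc k)" using r by simp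
  have one: "(dyad n T (Suc k) - dyad n T k) * 2 ^ n / T = 1" using T by (simp add: dyad_Suc_diff)
  show ?thesis
  proof (cases "Suc k < 2 ^ n")
    case True
    have "dyad_idx n T r = Suc k" using True unfolding r' by (intro dyad_idx_cell) (auto simp: dyad_strict_mono)
    then have "pl_approx n T x r = x r" by (simp add: pl_approx_def Let_def r')
    then show ?thesis unfolding r' one by simp
  next
    case False
    then have sk: "Suc k = 2 ^ n" using k by simp
    have "dyad n T (Suc k) * 2 ^ n / T = real (Suc k)" using T by (simp add: dyad_def)
    then have "\<lfloor>r * 2 ^ n / T\<rfloor> = int (Suc k)" unfolding r' by (metis floor_of_nat)
    then have "dyad_idx n T r = min (Suc k) (2 ^ n - 1)" by (simp add: dyad_idx_def)
    then have "dyad_idx n T r = k" using sk by linarith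
    then show ?thesis by (simp add: pl_approx_def Let_def)
  qed
qed

lemma pl_approx_grid:
  assumes "k \<le> 2 ^ n" shows "pl_approx n T x (dyad n T k) = x (dyad n T k)"
proof (cases "k < 2 ^ n")
  case True
  then show ?thesis using pl_approx_cell[OF True order_refl] by (simp add: dyad_strict_mono less_imp_le)
next
  case False
  then obtain k' where k': "k = Suc k'" "k' < 2 ^ n" using assms by (cases k) auto
  then show ?thesis
    using pl_approx_cell[OF k'(2), of "dyad n T k"] T
    by (auto simp: dyad_strict_mono less_imp_le dyad_Suc_diff)
qed

text \<open>On a cell the integrand is affine in r, so its integral is the midpoint value times the
  length. At t the slope may already be that of the next cell, hence the exceptional set
  {t}.\<close>

lemma pl_cell_integrals:
  assumes k: "k < 2 ^ n" and st: "dyad n T k \<le> s" "s \<le> t" "t \<le> dyad n T (Suc k)"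
  shows "(pl_slope n T x has_integral (pl_approx n T x t - pl_approx n T x s)) {s..t}"
    and "((\<lambda>r. outer (pl_approx n T x r - c) (pl_slope n T x r)) has_integral
      outer ((1 / 2) *\<^sub>R (pl_approx n T x s + pl_approx n T x t) - c) (pl_approx n T x t - pl_approx n T x s)) {s..t}"
proof -
  define v where "v = (2 ^ n / T) *\<^sub>R (x (dyad n T (Suc k)) - x (dyad n T k))"
  define a where "a = x (dyad n T k) - dyad n T k *\<^sub>R v"
  have y: "pl_approx n T x r = a + r *\<^sub>R v" if "r \<in> {s..t}" for r
  proof -
    have "((r - dyad n T k) * 2 ^ n / T) *\<^sub>R (x (dyad n T (Suc k)) - x (dyad n T k)) = (r - dyad n T k) *\<^sub>R v"
      by (simp add: v_def)
    then show ?thesis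
      using pl_approx_cell[OF k, of r] that st by (simp add: a_def scaleR_diff_left)
  qed
  have sl: "pl_slope n T x r = v" if "r \<in> {s..t} - {t}" for r
    using pl_slope_cell[OF k, of r] that st by (simp add: v_def)
  have yst: "pl_approx n T x s = a + s *\<^sub>R v" "pl_approx n T x t = a + t *\<^sub>R v" using y st by auto
  have "((\<lambda>r. v) has_integral (t - s) *\<^sub>R v) {s..t}"
    using has_integral_const_real[of v s t] st by simp
  then have "(pl_slope n T x has_integral (t - s) *\<^sub>R v) {s..t}"
    by (rule has_integral_spike_finite[rotated 2, of _ _ _ "{t}"]) (use sl in auto)
  then show "(pl_slope n T x has_integral (pl_approx n T x t - pl_approx n T x s)) {s..t}"
    by (simp add: yst algebra_simps)
  have "((\<lambda>r. outer (a - c) v + r *\<^sub>R outer v v) has_integral ((t - s) *\<^sub>R outer (a - c) v + ((t\<^sup>2 - s\<^sup>2) / 2) *\<^sub>R outer v v)) {s..t}"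
    using has_integral_const_real[of "outer (a - c) v" s t] st
    by (intro has_integral_add has_integral_scaleR_left ident_has_integral) auto
  then have "((\<lambda>r. outer (pl_approx n T x r - c) (pl_slope n T x r)) has_integral
    ((t - s) *\<^sub>R outer (a - c) v + ((t\<^sup>2 - s\<^sup>2) / 2) *\<^sub>R outer v v)) {s..t}"
  proof (rule has_integral_spike_finite[rotated 2, of _ _ _ "{t}"])
    show "outer (pl_approx n T x r - c) (pl_slope n T x r) = outer (a - c) v + r *\<^sub>R outer v v" if "r \<in> {s..t} - {t}" for r
      using y[of r] sl[OF that] that by (simp add: outer_algebra algebra_simps)
  qed simp
  also have "(t - s) *\<^sub>R outer (a - c) v + ((t\<^sup>2 - s\<^sup>2) / 2) *\<^sub>R outer v v
    = outer ((1 / 2) *\<^sub>R (pl_approx n T x s + pl_approx n T x t) - c) (pl_approx n T x t - pl_approx n T x s)"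
    unfolding yst by (simp add: vec_eq_iff outer_def power2_eq_square field_simps)
  finally show "((\<lambda>r. outer (pl_approx n T x r - c) (pl_slope n T x r)) has_integral
      outer ((1 / 2) *\<^sub>R (pl_approx n T x s + pl_approx n T x t) - c) (pl_approx n T x t - pl_approx n T x s)) {s..t}" .
qed

lemma dyad_le_T:
  assumes "k \<le> 2 ^ n" shows "dyad n T k \<le> T"
proof -
  have "real k \<le> real (2 ^ n)" using assms by (subst of_nat_le_iff)
  then have "real k * T \<le> real (2 ^ n) * T" using T by (intro mult_right_mono) auto
  then show ?thesis by (simp add: dyad_def field_simps)
qed

lemma in_cell:
  assumes "0 \<le> t" "t \<le> T"
  obtains k where "k < 2 ^ n" "dyad n T k \<le> t" "t \<le> dyad n T (Suc k)"
proof (cases "t = T")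
  case True
  have "dyad n T (Suc (2 ^ n - 1)) = T" by (simp add: dyad_def)
  then show ?thesis using that[of "2 ^ n - 1"] True dyad_strict_mono[of "2 ^ n - 1" "Suc (2 ^ n - 1)"] by simp
next
  case False
  define k where "k = nat \<lfloor>t * 2 ^ n / T\<rfloor>"
  have p: "0 \<le> t * 2 ^ n / T" "t * 2 ^ n / T < 2 ^ n" using assms False T by (auto simp: field_simps)
  then have k: "real k \<le> t * 2 ^ n / T" "t * 2 ^ n / T < real k + 1" unfolding k_def by linarith+
  then have "real k < real (2 ^ n)" using p by (simp only: of_nat_power of_nat_numeral)
  then have "k < 2 ^ n" by (simp only: of_nat_less_iff)
  moreover have "dyad n T k \<le> t" "t \<le> dyad n T (Suc k)" using k T by (auto simp: dyad_def field_simps)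
  ultimately show ?thesis by (rule that)
qed

text \<open>Cells are glued together from 0 upwards, the last one being cut at t. General intervals
  are obtained from this by restriction and subtraction.\<close>

lemma pl_prefix_integrals:
  assumes "0 \<le> t" "t \<le> T"
  shows "(pl_slope n T x has_integral (pl_approx n T x t - pl_approx n T x 0)) {0..t}"
    and "(\<lambda>r. outer (pl_approx n T x r - c) (pl_slope n T x r)) integrable_on {0..t}"
proof -
  have grid: "(pl_slope n T x has_integral (pl_approx n T x (dyad n T k) - pl_approx n T x 0)) {0..dyad n T k} \<and>
    (\<lambda>r. outer (pl_approx n T x r - c) (pl_slope n T x r)) integrable_on {0..dyad n T k}" if "k \<le> 2 ^ n" for k
    using that
  proof (induction k)
    case 0
    then show ?case by (simp add: dyad_def has_integral_refl has_integral_integrable[OF has_integral_refl(2)])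
  next
    case (Suc k)
    have k: "k < 2 ^ n" using Suc by simp
    have o: "0 \<le> dyad n T k" "dyad n T k \<le> dyad n T (Suc k)" using T by (auto simp: dyad_def field_simps)
    show ?case
      using has_integral_combine[OF o conjunct1[OF Suc.IH] pl_cell_integrals(1)[OF k order_refl o(2) order_refl]]
        Henstock_Kurzweil_Integration.integrable_combine[OF o conjunct2[OF Suc.IH] has_integral_integrable[OF pl_cell_integrals(2)[OF k order_refl o(2) order_refl]]] Suc.prems
      by simp
  qed
  obtain k where k: "k < 2 ^ n" "dyad n T k \<le> t" "t \<le> dyad n T (Suc k)" using in_cell[OF assms] .
  have o: "0 \<le> dyad n T k" using T by (auto simp: dyad_def)
  note g = grid[OF less_imp_le[OF k(1)]]
  show "(pl_slope n T x has_integral (pl_approx n T x t - pl_approx n T x 0)) {0..t}"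
    using has_integral_combine[OF o k(2) conjunct1[OF g] pl_cell_integrals(1)[OF k(1) order_refl k(2,3)]] by simp
  show "(\<lambda>r. outer (pl_approx n T x r - c) (pl_slope n T x r)) integrable_on {0..t}"
    using Henstock_Kurzweil_Integration.integrable_combine[OF o k(2) conjunct2[OF g] has_integral_integrable[OF pl_cell_integrals(2)[OF k(1) order_refl k(2,3)]]] .
qed

lemma pl_integrals:
  assumes "0 \<le> s" "s \<le> t" "t \<le> T"
  shows "(pl_slope n T x has_integral (pl_approx n T x t - pl_approx n T x s)) {s..t}"
    and "(\<lambda>r. outer (pl_approx n T x r - c) (pl_slope n T x r)) integrable_on {s..t}"
proof -
  have t: "0 \<le> t" and s: "s \<le> T" using assms by auto
  show "(\<lambda>r. outer (pl_approx n T x r - c) (pl_slope n T x r)) integrable_on {s..t}"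
    by (rule integrable_on_subinterval[OF pl_prefix_integrals(2)[OF t assms(3)]]) (use assms in auto)
  have i: "pl_slope n T x integrable_on {s..t}"
    by (rule integrable_on_subinterval[OF has_integral_integrable[OF pl_prefix_integrals(1)[OF t assms(3)]]]) (use assms in auto)
  have "pl_approx n T x s - pl_approx n T x 0 + integral {s..t} (pl_slope n T x) = pl_approx n T x t - pl_approx n T x 0"
    using has_integral_unique[OF has_integral_combine[OF assms(1,2) pl_prefix_integrals(1)[OF assms(1) s] integrable_integral[OF i]] pl_prefix_integrals(1)[OF t assms(3)]] .
  then have "integral {s..t} (pl_slope n T x) = pl_approx n T x t - pl_approx n T x s" by (simp add: algebra_simps)
  then show "(pl_slope n T x has_integral (pl_approx n T x t - pl_approx n T x s)) {s..t}"
    using integrable_integral[OF i] by simp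
qed

text \<open>On [u, t] the base point of the inner increment is moved from s to u; the constant left
  factor split off in this way integrates to the product of the two increments.\<close>

lemma pl_area_chen:
  assumes "0 \<le> s" "s \<le> u" "u \<le> t" "t \<le> T"
  shows "pl_area n T x s t = pl_area n T x s u + pl_area n T x u t
    + outer (pl_approx n T x u - pl_approx n T x s) (pl_approx n T x t - pl_approx n T x u)"
proof -
  let ?y = "pl_approx n T x" and ?v = "pl_slope n T x"
  have u: "0 \<le> u" "u \<le> T" "s \<le> t" using assms by auto
  have "pl_area n T x s t = pl_area n T x s u + integral {u..t} (\<lambda>r. outer (?y r - ?y s) (?v r))"
    unfolding pl_area_def
    by (rule Henstock_Kurzweil_Integration.integral_combine[symmetric]) (use assms u pl_integrals(2) in auto)
  also have "integral {u..t} (\<lambda>r. outer (?y r - ?y s) (?v r)) = integral {u..t} (\<lambda>r. outer (?y r - ?y u) (?v r) + outer (?y u - ?y s) (?v r))"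
    by (simp add: outer_algebra)
  also have "\<dots> = pl_area n T x u t + outer (?y u - ?y s) (?y t - ?y u)"
  proof (rule integral_unique, rule has_integral_add)
    show "((\<lambda>r. outer (?y r - ?y u) (?v r)) has_integral pl_area n T x u t) {u..t}"
      unfolding pl_area_def by (intro integrable_integral pl_integrals(2) u assms)
    show "((\<lambda>r. outer (?y u - ?y s) (?v r)) has_integral outer (?y u - ?y s) (?y t - ?y u)) {u..t}"
      using has_integral_linear[OF pl_integrals(1)[OF u(1) assms(3,4)] bounded_linear_outer_right] by (simp add: comp_def)
  qed
  finally show ?thesis by (simp add: add.assoc)
qed

lemma pl_area_cell:
  assumes k: "k < 2 ^ n" and st: "dyad n T k \<le> s" "s \<le> t" "t \<le> dyad n T (Suc k)"
  shows "pl_area n T x s t = (1 / 2) *\<^sub>R outer (pl_approx n T x t - pl_approx n T x s) (pl_approx n T x t - pl_approx n T x s)"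
proof -
  have "pl_area n T x s t = outer ((1 / 2) *\<^sub>R (pl_approx n T x s + pl_approx n T x t) - pl_approx n T x s) (pl_approx n T x t - pl_approx n T x s)"
    unfolding pl_area_def by (rule integral_unique[OF pl_cell_integrals(2)[OF assms]])
  also have "\<dots> = (1 / 2) *\<^sub>R outer (pl_approx n T x t - pl_approx n T x s) (pl_approx n T x t - pl_approx n T x s)"
    by (simp add: vec_eq_iff outer_def field_simps)
  finally show ?thesis .
qed

lemma pl_area_refl [simp]: "pl_area n T x s s = 0"
  by (simp add: pl_area_def)

text \<open>Integration by parts for the interpolation, or weak geometricity. It is clear on a cell,
  where the area is half a square; Chen's relation carries it to [0, t], and removing [0, s] gives
  the general case.\<close>

lemma pl_area_sym:
  assumes "0 \<le> s" "s \<le> t" "t \<le> T"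
  shows "pl_area n T x s t $ i $ j + pl_area n T x s t $ j $ i
    = (pl_approx n T x t - pl_approx n T x s) $ i * (pl_approx n T x t - pl_approx n T x s) $ j"
proof -
  let ?y = "pl_approx n T x"
  let ?S = "\<lambda>s t. pl_area n T x s t $ i $ j + pl_area n T x s t $ j $ i = (?y t - ?y s) $ i * (?y t - ?y s) $ j"
  have cell: "?S s t" if "k < 2 ^ n" "dyad n T k \<le> s" "s \<le> t" "t \<le> dyad n T (Suc k)" for k s t
    unfolding pl_area_cell[OF that] by (simp add: outer_def)
  have comb: "?S s t" if "?S s u" "?S u t" "0 \<le> s" "s \<le> u" "u \<le> t" "t \<le> T" for s u t
    using that(1,2) unfolding pl_area_chen[OF that(3-6)] by (simp add: outer_def algebra_simps)
  have grid: "?S 0 (dyad n T k)" if "k \<le> 2 ^ n" for k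
    using that
  proof (induction k)
    case 0 then show ?case by (simp add: dyad_def)
  next
    case (Suc k)
    have le: "dyad n T (Suc k) \<le> T" using Suc.prems by (rule dyad_le_T)
    have o: "0 \<le> dyad n T k" "dyad n T k \<le> dyad n T (Suc k)" using T by (auto simp: dyad_def field_simps)
    show ?case by (rule comb[OF _ _ order_refl o le]) (use Suc cell[of k] o in auto)
  qed
  have pre: "?S 0 t" if t: "0 \<le> t" "t \<le> T" for t
  proof -
    obtain k where k: "k < 2 ^ n" "dyad n T k \<le> t" "t \<le> dyad n T (Suc k)" using in_cell[OF t] .
    have o: "0 \<le> dyad n T k" using T by (auto simp: dyad_def)
    show ?thesis by (rule comb[OF grid cell[OF k(1) order_refl k(2,3)] order_refl o k(2) t(2)]) (use k in auto)
  qed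
  have "?S 0 s" "?S 0 t" using pre assms by auto
  then show ?thesis
    unfolding pl_area_chen[OF order_refl assms(1,2,3)] by (simp add: outer_def algebra_simps)
qed

text \<open>This turns the area between grid points into a polynomial in finitely many values of the
  path, to which the moment estimates apply.\<close>

lemma pl_area_grid:
  assumes "a \<le> b" "b \<le> 2 ^ n"
  shows "pl_area n T x (dyad n T a) (dyad n T b) $ i $ j = grid_area n T a b (\<lambda>t. x t $ i) (\<lambda>t. x t $ j)"
  using assms
proof (induction b rule: dec_induct)
  case base
  then show ?case by (simp add: grid_area_def)
next
  case (step b)
  have o: "0 \<le> dyad n T a" "dyad n T a \<le> dyad n T b" "dyad n T b \<le> dyad n T (Suc b)"
    using T step.hyps by (auto simp: dyad_def field_simps)
  have b: "b < 2 ^ n" using step.prems by simp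
  have "pl_area n T x (dyad n T a) (dyad n T (Suc b)) $ i $ j = grid_area n T a b (\<lambda>t. x t $ i) (\<lambda>t. x t $ j)
    + ((x (dyad n T (Suc b)) + x (dyad n T b)) $ i / 2 - x (dyad n T a) $ i) * (x (dyad n T (Suc b)) - x (dyad n T b)) $ j"
    using step b
    unfolding pl_area_chen[OF o dyad_le_T[OF step.prems]] pl_area_cell[OF b order_refl o(3) order_refl]
    by (simp add: pl_approx_grid outer_def field_simps)
  then show ?case
    using step.hyps by (simp add: grid_area_def grid_inc_def algebra_simps)
qed

end

text \<open>Chaining for a multiplicative functional that is controlled on dyadic intervals. On one-sided
  subintervals of a dyadic interval of level \<open>i\<close> the bound follows by descending induction on \<open>i\<close>.\<close>

lemma dyadic_chaining:
  fixes y :: "real \<Rightarrow> real^'d" and A :: "real \<Rightarrow> real \<Rightarrow> real^'d^'d" and \<delta> :: "nat \<Rightarrow> real"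
  assumes T: "0 < T"
    and chen: "\<And>s u t. 0 \<le> s \<Longrightarrow> s \<le> u \<Longrightarrow> u \<le> t \<Longrightarrow> t \<le> T \<Longrightarrow> A s t = A s u + A u t + outer (y u - y s) (y t - y u)"
    and cell: "\<And>k s t. k < 2 ^ n \<Longrightarrow> dyad n T k \<le> s \<Longrightarrow> s \<le> t \<Longrightarrow> t \<le> dyad n T (Suc k) \<Longrightarrow>
        norm (y t - y s) \<le> \<delta> n \<and> norm (A s t) \<le> (\<delta> n)\<^sup>2"
    and dy: "\<And>i k. i \<le> n \<Longrightarrow> k < 2 ^ i \<Longrightarrow> norm (y (dyad i T (Suc k)) - y (dyad i T k)) \<le> \<delta> i
        \<and> norm (A (dyad i T k) (dyad i T (Suc k))) \<le> (\<delta> i)\<^sup>2"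
    and \<delta>: "\<And>i. 0 \<le> \<delta> i" "\<And>i. (1 + C) * \<delta> (Suc i) \<le> C * \<delta> i" and C: "1 \<le> C"
    and st: "0 \<le> s" "s < t" "t \<le> T" "T / 2 ^ n \<le> t - s"
  shows "\<exists>i\<le>n. T / 2 ^ i \<le> t - s \<and> norm (y t - y s) \<le> 3 * C * \<delta> i \<and> norm (A s t) \<le> (3 * C * \<delta> i)\<^sup>2"
proof -
  \<comment> \<open>Homogeneous size: increments count to first order and areas to second. Chen's
    relation makes it subadditive because r^2 + r'^2 + r r' \<le> (r + r')^2.\<close>
  define b where "b s t r \<longleftrightarrow> norm (y t - y s) \<le> r \<and> norm (A s t) \<le> r\<^sup>2" for s t r
  have comb: "b s t (r + r')" if "b s u r" "b u t r'" "0 \<le> s" "s \<le> u" "u \<le> t" "t \<le> T" for s u t r r'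
  proof -
    have r: "0 \<le> r" "0 \<le> r'" using that(1,2) norm_ge_zero order_trans unfolding b_def by blast+
    have "norm (y t - y s) \<le> norm (y u - y s) + norm (y t - y u)"
      using norm_triangle_ineq[of "y u - y s" "y t - y u"] by simp
    then have 1: "norm (y t - y s) \<le> r + r'" using that(1,2) unfolding b_def by linarith
    have "norm (A s t) \<le> norm (A s u) + norm (A u t) + norm (y u - y s) * norm (y t - y u)"
      unfolding chen[OF that(3-6)] norm_outer[symmetric] by (intro norm_triangle_mono order_refl)
    also have "\<dots> \<le> r\<^sup>2 + r'\<^sup>2 + r * r'"
      using that(1,2) r unfolding b_def by (intro add_mono mult_mono) auto
    also have "\<dots> \<le> (r + r')\<^sup>2" using r by (simp add: power2_eq_square algebra_simps)
    finally show ?thesis using 1 by (simp add: b_def)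
  qed
  have mono: "b s t r'" if "b s t r" "r \<le> r'" for s t r r'
  proof -
    have "0 \<le> r" using that(1) norm_ge_zero order_trans unfolding b_def by blast
    then have "r\<^sup>2 \<le> r'\<^sup>2" using that(2) by (intro power_mono)
    then show ?thesis using that unfolding b_def by linarith
  qed
  have refl: "b u u 0" if "0 \<le> u" "u \<le> T" for u
  proof -
    have "A u u = A u u + A u u + outer 0 0" using chen[of u u u] that by simp
    then show ?thesis by (simp add: b_def outer_algebra)
  qed
  have C0: "0 \<le> C * \<delta> i" for i using C \<delta>(1)[of i] by simp
  have half: "dyad (Suc i) T (2 * k) = dyad i T k" "dyad (Suc i) T (Suc (Suc (2 * k))) = dyad i T (Suc k)" for i k
    using dyad_Suc_double[of i T k] dyad_Suc_double[of i T "Suc k"] by auto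
  have dle: "dyad i T k \<le> dyad i T l" if "k \<le> l" for i k l
    using T that by (simp add: dyad_def field_simps)
  have d0: "0 \<le> dyad i T k" for i k using T by (simp add: dyad_def)
  have dT: "dyad i T k \<le> T" if "k \<le> 2 ^ i" for i k using dyad_le_T[OF T that] .
  \<comment> \<open>A one-sided piece of a cell of level i consists of at most one full half cell
    and a one-sided piece of the other half, which gives \<delta> (i+1) + C \<delta> (i+1) \<le> C
    \<delta> i. Level n is covered by the bound inside cells.\<close>
  have sided: "(\<forall>k t. k < 2 ^ i \<longrightarrow> dyad i T k \<le> t \<longrightarrow> t \<le> dyad i T (Suc k) \<longrightarrow>
      b (dyad i T k) t (C * \<delta> i) \<and> b t (dyad i T (Suc k)) (C * \<delta> i))" if "i \<le> n" for i
    using that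
  proof (induction i rule: inc_induct)
    case base
    have "\<delta> n \<le> C * \<delta> n" using C \<delta>(1)[of n] mult_right_mono[of 1 C "\<delta> n"] by simp
    then show ?case using cell mono unfolding b_def by (metis order_refl)
  next
    case (step i)
    show ?case
    proof (intro allI impI)
      fix k t assume k: "k < 2 ^ i" and t: "dyad i T k \<le> t" "t \<le> dyad i T (Suc k)"
      let ?m = "dyad (Suc i) T (Suc (2 * k))"
      have k2: "2 * k < 2 ^ Suc i" "Suc (2 * k) < 2 ^ Suc i" "Suc (Suc (2 * k)) \<le> 2 ^ Suc i" using k by auto
      have kT: "dyad i T (Suc k) \<le> T" using dT[of "Suc k" i] k by simp
      have m: "dyad i T k \<le> ?m" "?m \<le> dyad i T (Suc k)"
        using dle[of "2 * k" "Suc (2 * k)" "Suc i"] dle[of "Suc (2 * k)" "Suc (Suc (2 * k))" "Suc i"] by (auto simp: half)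
      have L: "b (dyad i T k) ?m (\<delta> (Suc i))" using dy[of "Suc i" "2 * k"] step.hyps k2 by (auto simp: b_def half)
      have R: "b ?m (dyad i T (Suc k)) (\<delta> (Suc i))" using dy[of "Suc i" "Suc (2 * k)"] step.hyps k2 by (auto simp: b_def half)
      have le: "\<delta> (Suc i) + C * \<delta> (Suc i) \<le> C * \<delta> i" "C * \<delta> (Suc i) + \<delta> (Suc i) \<le> C * \<delta> i"
        using \<delta>(2)[of i] by (simp_all add: algebra_simps)
      have le': "C * \<delta> (Suc i) \<le> C * \<delta> i" using le \<delta>(1)[of "Suc i"] by linarith
      show "b (dyad i T k) t (C * \<delta> i) \<and> b t (dyad i T (Suc k)) (C * \<delta> i)"
      proof (cases "t \<le> ?m")
        case True
        have "b (dyad i T k) t (C * \<delta> (Suc i))" "b t ?m (C * \<delta> (Suc i))"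
          using step.IH[rule_format, of "2 * k" t] True t k2 by (auto simp: half)
        then show ?thesis
          using mono[OF _ le'] mono[OF comb[OF _ R _ True m(2) kT] le(2)] t d0[of i k] by auto
      next
        case False
        then have F: "?m \<le> t" by simp
        have "b ?m t (C * \<delta> (Suc i))" "b t (dyad i T (Suc k)) (C * \<delta> (Suc i))"
          using step.IH[rule_format, of "Suc (2 * k)" t] F t k2 by (auto simp: half)
        then show ?thesis
          using mono[OF _ le'] mono[OF comb[OF L _ d0 m(1) F] le(1)] t kT by auto
      qed
    qed
  qed
  have "\<exists>i. T / 2 ^ i \<le> t - s" using st(4) by auto
  \<comment> \<open>Minimality of i yields t - s \<le> 2h for the mesh h = T / 2^i, so only few
    cells of this level meet [s, t].\<close>
  define i where "i = (LEAST i. T / 2 ^ i \<le> t - s)"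
  have i: "T / 2 ^ i \<le> t - s" "i \<le> n"
    unfolding i_def by (rule LeastI[of _ n], rule st(4)) (rule Least_le, rule st(4))
  define h where "h = T / 2 ^ i"
  have h: "0 < h" using T by (simp add: h_def)
  have ts: "t - s \<le> 2 * h"
  proof (cases i)
    case 0 then show ?thesis using st h by (simp add: h_def)
  next
    case (Suc i')
    then have "\<not> T / 2 ^ i' \<le> t - s" using not_less_Least[of i' "\<lambda>i. T / 2 ^ i \<le> t - s"] by (simp add: i_def[symmetric])
    then show ?thesis by (simp add: h_def Suc)
  qed
  have dh: "dyad i T k = real k * h" for k by (simp add: dyad_def h_def)
  \<comment> \<open>k h is the first grid point not to the left of s. One one-sided piece leads from
    s to it, and at most two lead on to t because t \<le> k h + 2h; this is the origin of the factor
    3.\<close>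
  define k where "k = nat \<lceil>s / h\<rceil>"
  have sh: "0 \<le> s / h" using st h by simp
  have k: "s / h \<le> real k" "real k < s / h + 1" unfolding k_def using sh by linarith+
  have m: "s \<le> real k * h" "real k * h < s + h"
  proof -
    show "s \<le> real k * h" using k(1) h by (simp add: field_simps)
    have "real k * h < (s / h + 1) * h" using k(2) h by (intro mult_strict_right_mono)
    then show "real k * h < s + h" using h by (simp add: distrib_right)
  qed
  have mt: "real k * h \<le> t" using m i(1) by (simp add: h_def)
  have Th: "T = real (2 ^ i) * h" by (simp add: h_def)
  have kin: "l < 2 ^ i" if "real l * h < T" for l
  proof -
    have "real l < real (2 ^ i)" using that h unfolding Th by simp
    then show ?thesis by (simp only: of_nat_less_iff)
  qed
  have b1: "b s (real k * h) (C * \<delta> i)"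
  proof (cases k)
    case 0
    then have "s = 0" using m st by simp
    then show ?thesis using mono[OF refl[of 0] C0] T by (simp add: 0)
  next
    case (Suc k')
    have "k' < 2 ^ i" using m st by (intro kin) (auto simp: Suc algebra_simps)
    then show ?thesis using sided[OF i(2), rule_format, of k' s] m by (simp add: dh Suc algebra_simps)
  qed
  have b2: "b (real k * h) t (C * \<delta> i + C * \<delta> i)"
  proof (cases "t \<le> real (Suc k) * h")
    case True
    show ?thesis
    proof (cases "real k * h < T")
      case True2: True
      have "b (real k * h) t (C * \<delta> i)"
        using sided[OF i(2), rule_format, OF kin[OF True2], of t] True mt by (simp add: dh)
      then show ?thesis by (rule mono) (use C0[of i] in auto)
    next
      case False
      then have "real k * h = t" using mt st by simp
      then show ?thesis using mono[OF refl[of t], of "C * \<delta> i + C * \<delta> i"] C0[of i] st by simp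
    qed
  next
    case False
    have k1: "k < 2 ^ i" "Suc k < 2 ^ i" using False st h by (auto intro!: kin simp: algebra_simps)
    have "b (real k * h) (real (Suc k) * h) (C * \<delta> i)"
      using sided[OF i(2), rule_format, OF k1(1), of "dyad i T (Suc k)"] h by (simp add: dh algebra_simps)
    moreover have "b (real (Suc k) * h) t (C * \<delta> i)"
      using sided[OF i(2), rule_format, OF k1(2), of t] False ts m by (simp add: dh algebra_simps)
    ultimately show ?thesis
      by (rule comb) (use False st h in \<open>auto simp: algebra_simps\<close>)
  qed
  have "b s t (C * \<delta> i + (C * \<delta> i + C * \<delta> i))"
    by (rule comb[OF b1 b2]) (use st m mt in auto)
  then have "b s t (3 * C * \<delta> i)" by (simp add: algebra_simps)
  then show ?thesis using i unfolding b_def by blast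
qed

section \<open>An upper bound for the Carnot--Caratheodory norm\<close>

text \<open>Witnesses for \<open>cc_norm\<close> are built by concatenation. The integrals are
  therefore stated with \<open>has_integral\<close>, which, unlike the equations in
  \<open>cc_paths\<close>, keeps the integrability of the iterated integrand available.\<close>

definition sig_reach :: "real^'d \<Rightarrow> real^'d^'d \<Rightarrow> real \<Rightarrow> bool" where
  "sig_reach x A l \<longleftrightarrow> (\<exists>g :: real \<Rightarrow> real^'d. g absolutely_integrable_on {0..1} \<and> (g has_integral x) {0..1} \<and>
     ((\<lambda>r. outer (integral {0..r} g) (g r)) has_integral A) {0..1} \<and> integral {0..1} (\<lambda>r. norm (g r)) \<le> l)"

lemma sig_reach_mono: "sig_reach x A l \<Longrightarrow> l \<le> l' \<Longrightarrow> sig_reach x A l'"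
  unfolding sig_reach_def by (elim exE conjE, intro exI conjI) (assumption+, linarith)

lemma sig_reachE:
  fixes x :: "real^'d"
  assumes "sig_reach x A l"
  obtains g :: "real \<Rightarrow> real^'d" where "g absolutely_integrable_on {0..1}" "(g has_integral x) {0..1}"
     "((\<lambda>r. outer (integral {0..r} g) (g r)) has_integral A) {0..1}" "integral {0..1} (\<lambda>r. norm (g r)) \<le> l"
  using assms[unfolded sig_reach_def]
proof (elim exE conjE)
  fix g :: "real \<Rightarrow> real^'d"
  assume "g absolutely_integrable_on {0..1}" "(g has_integral x) {0..1}"
     "((\<lambda>r. outer (integral {0..r} g) (g r)) has_integral A) {0..1}" "integral {0..1} (\<lambda>r. norm (g r)) \<le> l"
  then show thesis by (rule that)
qed

lemma cc_norm_le_of_reach: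
  fixes x :: "real^'d"
  assumes "sig_reach x A l" shows "cc_norm x A \<le> l"
proof -
  obtain g :: "real \<Rightarrow> real^'d" where g: "g absolutely_integrable_on {0..1}" "(g has_integral x) {0..1}"
     "((\<lambda>r. outer (integral {0..r} g) (g r)) has_integral A) {0..1}" "integral {0..1} (\<lambda>r. norm (g r)) \<le> l"
    by (rule sig_reachE[OF assms])
  have "g \<in> cc_paths x A" using g(1-3) by (auto simp: cc_paths_def integral_unique)
  moreover have "bdd_below ((\<lambda>g. integral {0..1} (\<lambda>r. norm (g r))) ` cc_paths x A)"
    by (rule bdd_belowI2[where m=0]) (auto intro!: Henstock_Kurzweil_Integration.integral_nonneg simp: cc_paths_def absolutely_integrable_on_def)
  ultimately show ?thesis unfolding cc_norm_def using g(4) by (auto intro: cINF_lower2)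
qed

lemma has_integral_double_speed:
  fixes f :: "real \<Rightarrow> 'b::euclidean_space"
  assumes "(f has_integral I) {a..b}"
  shows "((\<lambda>r. 2 *\<^sub>R f (2 * r - c)) has_integral I) {(a + c) / 2..(b + c) / 2}"
proof -
  have "((\<lambda>r. f (2 *\<^sub>R r + - c)) has_integral (I /\<^sub>R 2 ^ DIM(real))) (cbox ((a - - c) /\<^sub>R 2) ((b - - c) /\<^sub>R 2))"
    using assms by (intro has_integral_affinity') auto
  note * = has_integral_cmul[OF this, of 2]
  have 1: "cbox ((a - - c) /\<^sub>R 2) ((b - - c) /\<^sub>R 2) = {(a + c) / 2..(b + c) / 2}"
    by (simp only: real_scaleR_def box_real diff_minus_eq_add) (simp only: mult.commute[of "inverse 2"] divide_inverse)
  have 2: "2 *\<^sub>R (I /\<^sub>R 2 ^ DIM(real)) = I" by simp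
  show ?thesis using *[unfolded 1 2] by simp
qed

text \<open>The two paths are run one after the other at double speed, which changes no length.
  During the second half the running integral is x plus that of h, and the constant x contributes
  \<open>outer x y\<close>.\<close>

lemma reach_concat:
  fixes x y :: "real^'d"
  assumes "sig_reach x A l" "sig_reach y B m"
  shows "sig_reach (x + y) (A + B + outer x y) (l + m)"
proof -
  obtain g :: "real \<Rightarrow> real^'d" where g: "g absolutely_integrable_on {0..1}" "(g has_integral x) {0..1}"
     "((\<lambda>r. outer (integral {0..r} g) (g r)) has_integral A) {0..1}" "integral {0..1} (\<lambda>r. norm (g r)) \<le> l"
    by (rule sig_reachE[OF assms(1)])
  obtain h :: "real \<Rightarrow> real^'d" where h: "h absolutely_integrable_on {0..1}" "(h has_integral y) {0..1}"
     "((\<lambda>r. outer (integral {0..r} h) (h r)) has_integral B) {0..1}" "integral {0..1} (\<lambda>r. norm (h r)) \<le> m"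
    by (rule sig_reachE[OF assms(2)])
  define f where "f r = (if r \<le> 1 / 2 then 2 *\<^sub>R g (2 * r) else 2 *\<^sub>R h (2 * r - 1))" for r :: real
  have join: "(\<phi> has_integral (I + J)) {0..b}"
    if "(\<phi>1 has_integral I) {0..1 / 2}" "(\<phi>2 has_integral J) {1 / 2..b}" "1 / 2 \<le> b"
      "\<And>r. 0 \<le> r \<Longrightarrow> r \<le> 1 / 2 \<Longrightarrow> \<phi> r = \<phi>1 r" "\<And>r. 1 / 2 < r \<Longrightarrow> r \<le> b \<Longrightarrow> \<phi> r = \<phi>2 r"
    for \<phi> \<phi>1 \<phi>2 :: "real \<Rightarrow> 'z::euclidean_space" and I J b
  proof (rule has_integral_combine)
    show "(\<phi> has_integral I) {0..1 / 2}" by (rule has_integral_eq[OF _ that(1)]) (use that(4) in auto)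
    show "(\<phi> has_integral J) {1 / 2..b}"
      by (rule has_integral_spike_finite[OF _ _ that(2), of "{1 / 2}"]) (use that(5) in auto)
  qed (use that in auto)
  have sg: "((\<lambda>r. 2 *\<^sub>R \<psi> (2 * r)) has_integral I) {0..b / 2}" if "(\<psi> has_integral I) {0..b}" for \<psi> :: "real \<Rightarrow> 'z::euclidean_space" and I b
    using has_integral_double_speed[OF that, of 0] by simp
  have sh: "((\<lambda>r. 2 *\<^sub>R \<psi> (2 * r - 1)) has_integral I) {1 / 2..(b + 1) / 2}" if "(\<psi> has_integral I) {0..b}" for \<psi> :: "real \<Rightarrow> 'z::euclidean_space" and I b
    using has_integral_double_speed[OF that, of 1] by simp
  have gi: "(g has_integral integral {0..b} g) {0..b}" "(h has_integral integral {0..b} h) {0..b}" if "0 \<le> b" "b \<le> 1" for b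
  proof -
    have "g integrable_on {0..b}" "h integrable_on {0..b}"
      using that by (auto intro!: integrable_on_subinterval[OF has_integral_integrable[OF g(2)]] integrable_on_subinterval[OF has_integral_integrable[OF h(2)]])
    then show "(g has_integral integral {0..b} g) {0..b}" "(h has_integral integral {0..b} h) {0..b}" by (auto intro: integrable_integral)
  qed
  have fi: "(f has_integral (x + y)) {0..1}"
    by (rule join[OF sg[OF g(2), simplified] sh[OF h(2), simplified]]) (auto simp: f_def)
  have ng: "((\<lambda>r. norm (g r)) has_integral integral {0..1} (\<lambda>r. norm (g r))) {0..1}"
    and nh: "((\<lambda>r. norm (h r)) has_integral integral {0..1} (\<lambda>r. norm (h r))) {0..1}"
    using g(1) h(1) by (auto simp: absolutely_integrable_on_def intro: integrable_integral)
  have nf: "((\<lambda>r. norm (f r)) has_integral (integral {0..1} (\<lambda>r. norm (g r)) + integral {0..1} (\<lambda>r. norm (h r)))) {0..1}"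
    by (rule join[OF sg[OF ng, simplified] sh[OF nh, simplified]]) (auto simp: f_def)
  have F1: "integral {0..r} f = integral {0..2 * r} g" if "0 \<le> r" "r \<le> 1 / 2" for r
  proof (rule integral_unique, rule has_integral_eq)
    show "((\<lambda>r. 2 *\<^sub>R g (2 * r)) has_integral integral {0..2 * r} g) {0..r}"
      using sg[OF gi(1), of "2 * r"] that by simp
  qed (use that in \<open>auto simp: f_def\<close>)
  have F2: "integral {0..r} f = x + integral {0..2 * r - 1} h" if "1 / 2 < r" "r \<le> 1" for r
  proof (rule integral_unique, rule join[OF sg[OF g(2), simplified]])
    show "((\<lambda>r. 2 *\<^sub>R h (2 * r - 1)) has_integral integral {0..2 * r - 1} h) {1 / 2..r}"
      using sh[OF gi(2), of "2 * r - 1"] that by simp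
  qed (use that in \<open>auto simp: f_def\<close>)
  have "((\<lambda>r. outer x (h r) + outer (integral {0..r} h) (h r)) has_integral (outer x y + B)) {0..1}"
    using has_integral_linear[OF h(2) bounded_linear_outer_right, of x] h(3)
    by (intro has_integral_add) (auto simp: comp_def)
  then have J: "((\<lambda>r. 2 *\<^sub>R (outer x (h (2 * r - 1)) + outer (integral {0..2 * r - 1} h) (h (2 * r - 1)))) has_integral (outer x y + B)) {1 / 2..1}"
    using sh[of "\<lambda>r. outer x (h r) + outer (integral {0..r} h) (h r)" "outer x y + B" 1] by simp
  have "((\<lambda>r. outer (integral {0..r} f) (f r)) has_integral (A + (outer x y + B))) {0..1}"
  proof (rule join[OF sg[OF g(3), simplified] J])
    fix r :: real assume r: "0 \<le> r" "r \<le> 1 / 2"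
    show "outer (integral {0..r} f) (f r) = 2 *\<^sub>R outer (integral {0..2 * r} g) (g (2 * r))"
      using r by (simp add: F1 f_def outer_algebra)
  next
    fix r :: real assume r: "1 / 2 < r" "r \<le> 1"
    show "outer (integral {0..r} f) (f r) = 2 *\<^sub>R (outer x (h (2 * r - 1)) + outer (integral {0..2 * r - 1} h) (h (2 * r - 1)))"
      using r by (simp add: F2 f_def outer_algebra scaleR_add_right)
  qed simp
  moreover have "f absolutely_integrable_on {0..1}"
    using fi nf by (auto simp: absolutely_integrable_on_def dest: has_integral_integrable)
  ultimately show ?thesis
    unfolding sig_reach_def using fi nf g(4) h(4)
    by (intro exI[of _ f]) (auto simp: integral_unique algebra_simps)
qed

lemma reach_line: "sig_reach x ((1 / 2) *\<^sub>R outer x x) (norm x)"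
proof -
  have "((\<lambda>r. r *\<^sub>R outer x x) has_integral (((1::real)\<^sup>2 - 0\<^sup>2) / 2) *\<^sub>R outer x x) {0..1}"
    by (intro has_integral_scaleR_left ident_has_integral) simp
  then have "((\<lambda>r. r *\<^sub>R outer x x) has_integral (1 / 2) *\<^sub>R outer x x) {0..1}" by simp
  moreover have "outer (integral {0..r} (\<lambda>_. x)) x = r *\<^sub>R outer x x" if "r \<in> {0..1}" for r :: real
    using that by (simp add: outer_algebra)
  ultimately have "((\<lambda>r::real. outer (integral {0..r} (\<lambda>_. x)) x) has_integral (1 / 2) *\<^sub>R outer x x) {0..1}"
    using has_integral_cong[of "{0..1}" "\<lambda>r::real. outer (integral {0..r} (\<lambda>_. x)) x" "\<lambda>r. r *\<^sub>R outer x x"] by blast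
  moreover have "((\<lambda>_. x) has_integral x) {0..1::real}" using has_integral_const_real[of x 0 1] by simp
  moreover have "(\<lambda>_. x) absolutely_integrable_on {0..1::real}" by (auto simp: absolutely_integrable_on_def intro: integrable_const_ivl)
  ultimately show ?thesis unfolding sig_reach_def by (intro exI[of _ "\<lambda>_. x"]) auto
qed

text \<open>The parallelogram with edges u, v, -u, -v returns to its start, while its second level
  is the commutator of u and v.\<close>

lemma reach_commutator: "sig_reach 0 (outer u v - outer v u) (2 * norm u + 2 * norm v)"
proof -
  note c = reach_concat[OF reach_concat[OF reach_concat[OF reach_line[of u] reach_line[of v]] reach_line[of "- u"]] reach_line[of "- v"]]
  have "(1 / 2) *\<^sub>R outer u u + (1 / 2) *\<^sub>R outer v v + outer u v + (1 / 2) *\<^sub>R outer (- u) (- u) + outer (u + v) (- u)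
    + (1 / 2) *\<^sub>R outer (- v) (- v) + outer (u + v + - u) (- v) = outer u v - outer v u"
    by (simp add: vec_eq_iff outer_def field_simps)
  moreover have "u + v + - u + - v = 0" "norm u + norm v + norm (- u) + norm (- v) = 2 * norm u + 2 * norm v" by simp_all
  ultimately show ?thesis using c by (simp only:)
qed

text \<open>One half of the ball-box estimate. By the symmetry relation only the antisymmetric part
  B of A remains once x is joined by a straight line. B is produced by one small parallelogram for
  each pair of basis vectors, with edges of length at most K since areas scale like squares of
  lengths.\<close>

lemma cc_norm_le:
  fixes x :: "real^'d"
  assumes sym: "\<And>i j. A $ i $ j + A $ j $ i = x $ i * x $ j"
    and x: "norm x \<le> K" and A: "norm A \<le> K\<^sup>2"
  shows "cc_norm x A \<le> (1 + 8 * (real CARD('d))\<^sup>2) * K"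
proof -
  have K: "0 \<le> K" using x norm_ge_zero order_trans by blast
  define B where "B = A - (1 / 2) *\<^sub>R outer x x"
  have anti: "B $ j $ i = - B $ i $ j" for i j
    using sym[of i j] by (simp add: B_def outer_def field_simps)
  have "norm B \<le> norm A + norm ((1 / 2) *\<^sub>R outer x x)" unfolding B_def by (rule norm_triangle_ineq4)
  also have "\<dots> \<le> K\<^sup>2 + K\<^sup>2"
  proof -
    have "norm x * norm x \<le> K * K" using x K by (intro mult_mono) auto
    moreover have "norm ((1 / 2) *\<^sub>R outer x x) = norm x * norm x / 2" by (simp add: norm_outer)
    moreover have "0 \<le> K * K" using K by simp
    ultimately show ?thesis using A unfolding power2_eq_square by linarith
  qed
  finally have nB: "norm B \<le> 2 * K\<^sup>2" by simp
  \<comment> \<open>Every unordered pair of indices occurs twice, as (i, j) and as (j, i), and B is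
    antisymmetric; hence the factor 1/2.\<close>
  define c where "c p = (case p of (i, j) \<Rightarrow> B $ i $ j / 2)" for p
  have cK: "sqrt \<bar>c p\<bar> \<le> K" for p
  proof -
    have "\<bar>B $ fst p $ snd p\<bar> \<le> norm B"
      using component_le_norm_cart[of "B $ fst p" "snd p"] Finite_Cartesian_Product.norm_nth_le[of B "fst p"] by linarith
    then have "\<bar>c p\<bar> \<le> K\<^sup>2" using nB by (simp add: c_def case_prod_beta)
    then have "sqrt \<bar>c p\<bar> \<le> sqrt (K\<^sup>2)" by (rule real_sqrt_le_mono)
    then show ?thesis using K by simp
  qed
  \<comment> \<open>The sign of the coefficient is put on u alone, so that the edge lengths multiply
    to c p with the right orientation.\<close>
  define u where "u p = (case p of (i, j) \<Rightarrow> (sgn (c p) * sqrt \<bar>c p\<bar>) *\<^sub>R (axis i 1 :: real^'d))" for p :: "'d \<times> 'd"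
  define v where "v p = (case p of (i, j) \<Rightarrow> sqrt \<bar>c p\<bar> *\<^sub>R (axis j 1 :: real^'d))" for p :: "'d \<times> 'd"
  have uv: "norm (u p) \<le> K" "norm (v p) \<le> K" for p
    using cK[of p] K by (auto simp: u_def v_def case_prod_beta abs_mult sgn_if)
  \<comment> \<open>A loop has increment 0, so appending it adds no cross term, only its own area
    and a length of at most 4K.\<close>
  have sum: "sig_reach x ((1 / 2) *\<^sub>R outer x x + (\<Sum>p\<in>S. outer (u p) (v p) - outer (v p) (u p))) (K + 4 * real (card S) * K)"
    if "finite S" for S
    using that
  proof (induction S rule: finite_induct)
    case empty
    have "sig_reach x ((1 / 2) *\<^sub>R outer x x) K" using reach_line[of x] x by (rule sig_reach_mono)
    then show ?case by simp
  next
    case (insert p S)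
    have "sig_reach (x + 0) ((1 / 2) *\<^sub>R outer x x + (\<Sum>p\<in>S. outer (u p) (v p) - outer (v p) (u p)) + (outer (u p) (v p) - outer (v p) (u p)) + outer x 0)
      (K + 4 * real (card S) * K + (2 * norm (u p) + 2 * norm (v p)))"
      by (rule reach_concat[OF insert.IH reach_commutator])
    moreover have "K + 4 * real (card S) * K + (2 * norm (u p) + 2 * norm (v p)) \<le> K + 4 * real (card (insert p S)) * K"
      using uv[of p] insert by (simp add: algebra_simps)
    ultimately have "sig_reach (x + 0) ((1 / 2) *\<^sub>R outer x x + (\<Sum>p\<in>S. outer (u p) (v p) - outer (v p) (u p)) + (outer (u p) (v p) - outer (v p) (u p)) + outer x 0)
      (K + 4 * real (card (insert p S)) * K)" by (rule sig_reach_mono)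
    then show ?case using insert by (simp add: outer_algebra add_ac)
  qed
  have ax: "axis i (1::real) $ j = (if i = j then 1 else 0)" for i j :: 'd by (auto simp: axis_def)
  have cc: "sgn t * sqrt \<bar>t\<bar> * sqrt \<bar>t\<bar> = t" for t :: real
    by (auto simp: sgn_if)
  have cc2: "\<bar>t\<bar> * sgn t = t" for t :: real
    by (auto simp: sgn_if)
  have "(\<Sum>p\<in>UNIV. outer (u p) (v p) - outer (v p) (u p)) = B"
  proof (subst vec_eq_iff, intro allI, subst vec_eq_iff, intro allI)
    fix a b
    have e: "(outer (u (i, j)) (v (i, j)) - outer (v (i, j)) (u (i, j))) $ a $ b =
      (if i = a then if j = b then c (i, j) else 0 else 0) - (if j = a then if i = b then c (i, j) else 0 else 0)" for i j
      using cc by (simp add: cc2 u_def v_def outer_def ax mult_ac)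
    have "(\<Sum>p\<in>UNIV. outer (u p) (v p) - outer (v p) (u p)) $ a $ b
      = (\<Sum>i\<in>UNIV. \<Sum>j\<in>UNIV. (outer (u (i, j)) (v (i, j)) - outer (v (i, j)) (u (i, j))) $ a $ b)"
      by (simp add: sum.cartesian_product UNIV_Times_UNIV case_prod_beta)
    also have "\<dots> = c (a, b) - c (b, a)"
      unfolding e sum_subtractf
      by (simp add: sum.delta sum.If_cases if_distrib[of "\<lambda>s. sum s _"] cong: if_cong)
    also have "\<dots> = B $ a $ b" using anti[of a b] by (simp add: c_def)
    finally show "(\<Sum>p\<in>UNIV. outer (u p) (v p) - outer (v p) (u p)) $ a $ b = B $ a $ b" .
  qed
  then have "sig_reach x A (K + 4 * real CARD('d \<times> 'd) * K)" using sum[of UNIV] by (simp add: B_def)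
  then have "cc_norm x A \<le> K + 4 * real CARD('d \<times> 'd) * K" by (rule cc_norm_le_of_reach)
  also have "\<dots> \<le> (1 + 8 * (real CARD('d))\<^sup>2) * K"
    using K by (simp add: power2_eq_square algebra_simps)
  finally show ?thesis .
qed

section \<open>Gaussian paths with regular covariance\<close>

lemma powr_sum_le_of_rho_var2:
  assumes "rho_var2 R \<rho> a b \<le> ereal B" "is_partition a b n p" "is_partition a b m q" and \<rho>: "0 < \<rho>" and B: "0 \<le> B"
  shows "(\<Sum>i<n. \<Sum>j<m. norm (R (p i) (p (Suc i)) (q j) (q (Suc j))) powr \<rho>) \<le> B powr \<rho>"
proof -
  let ?S = "\<Sum>i<n. \<Sum>j<m. norm (R (p i) (p (Suc i)) (q j) (q (Suc j))) powr \<rho>"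
  have "ereal (?S powr (1 / \<rho>)) \<le> rho_var2 R \<rho> a b"
    unfolding rho_var2_def
  proof (rule SUP_upper2[of "(n, p, m, q)"])
    show "(n, p, m, q) \<in> {(n, p, m, q). is_partition a b n p \<and> is_partition a b m q}"
      using assms(2,3) by (simp only: mem_Collect_eq prod.case)
  qed (simp only: prod.case order_refl)
  from order_trans[OF this assms(1)] have "?S powr (1 / \<rho>) \<le> B" by (simp only: ereal_less_eq(3))
  then have "(?S powr (1 / \<rho>)) powr \<rho> \<le> B powr \<rho>" using \<rho> by (intro powr_mono2) auto
  moreover have "0 \<le> ?S" by (intro sum_nonneg) auto
  ultimately show ?thesis using \<rho> by (simp add: powr_powr)
qed

text \<open>Interpolation between the supremum and the \<rho>-variation: r^2 \<le> V^(2 - \<rho>)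
  |r|^\<rho>, where V bounds the covariances of single cells and the sum of |r|^\<rho> is controlled
  on the parent interval. Since V shrinks with the refinement i and \<rho> < 2, this gains the
  geometric factor q^i with q < 1.\<close>

lemma cov_square_sum_le:
  fixes R :: "real \<Rightarrow> real \<Rightarrow> real \<Rightarrow> real \<Rightarrow> real^'d^'d" and i j k :: nat
  assumes T: "0 < T" and \<rho>: "1 \<le> \<rho>" "\<rho> < 2" and Mc: "0 < Mc"
    and R: "\<And>s t. 0 \<le> s \<Longrightarrow> s \<le> t \<Longrightarrow> t \<le> T \<Longrightarrow> rho_var2 R \<rho> s t \<le> ereal (Mc * (t - s) powr (1 / \<rho>))"
    and CS: "\<And>s t u v. s \<in> {0..T} \<Longrightarrow> t \<in> {0..T} \<Longrightarrow> u \<in> {0..T} \<Longrightarrow> v \<in> {0..T} \<Longrightarrow>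
        \<bar>R s t u v $ c $ c\<bar> \<le> (R s t s t $ c $ c + R u v u v $ c $ c) / 2"
    and k: "k < 2 ^ j"
  defines "t \<equiv> \<lambda>l. dyad (j + i) T l" and "q \<equiv> 2 powr (1 - 2 / \<rho>)"
  shows "(\<Sum>l\<in>{k * 2 ^ i..<Suc k * 2 ^ i}. \<Sum>l'\<in>{k * 2 ^ i..<Suc k * 2 ^ i}. (R (t l) (t (Suc l)) (t l') (t (Suc l')) $ c $ c)\<^sup>2)
    \<le> (Mc * (T / 2 ^ j) powr (1 / \<rho>))\<^sup>2 * q ^ i"
    and "R (dyad j T k) (dyad j T (Suc k)) (dyad j T k) (dyad j T (Suc k)) $ c $ c \<le> Mc * (T / 2 ^ j) powr (1 / \<rho>)"
proof -
  have comp: "\<bar>A $ c $ c\<bar> \<le> norm A" for A :: "real^'d^'d"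
    using component_le_norm_cart[of "A $ c" c] Finite_Cartesian_Product.norm_nth_le[of A c] by linarith
  have var: "R a b a b $ c $ c \<le> Mc * (b - a) powr (1 / \<rho>)" if ab: "0 \<le> a" "a \<le> b" "b \<le> T" for a b
  proof -
    \<comment> \<open>The trivial partition with one cell extracts a variance bound for a single
      increment from the bound on the variation.\<close>
    have p: "is_partition a b 1 (\<lambda>i. if i = 0 then a else b)" using ab by (simp add: is_partition_def)
    have "norm (R a b a b) powr \<rho> \<le> (Mc * (b - a) powr (1 / \<rho>)) powr \<rho>"
      using powr_sum_le_of_rho_var2[OF R[OF ab] p p] \<rho> Mc by simp
    then have "norm (R a b a b) \<le> Mc * (b - a) powr (1 / \<rho>)"
      by (rule contrapos_pp) (use \<rho> Mc in \<open>auto simp: not_le intro!: powr_less_mono2\<close>)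
    then show ?thesis using comp[of "R a b a b"] by linarith
  qed
  have cellT: "dyad m T (Suc l) \<le> T" if "l < 2 ^ m" for m l using dyad_le_T[OF T, of "Suc l" m] that by simp
  have diff: "dyad m T (Suc l) - dyad m T l = T / 2 ^ m" for m l by (rule dyad_Suc_diff[OF T])
  have d0: "0 \<le> dyad m T l" "dyad m T l \<le> dyad m T (Suc l)" for m l using T by (auto simp: dyad_def field_simps)
  show "R (dyad j T k) (dyad j T (Suc k)) (dyad j T k) (dyad j T (Suc k)) $ c $ c \<le> Mc * (T / 2 ^ j) powr (1 / \<rho>)"
    using var[OF d0 cellT[OF k]] by (simp add: diff)
  define V where "V = Mc * (T / 2 ^ (j + i)) powr (1 / \<rho>)"
  have V: "0 < V" using Mc T by (simp add: V_def)
  define C where "C = {k * 2 ^ i..<Suc k * 2 ^ i}"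
  have C: "l < 2 ^ (j + i)" if "l \<in> C" for l
  proof -
    have "Suc k * 2 ^ i \<le> 2 ^ j * 2 ^ i" using k by (intro mult_right_mono) auto
    then show ?thesis using that by (simp add: C_def power_add)
  qed
  have small: "\<bar>R (t l) (t (Suc l)) (t l') (t (Suc l')) $ c $ c\<bar> \<le> V" if "l \<in> C" "l' \<in> C" for l l'
  proof -
    have in0: "t l \<in> {0..T}" "t (Suc l) \<in> {0..T}" if "l \<in> C" for l
      using d0[where m="j + i"] cellT[OF C[OF that]] order_trans[OF d0(2) cellT[OF C[OF that]]] unfolding t_def by auto
    have v: "R (t l) (t (Suc l)) (t l) (t (Suc l)) $ c $ c \<le> V" if "l \<in> C" for l
      using var[OF d0 cellT[OF C[OF that]]] by (simp add: t_def V_def diff)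
    show ?thesis
      by (rule order_trans[OF CS[OF in0[OF that(1)] in0[OF that(2)]]]) (use add_mono[OF v[OF that(1)] v[OF that(2)]] in simp)
  qed
  define B where "B = Mc * (T / 2 ^ j) powr (1 / \<rho>)"
  have B: "0 < B" using Mc T by (simp add: B_def)
  define p where "p l = t (k * 2 ^ i + l)" for l
  have part: "is_partition (dyad j T k) (dyad j T (Suc k)) (2 ^ i) p"
    using dyad_scale[of j i T k] dyad_scale[of j i T "Suc k"] d0(2)
    by (auto simp: is_partition_def p_def t_def add.commute)
  have "(\<Sum>l\<in>C. \<Sum>l'\<in>C. norm (R (t l) (t (Suc l)) (t l') (t (Suc l'))) powr \<rho>)
    = (\<Sum>l<2 ^ i. \<Sum>l'<2 ^ i. norm (R (p l) (p (Suc l)) (p l') (p (Suc l'))) powr \<rho>)"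
  proof -
    have re: "(\<Sum>l\<in>C. F l) = (\<Sum>l<2 ^ i. F (k * 2 ^ i + l))" for F :: "nat \<Rightarrow> real"
      by (rule sum.reindex_bij_witness[of _ "\<lambda>l. k * 2 ^ i + l" "\<lambda>l. l - k * 2 ^ i"]) (auto simp: C_def)
    show ?thesis unfolding re p_def by simp
  qed
  also have "\<dots> \<le> (Mc * (dyad j T (Suc k) - dyad j T k) powr (1 / \<rho>)) powr \<rho>"
    using powr_sum_le_of_rho_var2[OF R[OF d0 cellT[OF k]] part part] \<rho> Mc by simp
  finally have sum: "(\<Sum>l\<in>C. \<Sum>l'\<in>C. norm (R (t l) (t (Suc l)) (t l') (t (Suc l'))) powr \<rho>) \<le> B powr \<rho>"
    by (simp add: diff B_def)
  have "(\<Sum>l\<in>C. \<Sum>l'\<in>C. (R (t l) (t (Suc l)) (t l') (t (Suc l')) $ c $ c)\<^sup>2)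
    \<le> (\<Sum>l\<in>C. \<Sum>l'\<in>C. V powr (2 - \<rho>) * norm (R (t l) (t (Suc l)) (t l') (t (Suc l'))) powr \<rho>)"
  proof (intro sum_mono)
    fix l l' assume l: "l \<in> C" "l' \<in> C"
    let ?r = "R (t l) (t (Suc l)) (t l') (t (Suc l'))"
    show "(?r $ c $ c)\<^sup>2 \<le> V powr (2 - \<rho>) * norm ?r powr \<rho>"
    proof (cases "?r $ c $ c = 0")
      case False
      have "(?r $ c $ c)\<^sup>2 = \<bar>?r $ c $ c\<bar> powr 2" using False by (simp add: powr_numeral)
      also have "\<dots> = \<bar>?r $ c $ c\<bar> powr (2 - \<rho>) * \<bar>?r $ c $ c\<bar> powr \<rho>" by (simp add: powr_add[symmetric])
      also have "\<dots> \<le> V powr (2 - \<rho>) * norm ?r powr \<rho>"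
        using \<rho> small[OF l] comp[of ?r] by (intro mult_mono powr_mono2) auto
      finally show ?thesis .
    qed simp
  qed
  also have "\<dots> = V powr (2 - \<rho>) * (\<Sum>l\<in>C. \<Sum>l'\<in>C. norm (R (t l) (t (Suc l)) (t l') (t (Suc l'))) powr \<rho>)"
    by (simp add: sum_distrib_left)
  also have "\<dots> \<le> V powr (2 - \<rho>) * B powr \<rho>" using sum by (intro mult_left_mono) auto
  also have "\<dots> = B\<^sup>2 * q ^ i"
  proof -
    \<comment> \<open>Halving the interval i times multiplies the variance bound by 2^(-i/\<rho>);
      the power 2 - \<rho> of this factor is q^i.\<close>
    have VB: "V = B * (2 powr - (1 / \<rho>)) ^ i"
    proof -
      have "(T / 2 ^ (j + i)) powr (1 / \<rho>) = (T / 2 ^ j * (1 / 2) ^ i) powr (1 / \<rho>)" by (simp add: power_add power_divide)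
      also have "\<dots> = (T / 2 ^ j) powr (1 / \<rho>) * ((1 / 2) ^ i) powr (1 / \<rho>)" by (rule powr_mult)
      also have "((1 / 2) ^ i) powr (1 / \<rho>) = (2 powr - (1 / \<rho>)) ^ i"
        by (simp add: powr_realpow[symmetric] powr_powr powr_minus_divide powr_divide powr_power mult.commute)
      finally show ?thesis by (simp add: V_def B_def)
    qed
    have "V powr (2 - \<rho>) = B powr (2 - \<rho>) * ((2 powr - (1 / \<rho>)) ^ i) powr (2 - \<rho>)"
      unfolding VB by (rule powr_mult)
    also have "((2 powr - (1 / \<rho>)) ^ i) powr (2 - \<rho>) = q ^ i"
    proof -
      have "((2 powr - (1 / \<rho>)) ^ i) powr (2 - \<rho>) = 2 powr (- (1 / \<rho>) * real i * (2 - \<rho>))"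
        by (simp add: powr_realpow[symmetric] powr_powr)
      also have "- (1 / \<rho>) * real i * (2 - \<rho>) = (1 - 2 / \<rho>) * real i" using \<rho> by (simp add: field_simps)
      also have "2 powr ((1 - 2 / \<rho>) * real i) = q ^ i" by (simp add: q_def powr_realpow[symmetric] powr_powr)
      finally show ?thesis .
    qed
    finally have "V powr (2 - \<rho>) * B powr \<rho> = (B powr (2 - \<rho>) * B powr \<rho>) * q ^ i" by simp
    also have "B powr (2 - \<rho>) * B powr \<rho> = B\<^sup>2" using B by (simp add: powr_add[symmetric] powr_numeral)
    finally show ?thesis .
  qed
  finally show "(\<Sum>l\<in>{k * 2 ^ i..<Suc k * 2 ^ i}. \<Sum>l'\<in>{k * 2 ^ i..<Suc k * 2 ^ i}. (R (t l) (t (Suc l)) (t l') (t (Suc l')) $ c $ c)\<^sup>2)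
    \<le> (Mc * (T / 2 ^ j) powr (1 / \<rho>))\<^sup>2 * q ^ i" by (simp add: C_def B_def)
qed

lemma centred_normal_rv_distr:
  assumes [measurable]: "g \<in> measurable M S" "X \<in> borel_measurable S" and "centred_normal_rv M (\<lambda>x. X (g x))"
  shows "centred_normal_rv (distr M S g) X"
  using assms(3) unfolding centred_normal_rv_def
proof (elim conjE disjE exE)
  assume "AE x in M. X (g x) = 0"
  then show "X \<in> borel_measurable (distr M S g) \<and>
     ((AE x in distr M S g. X x = 0) \<or> (\<exists>\<sigma>>0. distributed (distr M S g) lborel X (normal_density 0 \<sigma>)))"
    by (auto simp: AE_distr_iff)
next
  fix \<sigma> :: real assume "0 < \<sigma>" "distributed M lborel (\<lambda>x. X (g x)) (normal_density 0 \<sigma>)"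
  moreover have "distr (distr M S g) lborel X = distr M lborel (\<lambda>x. X (g x))"
    by (subst distr_distr) (auto simp: comp_def)
  ultimately show "X \<in> borel_measurable (distr M S g) \<and>
     ((AE x in distr M S g. X x = 0) \<or> (\<exists>\<sigma>>0. distributed (distr M S g) lborel X (normal_density 0 \<sigma>)))"
    by (auto simp: distributed_def)
qed

section \<open>The Gaussian path on a finite dyadic grid\<close>

definition grid :: "nat \<Rightarrow> real \<Rightarrow> real set" where
  "grid n T = dyad n T ` {..2 ^ n}"

text \<open>The component is the outer index, so that independence of the components becomes a
  product over c of laws on the finite product space \<open>grid_space\<close>.\<close>

definition grid_path :: "nat \<Rightarrow> real \<Rightarrow> (real \<Rightarrow> 'a \<Rightarrow> real^'d) \<Rightarrow> 'a \<Rightarrow> 'd \<Rightarrow> real \<Rightarrow> real" where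
  "grid_path n T W \<omega> c = (\<lambda>t\<in>grid n T. W t \<omega> $ c)"

abbreviation grid_space :: "nat \<Rightarrow> real \<Rightarrow> (real \<Rightarrow> real) measure" where
  "grid_space n T \<equiv> PiM (grid n T) (\<lambda>_. borel)"

definition grid_law :: "'a measure \<Rightarrow> nat \<Rightarrow> real \<Rightarrow> (real \<Rightarrow> 'a \<Rightarrow> real^'d) \<Rightarrow> 'd \<Rightarrow> (real \<Rightarrow> real) measure" where
  "grid_law M n T W c = distr M (grid_space n T) (\<lambda>\<omega>. grid_path n T W \<omega> c)"

lemma finite_grid: "finite (grid n T)"
  by (simp add: grid_def)

lemma dyad_in_grid: "j \<le> n \<Longrightarrow> l \<le> 2 ^ j \<Longrightarrow> dyad j T l \<in> grid n T"
proof -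
  assume j: "j \<le> n" "l \<le> 2 ^ j"
  have "l * 2 ^ (n - j) \<le> 2 ^ j * 2 ^ (n - j)" using j by simp
  then have "l * 2 ^ (n - j) \<le> 2 ^ n" using j by (simp add: power_add[symmetric])
  moreover have "dyad j T l = dyad n T (l * 2 ^ (n - j))" using dyad_scale[of j "n - j" T l] j by simp
  ultimately show ?thesis by (auto simp: grid_def)
qed

lemma grid_subset: "0 < T \<Longrightarrow> grid n T \<subseteq> {0..T}"
  using dyad_le_T by (auto simp: grid_def dyad_def)

context
  fixes M :: "'a measure" and T :: real and W :: "real \<Rightarrow> 'a \<Rightarrow> real^'d"
  assumes T: "0 < T" and G: "cont_centred_gauss_indep M T W"
begin

lemma prob_M: "prob_space M"
  using G by (simp add: cont_centred_gauss_indep_def)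

lemma W_measurable: "t \<in> {0..T} \<Longrightarrow> (\<lambda>\<omega>. W t \<omega> $ c) \<in> borel_measurable M"
proof -
  assume "t \<in> {0..T}"
  then have "W t \<in> borel_measurable M" using G by (simp add: cont_centred_gauss_indep_def)
  moreover have "(\<lambda>x::real^'d. x $ c) \<in> borel_measurable borel"
    by (intro borel_measurable_continuous_onI continuous_intros)
  ultimately show ?thesis by (rule measurable_compose)
qed

lemma W_gaussian: "\<forall>j<(n::nat). ts j \<in> {0..T} \<Longrightarrow> centred_normal_rv M (\<lambda>\<omega>. \<Sum>j<n. u j * W (ts j) \<omega> $ is j)"
  and W_indep: "finite F \<Longrightarrow> F \<subseteq> {0..T} \<Longrightarrow> prob_space.indep_vars M (\<lambda>_. Pi\<^sub>M F (\<lambda>_. borel))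
          (\<lambda>i \<omega>. restrict (\<lambda>t. W t \<omega> $ i) F) UNIV"
proof -
  have a: "\<forall>(n::nat) (ts::nat \<Rightarrow> real) (is::nat \<Rightarrow> 'd) (c::nat \<Rightarrow> real).
        (\<forall>j<n. ts j \<in> {0..T}) \<longrightarrow>
        centred_normal_rv M (\<lambda>\<omega>. \<Sum>j<n. c j * W (ts j) \<omega> $ is j)"
    using G unfolding cont_centred_gauss_indep_def by (elim conjE)
  have b: "\<forall>F. finite F \<and> F \<subseteq> {0..T} \<longrightarrow>
        prob_space.indep_vars M (\<lambda>_. Pi\<^sub>M F (\<lambda>_. borel))
          (\<lambda>i \<omega>. restrict (\<lambda>t. W t \<omega> $ i) F) UNIV"
    using G unfolding cont_centred_gauss_indep_def by (elim conjE)
  show "\<forall>j<(n::nat). ts j \<in> {0..T} \<Longrightarrow> centred_normal_rv M (\<lambda>\<omega>. \<Sum>j<n. u j * W (ts j) \<omega> $ is j)"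
    using a[THEN spec, of n, THEN spec, of ts, THEN spec, of "is", THEN spec, of u] by (rule mp)
  show "finite F \<Longrightarrow> F \<subseteq> {0..T} \<Longrightarrow> prob_space.indep_vars M (\<lambda>_. Pi\<^sub>M F (\<lambda>_. borel))
          (\<lambda>i \<omega>. restrict (\<lambda>t. W t \<omega> $ i) F) UNIV"
    by (rule b[THEN spec, THEN mp]) (rule conjI)
qed

text \<open>The linear span of the evaluations of the path. Lists allow repeated times and
  components, make sums concatenations, and match the indexed sums in
  \<open>cont_centred_gauss_indep\<close>.\<close>

definition gaussian_space :: "('a \<Rightarrow> real) set" where
  "gaussian_space = {\<phi>. \<exists>xs. (\<forall>(u, t, c)\<in>set xs. t \<in> {0..T}) \<and> \<phi> = (\<lambda>\<omega>. \<Sum>(u, t, c)\<leftarrow>xs. u * W t \<omega> $ c)}"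

lemma gaussian_space_W: "t \<in> {0..T} \<Longrightarrow> (\<lambda>\<omega>. W t \<omega> $ c) \<in> gaussian_space"
  unfolding gaussian_space_def by (auto intro!: exI[of _ "[(1, t, c)]"])

lemma gaussian_space_add: "\<phi> \<in> gaussian_space \<Longrightarrow> \<psi> \<in> gaussian_space \<Longrightarrow> (\<lambda>\<omega>. \<phi> \<omega> + \<psi> \<omega>) \<in> gaussian_space"
  unfolding gaussian_space_def
proof (elim CollectE exE conjE)
  fix xs ys assume "\<forall>(u, t, c)\<in>set xs. t \<in> {0..T}" "\<forall>(u, t, c)\<in>set ys. t \<in> {0..T}"
    "\<phi> = (\<lambda>\<omega>. \<Sum>(u, t, c)\<leftarrow>xs. u * W t \<omega> $ c)" "\<psi> = (\<lambda>\<omega>. \<Sum>(u, t, c)\<leftarrow>ys. u * W t \<omega> $ c)"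
  then show "(\<lambda>\<omega>. \<phi> \<omega> + \<psi> \<omega>) \<in> {\<phi>. \<exists>xs. (\<forall>(u, t, c)\<in>set xs. t \<in> {0..T}) \<and> \<phi> = (\<lambda>\<omega>. \<Sum>(u, t, c)\<leftarrow>xs. u * W t \<omega> $ c)}"
    by (auto intro!: exI[of _ "xs @ ys"])
qed

lemma gaussian_space_cmult: "\<phi> \<in> gaussian_space \<Longrightarrow> (\<lambda>\<omega>. r * \<phi> \<omega>) \<in> gaussian_space"
  unfolding gaussian_space_def
proof (elim CollectE exE conjE)
  fix xs assume xs: "\<forall>(u, t, c)\<in>set xs. t \<in> {0..T}" and \<phi>: "\<phi> = (\<lambda>\<omega>. \<Sum>(u, t, c)\<leftarrow>xs. u * W t \<omega> $ c)"
  have "r * \<phi> \<omega> = (\<Sum>(u, t, c)\<leftarrow>map (\<lambda>(u, t, c). (r * u, t, c)) xs. u * W t \<omega> $ c)" for \<omega>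
    unfolding \<phi> by (induction xs) (auto simp: algebra_simps)
  then show "(\<lambda>\<omega>. r * \<phi> \<omega>) \<in> {\<phi>. \<exists>xs. (\<forall>(u, t, c)\<in>set xs. t \<in> {0..T}) \<and> \<phi> = (\<lambda>\<omega>. \<Sum>(u, t, c)\<leftarrow>xs. u * W t \<omega> $ c)}"
    using xs by (auto intro!: exI[of _ "map (\<lambda>(u, t, c). (r * u, t, c)) xs"])
qed

lemma gaussian_space_diff: "\<phi> \<in> gaussian_space \<Longrightarrow> \<psi> \<in> gaussian_space \<Longrightarrow> (\<lambda>\<omega>. \<phi> \<omega> - \<psi> \<omega>) \<in> gaussian_space"
  using gaussian_space_add[OF _ gaussian_space_cmult[of \<psi> "-1"]] by simp

lemma gaussian_space_sum:
  assumes "finite K" "\<And>a. a \<in> K \<Longrightarrow> \<phi> a \<in> gaussian_space"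
  shows "(\<lambda>\<omega>. \<Sum>a\<in>K. u a * \<phi> a \<omega>) \<in> gaussian_space"
  using assms
proof (induction K rule: finite_induct)
  case empty
  show ?case unfolding gaussian_space_def by (auto intro!: exI[of _ "[]"])
next
  case (insert a K)
  then show ?case by (auto intro!: gaussian_space_add gaussian_space_cmult)
qed

lemma gaussian_space_normal: "\<phi> \<in> gaussian_space \<Longrightarrow> centred_normal_rv M \<phi>"
  unfolding gaussian_space_def
proof (elim CollectE exE conjE)
  fix xs assume xs: "\<forall>(u, t, c)\<in>set xs. t \<in> {0..T}" and \<phi>: "\<phi> = (\<lambda>\<omega>. \<Sum>(u, t, c)\<leftarrow>xs. u * W t \<omega> $ c)"
  have "\<phi> = (\<lambda>\<omega>. \<Sum>j<length xs. fst (xs ! j) * W (fst (snd (xs ! j))) \<omega> $ snd (snd (xs ! j)))"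
    unfolding \<phi> by (simp add: sum_list_sum_nth atLeast0LessThan case_prod_beta)
  moreover have "\<forall>j<length xs. fst (snd (xs ! j)) \<in> {0..T}" using xs by (auto simp: case_prod_beta)
  ultimately show "centred_normal_rv M \<phi>" by (simp only:) (rule W_gaussian)
qed

lemma grid_path_eq: "t \<in> grid n T \<Longrightarrow> grid_path n T W \<omega> c t = W t \<omega> $ c"
  by (simp add: grid_path_def)

lemma gaussian_space_grid_path: "t \<in> grid n T \<Longrightarrow> (\<lambda>\<omega>. grid_path n T W \<omega> c t) \<in> gaussian_space"
  using grid_subset[OF T, of n] by (auto simp: grid_path_eq intro!: gaussian_space_W)

lemma grid_path_measurable [measurable]: "(\<lambda>\<omega>. grid_path n T W \<omega> c) \<in> measurable M (grid_space n T)"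
  unfolding grid_path_def using grid_subset[OF T, of n] by (intro measurable_restrict W_measurable) auto

lemma prob_grid_law: "prob_space (grid_law M n T W c)"
  unfolding grid_law_def by (intro prob_space.prob_space_distr prob_M grid_path_measurable)

lemma indep_grid_paths: "prob_space.indep_vars M (\<lambda>_. grid_space n T) (\<lambda>c \<omega>. grid_path n T W \<omega> c) UNIV"
  unfolding grid_path_def by (rule W_indep[OF finite_grid grid_subset[OF T]])

text \<open>Independence of the components enters the duplication argument in this form, as a
  product measure indexed by the components.\<close>

lemma grid_path_law: "distr M (PiM UNIV (\<lambda>_. grid_space n T)) (grid_path n T W) = PiM UNIV (grid_law M n T W)"
proof -
  interpret prob_space M by (rule prob_M)
  have "distr M (\<Pi>\<^sub>M c\<in>UNIV. grid_space n T) (\<lambda>\<omega>. \<lambda>c\<in>UNIV. grid_path n T W \<omega> c) = (\<Pi>\<^sub>M c\<in>UNIV. distr M (grid_space n T) (\<lambda>\<omega>. grid_path n T W \<omega> c))"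
    by (subst indep_vars_iff_distr_eq_PiM[symmetric]) (auto intro: indep_grid_paths)
  then show ?thesis by (simp add: grid_law_def[abs_def] restrict_UNIV)
qed

lemma grid_pair_law:
  assumes "c \<noteq> c'"
  shows "distr M (grid_space n T \<Otimes>\<^sub>M grid_space n T) (\<lambda>\<omega>. (grid_path n T W \<omega> c, grid_path n T W \<omega> c')) = grid_law M n T W c \<Otimes>\<^sub>M grid_law M n T W c'"
proof -
  interpret prob_space M by (rule prob_M)
  have "indep_var (grid_space n T) (\<lambda>\<omega>. grid_path n T W \<omega> c) (grid_space n T) (\<lambda>\<omega>. grid_path n T W \<omega> c')"
  proof -
    have "indep_var (PiM {c} (\<lambda>_. grid_space n T)) (\<lambda>\<omega>. \<lambda>i\<in>{c}. grid_path n T W \<omega> i) (PiM {c'} (\<lambda>_. grid_space n T)) (\<lambda>\<omega>. \<lambda>i\<in>{c'}. grid_path n T W \<omega> i)"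
      using assms by (intro indep_var_restrict[OF indep_grid_paths]) auto
    from indep_var_compose[OF this, of "\<lambda>f. f c" "grid_space n T" "\<lambda>f. f c'" "grid_space n T"]
    show ?thesis by (simp add: comp_def)
  qed
  then show ?thesis unfolding indep_var_distribution_eq grid_law_def by simp
qed

lemma grid_inc_in_gaussian_space:
  assumes "j \<le> n" "k < 2 ^ j"
  shows "(\<lambda>\<omega>. grid_inc j T (grid_path n T W \<omega> c) k) \<in> gaussian_space"
  unfolding grid_inc_def using assms by (intro gaussian_space_diff gaussian_space_grid_path dyad_in_grid) auto

lemma cov_eq_grid_inc:
  assumes "j \<le> n" "l < 2 ^ j" "l' < 2 ^ j"
  shows "(\<integral>\<omega>. grid_inc j T (grid_path n T W \<omega> c) l * grid_inc j T (grid_path n T W \<omega> c) l' \<partial>M)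
    = cov M W (dyad j T l) (dyad j T (Suc l)) (dyad j T l') (dyad j T (Suc l')) $ c $ c"
  using assms by (simp add: cov_def grid_inc_def grid_path_eq dyad_in_grid)

text \<open>The arithmetic mean of the variances replaces their geometric mean. This costs nothing
  later, because both variances are estimated by the same bound.\<close>

lemma cov_Cauchy_Schwarz:
  assumes "s \<in> {0..T}" "t \<in> {0..T}" "u \<in> {0..T}" "v \<in> {0..T}"
  shows "\<bar>cov M W s t u v $ c $ c\<bar> \<le> (cov M W s t s t $ c $ c + cov M W u v u v $ c $ c) / 2"
proof -
  define X where "X \<omega> = W t \<omega> $ c - W s \<omega> $ c" for \<omega>
  define Y where "Y \<omega> = W v \<omega> $ c - W u \<omega> $ c" for \<omega>
  have XY: "X \<in> gaussian_space" "Y \<in> gaussian_space"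
    unfolding X_def[abs_def] Y_def[abs_def] using assms by (auto intro!: gaussian_space_diff gaussian_space_W)
  have i: "integrable M (\<lambda>\<omega>. (X \<omega>)\<^sup>2)" "integrable M (\<lambda>\<omega>. (Y \<omega>)\<^sup>2)"
    using centred_normal_rv_moment(1)[OF prob_M gaussian_space_normal, of _ 1] XY by auto
  have m: "X \<in> borel_measurable M" "Y \<in> borel_measurable M"
    using gaussian_space_normal XY by (auto simp: centred_normal_rv_def)
  have ip: "integrable M (\<lambda>\<omega>. X \<omega> * Y \<omega>)" by (rule integrable_mult_of_squares[OF m i])
  have "\<bar>\<integral>\<omega>. X \<omega> * Y \<omega> \<partial>M\<bar> \<le> (\<integral>\<omega>. \<bar>X \<omega> * Y \<omega>\<bar> \<partial>M)" by (rule integral_abs_bound)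
  also have "\<dots> \<le> (\<integral>\<omega>. ((X \<omega>)\<^sup>2 + (Y \<omega>)\<^sup>2) / 2 \<partial>M)"
  proof (rule integral_mono)
    show "\<bar>X \<omega> * Y \<omega>\<bar> \<le> ((X \<omega>)\<^sup>2 + (Y \<omega>)\<^sup>2) / 2" for \<omega>
      using sum_squares_bound[of "\<bar>X \<omega>\<bar>" "\<bar>Y \<omega>\<bar>"] by (simp add: abs_mult)
  qed (use ip i in auto)
  also have "\<dots> = ((\<integral>\<omega>. (X \<omega>)\<^sup>2 \<partial>M) + (\<integral>\<omega>. (Y \<omega>)\<^sup>2 \<partial>M)) / 2" using i by simp
  finally show ?thesis by (simp add: cov_def X_def Y_def power2_eq_square)
qed

context
  fixes \<rho> Mc :: real
  assumes \<rho>: "1 \<le> \<rho>" "\<rho> < 2" and Mc: "0 < Mc"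
    and R: "\<And>s t. 0 \<le> s \<Longrightarrow> s \<le> t \<Longrightarrow> t \<le> T \<Longrightarrow> rho_var2 (cov M W) \<rho> s t \<le> ereal (Mc * (t - s) powr (1 / \<rho>))"
begin

lemma grid_inc_variance:
  assumes "j \<le> n" "k < 2 ^ j"
  shows "(\<integral>\<omega>. (grid_inc j T (grid_path n T W \<omega> c) k)\<^sup>2 \<partial>M) \<le> Mc * (T / 2 ^ j) powr (1 / \<rho>)"
  using cov_square_sum_le(2)[where c=c, OF T \<rho> Mc R cov_Cauchy_Schwarz assms(2)] cov_eq_grid_inc[OF assms assms(2), of c]
  by (simp add: power2_eq_square)

text \<open>For distinct components the area is a bilinear form in two independent Gaussian vectors.
  Its moments are therefore computed on the product of the two component laws, by the chaos estimate
  and by the second moment bound along refinements.\<close>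

lemma grid_area_moments:
  assumes c: "c \<noteq> c'" and j: "j \<le> n" "k < 2 ^ j"
  defines "A \<equiv> \<lambda>\<omega>. grid_area n T (k * 2 ^ (n - j)) (Suc k * 2 ^ (n - j)) (grid_path n T W \<omega> c) (grid_path n T W \<omega> c')"
  shows "A \<in> borel_measurable M" "integrable M (\<lambda>\<omega>. (A \<omega>)\<^sup>2)" "integrable M (\<lambda>\<omega>. A \<omega> ^ (2 * Suc p))"
    and "(\<integral>\<omega>. (A \<omega>)\<^sup>2 \<partial>M) \<le> (Mc * (T / 2 ^ j) powr (1 / \<rho>))\<^sup>2 / (1 - sqrt (2 powr (1 - 2 / \<rho>)))\<^sup>2"
    and "(\<integral>\<omega>. A \<omega> ^ (2 * Suc p) \<partial>M) \<le> (fact (2 * Suc p) / (2 ^ Suc p * fact (Suc p)))\<^sup>2 * (\<integral>\<omega>. (A \<omega>)\<^sup>2 \<partial>M) ^ Suc p"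
proof -
  define i where "i = n - j"
  have n: "n = j + i" using j by (simp add: i_def)
  define P where "P = grid_law M n T W"
  define K where "K = {k * 2 ^ i..<Suc k * 2 ^ i}"
  define a where "a = k * 2 ^ i"
  have K: "l < 2 ^ n" if "l \<in> K" for l
  proof -
    have "Suc k * 2 ^ i \<le> 2 ^ j * 2 ^ i" using j by (intro mult_right_mono) auto
    then show ?thesis using that by (simp add: K_def power_add n)
  qed
  \<comment> \<open>f collects the midpoint values of one interpolated component relative to the
    left end of the interval, g the increments of the other component; the area is the sum of the
    products f l * g l.\<close>
  define f where "f l v = (v (dyad n T l) + v (dyad n T (Suc l))) / 2 - v (dyad n T a)" for l and v :: "real \<Rightarrow> real"
  define g where "g l v = grid_inc n T v l" for l v
  have gr: "dyad n T l \<in> grid n T" "dyad n T (Suc l) \<in> grid n T" "dyad n T a \<in> grid n T" if "l \<in> K" for l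
    using K[OF that] that by (auto intro!: dyad_in_grid simp: K_def a_def)
  have ev: "(\<lambda>v. v t) \<in> borel_measurable (grid_space n T)" if "t \<in> grid n T" for t
    using measurable_component_singleton[OF that, of "\<lambda>_. borel"] by simp
  have fgm: "f l \<in> borel_measurable (grid_space n T)" "g l \<in> borel_measurable (grid_space n T)" if "l \<in> K" for l
    unfolding f_def[abs_def] g_def[abs_def] grid_inc_def using ev gr[OF that] by auto
  have fn: "centred_normal_rv (P b) (\<lambda>v. \<Sum>l\<in>K. u l * f l v)" for u b
    unfolding P_def grid_law_def
  proof (rule centred_normal_rv_distr[OF grid_path_measurable])
    show "(\<lambda>v. \<Sum>l\<in>K. u l * f l v) \<in> borel_measurable (grid_space n T)" using fgm by (intro borel_measurable_sum borel_measurable_times) auto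
    have "(\<lambda>\<omega>. f l (grid_path n T W \<omega> b)) \<in> gaussian_space" if "l \<in> K" for l
    proof -
      have "(\<lambda>\<omega>. (1 / 2) * (grid_path n T W \<omega> b (dyad n T l) + grid_path n T W \<omega> b (dyad n T (Suc l))) - grid_path n T W \<omega> b (dyad n T a)) \<in> gaussian_space"
        using gr[OF that] by (intro gaussian_space_diff gaussian_space_cmult gaussian_space_add gaussian_space_grid_path)
      then show ?thesis by (simp add: f_def)
    qed
    then show "centred_normal_rv M (\<lambda>x. \<Sum>l\<in>K. u l * f l (grid_path n T W x b))"
      by (intro gaussian_space_normal gaussian_space_sum) (auto simp: K_def)
  qed
  have gn: "centred_normal_rv (P b) (\<lambda>v. \<Sum>l\<in>K. u l * g l v)" for u b
    unfolding P_def grid_law_def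
  proof (rule centred_normal_rv_distr[OF grid_path_measurable])
    show "(\<lambda>v. \<Sum>l\<in>K. u l * g l v) \<in> borel_measurable (grid_space n T)" using fgm by (intro borel_measurable_sum borel_measurable_times) auto
    have "(\<lambda>\<omega>. g l (grid_path n T W \<omega> b)) \<in> gaussian_space" if "l \<in> K" for l
      unfolding g_def using grid_inc_in_gaussian_space[OF order_refl K[OF that]] .
    then show "centred_normal_rv M (\<lambda>x. \<Sum>l\<in>K. u l * g l (grid_path n T W x b))"
      by (intro gaussian_space_normal gaussian_space_sum) (auto simp: K_def)
  qed
  define B where "B = (\<lambda>(v, v'). \<Sum>l\<in>K. f l v * g l v')"
  have AB: "A \<omega> = B (grid_path n T W \<omega> c, grid_path n T W \<omega> c')" for \<omega>
    by (simp add: A_def B_def grid_area_def f_def g_def K_def a_def i_def)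
  have area: "grid_area (j + i) T (k * 2 ^ i) (Suc k * 2 ^ i) v v' = B (v, v')" for v v'
    by (simp add: B_def grid_area_def f_def g_def K_def a_def n)
  have finK: "finite K" by (simp add: K_def)
  note ch = decoupled_chaos_moment[of "grid_law M n T W c" "grid_law M n T W c'" K f g, OF prob_grid_law prob_grid_law finK fn[where b=c, unfolded P_def] gn[where b=c', unfolded P_def], folded B_def]
  have Bm: "B \<in> borel_measurable (grid_space n T \<Otimes>\<^sub>M grid_space n T)"
  proof -
    have "(\<lambda>z. f l (fst z) * g l (snd z)) \<in> borel_measurable (grid_space n T \<Otimes>\<^sub>M grid_space n T)" if "l \<in> K" for l
      by (intro borel_measurable_times measurable_compose[OF measurable_fst fgm(1)[OF that]] measurable_compose[OF measurable_snd fgm(2)[OF that]])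
    then show ?thesis unfolding B_def case_prod_beta' by (intro borel_measurable_sum) auto
  qed
  have pm: "(\<lambda>\<omega>. (grid_path n T W \<omega> c, grid_path n T W \<omega> c')) \<in> measurable M (grid_space n T \<Otimes>\<^sub>M grid_space n T)"
    by measurable
  have tr: "(\<integral>\<omega>. A \<omega> ^ r \<partial>M) = (\<integral>z. B z ^ r \<partial>(grid_law M n T W c \<Otimes>\<^sub>M grid_law M n T W c'))"
    "integrable M (\<lambda>\<omega>. A \<omega> ^ r) \<longleftrightarrow> integrable (grid_law M n T W c \<Otimes>\<^sub>M grid_law M n T W c') (\<lambda>z. B z ^ r)" for r
    unfolding grid_pair_law[OF c, symmetric] AB using Bm pm
    by (auto simp: integral_distr integrable_distr_eq)
  show "A \<in> borel_measurable M" unfolding AB[abs_def] by (rule measurable_compose[OF pm Bm])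
  show "integrable M (\<lambda>\<omega>. (A \<omega>)\<^sup>2)" "integrable M (\<lambda>\<omega>. A \<omega> ^ (2 * Suc p))"
    unfolding tr(2) using ch(1,2) by auto
  show "(\<integral>\<omega>. A \<omega> ^ (2 * Suc p) \<partial>M) \<le> (fact (2 * Suc p) / (2 ^ Suc p * fact (Suc p)))\<^sup>2 * (\<integral>\<omega>. (A \<omega>)\<^sup>2 \<partial>M) ^ Suc p"
    unfolding tr(1) by (rule ch(3))
  have q: "0 < 2 powr (1 - 2 / \<rho>)" "2 powr (1 - 2 / \<rho>) < 1"
  proof -
    have "1 - 2 / \<rho> < 0" using \<rho> by (simp add: field_simps)
    then show "2 powr (1 - 2 / \<rho>) < 1" using powr_less_mono[of "1 - 2 / \<rho>" 0 2] by simp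
  qed simp
  have evl: "(\<lambda>v. v (dyad (j + i) T l)) \<in> borel_measurable (grid_law M n T W b)"
    "integrable (grid_law M n T W b) (\<lambda>v. (v (dyad (j + i) T l))\<^sup>2)" if "l \<le> 2 ^ (j + i)" for l b
  proof -
    have t: "dyad (j + i) T l \<in> grid n T" using that by (intro dyad_in_grid) (auto simp: n)
    then show "(\<lambda>v. v (dyad (j + i) T l)) \<in> borel_measurable (grid_law M n T W b)"
      using ev by (simp add: grid_law_def)
    show "integrable (grid_law M n T W b) (\<lambda>v. (v (dyad (j + i) T l))\<^sup>2)"
      unfolding grid_law_def using ev[OF t] centred_normal_rv_moment(1)[OF prob_M gaussian_space_normal[OF gaussian_space_grid_path[OF t]], where p=1]
      by (subst integrable_distr_eq) auto
  qed
  have Rb: "(\<Sum>l\<in>{k * 2 ^ i'..<Suc k * 2 ^ i'}. \<Sum>l'\<in>{k * 2 ^ i'..<Suc k * 2 ^ i'}.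
        (\<integral>x. grid_inc (j + i') T (\<lambda>t. x t) l * grid_inc (j + i') T (\<lambda>t. x t) l' \<partial>grid_law M n T W b)\<^sup>2)
      \<le> (Mc * (T / 2 ^ j) powr (1 / \<rho>))\<^sup>2 * (2 powr (1 - 2 / \<rho>)) ^ i'" if i': "i' \<le> i" for i' b
  proof -
    have lt: "l < 2 ^ (j + i')" if "l \<in> {k * 2 ^ i'..<Suc k * 2 ^ i'}" for l
    proof -
      have "Suc k * 2 ^ i' \<le> 2 ^ j * 2 ^ i'" using j by (intro mult_right_mono) auto
      then show ?thesis using that by (simp add: power_add)
    qed
    have e: "(\<integral>x. grid_inc (j + i') T (\<lambda>t. x t) l * grid_inc (j + i') T (\<lambda>t. x t) l' \<partial>grid_law M n T W b)
      = cov M W (dyad (j + i') T l) (dyad (j + i') T (Suc l)) (dyad (j + i') T l') (dyad (j + i') T (Suc l')) $ b $ b"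
      if "l \<in> {k * 2 ^ i'..<Suc k * 2 ^ i'}" "l' \<in> {k * 2 ^ i'..<Suc k * 2 ^ i'}" for l l'
    proof -
      have ji: "j + i' \<le> n" using i' n by simp
      have "(\<lambda>x. grid_inc (j + i') T x l) \<in> borel_measurable (grid_space n T)" if "l \<in> {k * 2 ^ i'..<Suc k * 2 ^ i'}" for l
        unfolding grid_inc_def using lt[OF that] ji by (intro borel_measurable_diff ev dyad_in_grid) auto
      then show ?thesis
        unfolding cov_eq_grid_inc[OF ji lt[OF that(1)] lt[OF that(2)], symmetric] grid_law_def using that
        by (subst integral_distr[OF grid_path_measurable]) auto
    qed
    show ?thesis
      using cov_square_sum_le(1)[where c=b and i=i', OF T \<rho> Mc R cov_Cauchy_Schwarz j(2)] by (simp add: e)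
  qed
  show "(\<integral>\<omega>. (A \<omega>)\<^sup>2 \<partial>M) \<le> (Mc * (T / 2 ^ j) powr (1 / \<rho>))\<^sup>2 / (1 - sqrt (2 powr (1 - 2 / \<rho>)))\<^sup>2"
    using grid_area_second_moment[of "grid_law M n T W c" "grid_law M n T W c'" k j i "\<lambda>t v. v t" T "\<lambda>t v. v t", OF prob_grid_law prob_grid_law j(2) evl evl q Rb Rb]
    unfolding tr(1) area by (simp add: case_prod_beta')
qed

end

end

text \<open>The index \<open>(j, k, c, c')\<close> refers to the dyadic interval number \<open>k\<close> of level \<open>j\<close>. The diagonal
  \<open>c = c'\<close> is used for the increment of the component \<open>c\<close>, because the diagonal of the second
  level is half the square of the increment and needs no separate control.\<close>

definition code_var :: "nat \<Rightarrow> real \<Rightarrow> nat \<times> nat \<times> 'd \<times> 'd \<Rightarrow> ('d \<Rightarrow> real \<Rightarrow> real) \<Rightarrow> real" where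
  "code_var n T \<theta> v = (case \<theta> of (j, k, c, c') \<Rightarrow>
     if c = c' then grid_inc j T (v c) k
     else grid_area n T (k * 2 ^ (n - j)) (Suc k * 2 ^ (n - j)) (v c) (v c'))"

definition codes :: "nat \<Rightarrow> (nat \<times> nat \<times> 'd::finite \<times> 'd) set" where
  "codes n = {(j, k, c, c'). j \<le> n \<and> k < 2 ^ j}"

lemma finite_codes: "finite (codes n)"
proof (rule finite_subset)
  show "codes n \<subseteq> {..n} \<times> {..<2 ^ n} \<times> UNIV \<times> UNIV"
    by (auto simp: codes_def intro: less_le_trans power_increasing)
qed simp

lemma card_codes_level: "real (card {\<theta> \<in> codes n. fst (\<theta> :: nat \<times> nat \<times> 'd::finite \<times> 'd) = j}) \<le> (real CARD('d))\<^sup>2 * 2 ^ j"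
proof -
  have "card {\<theta> \<in> codes n. fst (\<theta> :: nat \<times> nat \<times> 'd \<times> 'd) = j} \<le> card ({j} \<times> {..<2 ^ j :: nat} \<times> (UNIV :: 'd set) \<times> (UNIV :: 'd set))"
    by (intro card_mono) (auto simp: codes_def)
  also have "\<dots> = CARD('d)\<^sup>2 * 2 ^ j" by (simp add: power2_eq_square)
  finally have "real (card {\<theta> \<in> codes n. fst (\<theta> :: nat \<times> nat \<times> 'd \<times> 'd) = j}) \<le> real (CARD('d)\<^sup>2 * 2 ^ j)"
    by (subst of_nat_le_iff)
  then show ?thesis by simp
qed

lemma codes_grid:
  assumes "(j, k, c, c') \<in> codes n"
  shows "dyad j T k \<in> grid n T" "dyad j T (Suc k) \<in> grid n T"
    and "l \<le> Suc k * 2 ^ (n - j) \<Longrightarrow> dyad n T l \<in> grid n T"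
proof -
  have j: "j \<le> n" "k < 2 ^ j" using assms by (auto simp: codes_def)
  show "dyad j T k \<in> grid n T" "dyad j T (Suc k) \<in> grid n T" using j by (auto intro!: dyad_in_grid)
  have "Suc k * 2 ^ (n - j) \<le> 2 ^ j * 2 ^ (n - j)" using j by (intro mult_right_mono) auto
  also have "\<dots> = 2 ^ n" using j by (simp add: power_add[symmetric])
  finally have "Suc k * 2 ^ (n - j) \<le> 2 ^ n" .
  then show "l \<le> Suc k * 2 ^ (n - j) \<Longrightarrow> dyad n T l \<in> grid n T" by (intro dyad_in_grid) auto
qed

lemma code_var_cong:
  assumes \<theta>: "\<theta> \<in> codes n" and v: "\<And>c t. t \<in> grid n T \<Longrightarrow> v c t = v' c t"
  shows "code_var n T \<theta> v = code_var n T \<theta> v'"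
proof -
  obtain j k c c' where [simp]: "\<theta> = (j, k, c, c')" by (cases \<theta>) auto
  note g = codes_grid[OF \<theta>[simplified]]
  have "v b (dyad n T l) = v' b (dyad n T l)" if "l \<le> Suc k * 2 ^ (n - j)" for b l
    using g(3)[OF that] v by auto
  then show ?thesis
    using v g(1,2) unfolding code_var_def grid_area_def grid_inc_def
    by (auto intro!: sum.cong simp del: mult_Suc)
qed

lemma code_var_measurable:
  assumes \<theta>: "\<theta> \<in> codes n" and v: "\<And>c t. t \<in> grid n T \<Longrightarrow> (\<lambda>x. v x c t) \<in> borel_measurable S"
  shows "(\<lambda>x. code_var n T \<theta> (v x)) \<in> borel_measurable S"
proof -
  obtain j k c c' where [simp]: "\<theta> = (j, k, c, c')" by (cases \<theta>) auto
  note g = codes_grid[OF \<theta>[simplified]]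
  have "(\<lambda>x. v x b (dyad n T l)) \<in> borel_measurable S" if "l \<le> Suc k * 2 ^ (n - j)" for b l
    using g(3)[OF that] v by auto
  then show ?thesis
    using v g(1,2) unfolding code_var_def grid_area_def grid_inc_def
    by (auto intro!: borel_measurable_sum borel_measurable_times borel_measurable_diff borel_measurable_add borel_measurable_divide simp del: mult_Suc)
qed

lemma grid_area_diff:
  "grid_area n T a b (\<lambda>t. r * (f t - f' t)) g = r * (grid_area n T a b f g - grid_area n T a b f' g)"
  "grid_area n T a b f (\<lambda>t. r * (g t - g' t)) = r * (grid_area n T a b f g - grid_area n T a b f g')"
  unfolding grid_area_def grid_inc_def sum_subtractf[symmetric] sum_distrib_left
  by (intro sum.cong refl, simp add: field_simps)+

lemma round_eq_imp_close:
  fixes x y \<delta> :: real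
  assumes "round (x / \<delta>) = round (y / \<delta>)" "0 < \<delta>"
  shows "\<bar>x - y\<bar> \<le> \<delta>"
proof -
  have "\<bar>real_of_int (round (x / \<delta>)) - x / \<delta>\<bar> \<le> 1 / 2" "\<bar>real_of_int (round (y / \<delta>)) - y / \<delta>\<bar> \<le> 1 / 2"
    by (rule of_int_round_abs_le)+
  then have "\<bar>x / \<delta> - y / \<delta>\<bar> \<le> 1" using assms(1) by linarith
  then show ?thesis using assms(2) by (simp add: diff_divide_distrib[symmetric] abs_divide field_simps)
qed

text \<open>For an area the difference expands into four mixed areas with total factor 1/2. They
  form two differences of values with the same rounding, each at most \<delta>. For an increment one
  such difference occurs, with factor 1 / sqrt 2.\<close>

lemma code_var_difference_le:
  fixes w w' :: "'d \<Rightarrow> real \<Rightarrow> real"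
  assumes \<delta>: "0 < \<delta>" and eq: "\<And>a. round (code_var n T \<theta> (mix a w w') / \<delta>) = z"
  shows "\<bar>code_var n T \<theta> (\<lambda>c t. (w c t - w' c t) / sqrt 2)\<bar> \<le> \<delta>"
proof -
  obtain j k c c' where \<theta>: "\<theta> = (j, k, c, c')" by (cases \<theta>) auto
  have close: "\<bar>code_var n T \<theta> (mix a w w') - code_var n T \<theta> (mix b w w')\<bar> \<le> \<delta>" for a b
    using eq \<delta> by (intro round_eq_imp_close) auto
  define r where "r = 1 / sqrt 2"
  have r: "0 \<le> r" "r \<le> 1" "r * r = 1 / 2" by (auto simp: r_def field_simps)
  have V: "(\<lambda>t. (w c t - w' c t) / sqrt 2) = (\<lambda>t. r * (w c t - w' c t))" for c by (simp add: r_def)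
  show ?thesis
  proof (cases "c = c'")
    case True
    have "code_var n T \<theta> (\<lambda>c t. (w c t - w' c t) / sqrt 2) = r * (code_var n T \<theta> (mix {} w w') - code_var n T \<theta> (mix UNIV w w'))"
      unfolding V by (simp add: code_var_def \<theta> True mix_def grid_inc_def algebra_simps)
    then have "\<bar>code_var n T \<theta> (\<lambda>c t. (w c t - w' c t) / sqrt 2)\<bar> = r * \<bar>code_var n T \<theta> (mix {} w w') - code_var n T \<theta> (mix UNIV w w')\<bar>"
      using r by (simp add: abs_mult)
    also have "\<dots> \<le> 1 * \<delta>" using r close[of "{}" UNIV] by (intro mult_mono) auto
    finally show ?thesis by simp
  next
    case False
    let ?A = "\<lambda>a. code_var n T \<theta> (mix a w w')"
    \<comment> \<open>Only the components c and c' enter, so UNIV serves as the choice in which both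
      come from w'.\<close>
    have m: "?A {} = grid_area n T (k * 2 ^ (n - j)) (Suc k * 2 ^ (n - j)) (w c) (w c')"
      "?A {c} = grid_area n T (k * 2 ^ (n - j)) (Suc k * 2 ^ (n - j)) (w' c) (w c')"
      "?A {c'} = grid_area n T (k * 2 ^ (n - j)) (Suc k * 2 ^ (n - j)) (w c) (w' c')"
      "?A UNIV = grid_area n T (k * 2 ^ (n - j)) (Suc k * 2 ^ (n - j)) (w' c) (w' c')"
      using False by (auto simp: code_var_def \<theta> mix_def)
    have "code_var n T \<theta> (\<lambda>c t. (w c t - w' c t) / sqrt 2) = (r * r) * ((?A {} - ?A {c}) - (?A {c'} - ?A UNIV))"
      unfolding V m by (simp only: code_var_def \<theta> prod.case False if_False grid_area_diff) (simp add: algebra_simps)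
    moreover have "\<bar>x\<bar> \<le> \<delta>" if "x = 1 / 2 * (u - v)" "\<bar>u\<bar> \<le> \<delta>" "\<bar>v\<bar> \<le> \<delta>" for x u v :: real
    proof -
      have "\<bar>u - v\<bar> \<le> \<delta> + \<delta>" using that(2,3) abs_triangle_ineq4[of u v] by linarith
      then show ?thesis by (simp add: that(1))
    qed
    ultimately show ?thesis using close[of "{}" "{c}"] close[of "{c'}" UNIV] unfolding r(3) by blast
  qed
qed

context
  fixes M :: "'a measure" and T :: real and W :: "real \<Rightarrow> 'a \<Rightarrow> real^'d"
  assumes T: "0 < T" and G: "cont_centred_gauss_indep M T W"
begin

lemma grid_path_code_var_measurable:
  "\<theta> \<in> codes n \<Longrightarrow> (\<lambda>\<omega>. code_var n T \<theta> (grid_path n T W \<omega>)) \<in> borel_measurable M"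
  by (intro code_var_measurable) (use gaussian_space_normal[OF T G gaussian_space_grid_path[OF T G]] in \<open>auto simp: centred_normal_rv_def\<close>)

text \<open>Two independent copies with the same code differ by a small path, also after exchanging some of
  their components, and the normalised difference has the law of the original path.\<close>

lemma small_paths_from_code:
  assumes \<delta>: "\<And>\<theta>. 0 < \<delta> \<theta>" and p: "0 \<le> p"
    and z: "p \<le> measure M {\<omega> \<in> space M. \<forall>\<theta>\<in>codes n. round (code_var n T \<theta> (grid_path n T W \<omega>) / \<delta> \<theta>) = z \<theta>}"
  shows "p ^ (2 ^ CARD('d)) \<le> measure M {\<omega> \<in> space M. \<forall>\<theta>\<in>codes n. \<bar>code_var n T \<theta> (grid_path n T W \<omega>)\<bar> \<le> \<delta> \<theta>}"
proof -
  interpret M: prob_space M by (rule prob_M[OF T G])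
  define \<mu> where "\<mu> = grid_law M n T W"
  have \<mu>: "prob_space (\<mu> c)" for c unfolding \<mu>_def by (rule prob_grid_law[OF T G])
  define N where "N = PiM UNIV \<mu>"
  interpret N: prob_space N unfolding N_def by (intro prob_space_PiM \<mu>)
  interpret NN: pair_prob_space N N ..
  have Nlaw: "distr M (PiM UNIV (\<lambda>_. grid_space n T)) (grid_path n T W) = N"
    unfolding N_def \<mu>_def by (rule grid_path_law[OF T G])
  have pm [measurable]: "grid_path n T W \<in> measurable M (PiM UNIV (\<lambda>_. grid_space n T))"
  proof -
    have "(\<lambda>\<omega>. \<lambda>c\<in>UNIV. grid_path n T W \<omega> c) \<in> measurable M (PiM UNIV (\<lambda>_. grid_space n T))"
      by (intro measurable_restrict grid_path_measurable[OF T G])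
    then show ?thesis by (simp add: restrict_UNIV)
  qed
  have sN: "sets N = sets (PiM UNIV (\<lambda>_. grid_space n T))" "space N = space (PiM UNIV (\<lambda>_. grid_space n T))"
    unfolding Nlaw[symmetric] by auto
  have cN: "(\<lambda>w. w c t) \<in> borel_measurable N" if "t \<in> grid n T" for c t
  proof -
    have "(\<lambda>w. w c) \<in> measurable (PiM UNIV (\<lambda>_. grid_space n T)) (grid_space n T)" by (rule measurable_component_singleton) simp
    moreover have "(\<lambda>v. v t) \<in> borel_measurable (grid_space n T)" using measurable_component_singleton[OF that, of "\<lambda>_. borel"] by simp
    ultimately have "(\<lambda>w. w c t) \<in> borel_measurable (PiM UNIV (\<lambda>_. grid_space n T))" by (rule measurable_compose)
    then show ?thesis unfolding measurable_cong_sets[OF sN(1) refl] .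
  qed
  have yN: "(\<lambda>w. code_var n T \<theta> w) \<in> borel_measurable N" if "\<theta> \<in> codes n" for \<theta>
    using code_var_measurable[OF that, of T "\<lambda>w. w" N] cN by simp
  define E where "E = {w \<in> space N. \<forall>\<theta>\<in>codes n. round (code_var n T \<theta> w / \<delta> \<theta>) = z \<theta>}"
  have E: "E \<in> sets N"
    unfolding E_def
  proof (rule sets.sets_Collect_finite_All[OF _ finite_codes])
    fix \<theta> assume \<theta>: "\<theta> \<in> (codes n :: (nat \<times> nat \<times> 'd \<times> 'd) set)"
    note [measurable] = yN[OF \<theta>]
    have "(\<lambda>w. round (code_var n T \<theta> w / \<delta> \<theta>)) \<in> measurable N (count_space UNIV)"
      unfolding round_def by measurable
    then show "{w \<in> space N. round (code_var n T \<theta> w / \<delta> \<theta>) = z \<theta>} \<in> sets N" by measurable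
  qed
  define V where "V w w' = (\<lambda>c t. (w c t - w' c t) / sqrt 2)" for w w' :: "'d \<Rightarrow> real \<Rightarrow> real"
  define B where "B = {q \<in> space (N \<Otimes>\<^sub>M N). \<forall>\<theta>\<in>codes n. \<bar>code_var n T \<theta> (V (fst q) (snd q))\<bar> \<le> \<delta> \<theta>}"
  have cNN: "(\<lambda>q. V (fst q) (snd q) c t) \<in> borel_measurable (N \<Otimes>\<^sub>M N)" if "t \<in> grid n T" for c t
    unfolding V_def
    by (intro borel_measurable_divide borel_measurable_diff measurable_compose[OF measurable_fst cN[OF that]] measurable_compose[OF measurable_snd cN[OF that]]) simp
  have B: "B \<in> sets (N \<Otimes>\<^sub>M N)"
    unfolding B_def
  proof (rule sets.sets_Collect_finite_All[OF _ finite_codes])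
    fix \<theta> assume \<theta>: "\<theta> \<in> (codes n :: (nat \<times> nat \<times> 'd \<times> 'd) set)"
    have [measurable]: "(\<lambda>q. code_var n T \<theta> (V (fst q) (snd q))) \<in> borel_measurable (N \<Otimes>\<^sub>M N)"
      by (rule code_var_measurable[OF \<theta> cNN])
    show "{q \<in> space (N \<Otimes>\<^sub>M N). \<bar>code_var n T \<theta> (V (fst q) (snd q))\<bar> \<le> \<delta> \<theta>} \<in> sets (N \<Otimes>\<^sub>M N)" by measurable
  qed
  \<comment> \<open>With f the indicator of a code, the product of f (mix a w w') over all a
    indicates that every mixed path carries this code.\<close>
  define f where "f = (indicator E :: _ \<Rightarrow> real)"
  have fm: "f \<in> borel_measurable N" unfolding f_def using E by simp
  have "(\<lambda>q. f (mix a (fst q) (snd q))) \<in> borel_measurable (N \<Otimes>\<^sub>M N)" for a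
    using measurable_compose[OF mix_measurable[where \<mu>=\<mu>, OF \<mu>, folded N_def] fm, of a] by (simp add: case_prod_beta')
  then have int: "integrable (N \<Otimes>\<^sub>M N) (\<lambda>(w, w'). \<Prod>a\<in>Pow UNIV. f (mix a w w'))"
    by (intro NN.integrable_const_bound[where B=1])
      (auto simp: case_prod_beta' f_def abs_prod intro!: prod_le_1)
  have "p \<le> (\<integral>w. f w \<partial>N)"
  proof -
    have "{\<omega> \<in> space M. \<forall>\<theta>\<in>codes n. round (code_var n T \<theta> (grid_path n T W \<omega>) / \<delta> \<theta>) = z \<theta>} = grid_path n T W -` E \<inter> space M"
      using measurable_space[OF pm] by (auto simp: E_def sN)
    then have "p \<le> measure N E" using z measure_distr[OF pm, of E] E Nlaw sN by simp
    then show ?thesis using E by (simp add: f_def)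
  qed
  then have "p ^ (2 ^ CARD('d)) \<le> (\<integral>w. f w \<partial>N) ^ (2 ^ CARD('d))" using p by (intro power_mono)
  also have "\<dots> \<le> (\<integral>w'. (\<integral>w. (\<Prod>a\<in>Pow UNIV. f (mix a w w')) \<partial>N) \<partial>N)"
    using box_inequality[where S=UNIV and f=f and \<mu>=\<mu>, OF \<mu>] fm unfolding N_def by (simp add: f_def)
  also have "\<dots> = (\<integral>q. (case q of (w, w') \<Rightarrow> \<Prod>a\<in>Pow UNIV. f (mix a w w')) \<partial>(N \<Otimes>\<^sub>M N))"
    by (rule NN.integral_snd[OF int])
  also have "(\<integral>q. (case q of (w, w') \<Rightarrow> \<Prod>a\<in>Pow UNIV. f (mix a w w')) \<partial>(N \<Otimes>\<^sub>M N)) \<le> (\<integral>q. indicator B q \<partial>(N \<Otimes>\<^sub>M N))"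
  proof (rule integral_mono[OF int])
    show "integrable (N \<Otimes>\<^sub>M N) (indicator B :: _ \<Rightarrow> real)" using B by (simp add: NN.emeasure_eq_measure)
    fix q assume q: "q \<in> space (N \<Otimes>\<^sub>M N)"
    show "(case q of (w, w') \<Rightarrow> \<Prod>a\<in>Pow UNIV. f (mix a w w')) \<le> indicator B q"
    proof (cases "\<forall>a. mix a (fst q) (snd q) \<in> E")
      case True
      have "\<bar>code_var n T \<theta> (V (fst q) (snd q))\<bar> \<le> \<delta> \<theta>" if "\<theta> \<in> codes n" for \<theta>
        unfolding V_def by (rule code_var_difference_le[OF \<delta>, where z="z \<theta>"]) (use True that in \<open>auto simp: E_def\<close>)
      then have "q \<in> B" using q by (auto simp: B_def)
      then show ?thesis by (auto simp: f_def case_prod_beta intro!: prod_le_1)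
    next
      case False
      then have "\<exists>a\<in>Pow UNIV. f (mix a (fst q) (snd q)) = 0" by (auto simp: f_def indicator_eq_0_iff)
      then have zero: "(\<Prod>a\<in>Pow UNIV. f (mix a (fst q) (snd q))) = 0" by (intro prod_zero) auto
      show ?thesis by (simp only: case_prod_beta zero) simp
    qed
  qed
  also have "\<dots> = measure (N \<Otimes>\<^sub>M N) B" using B by simp
  also have "\<dots> = measure M {\<omega> \<in> space M. \<forall>\<theta>\<in>codes n. \<bar>code_var n T \<theta> (grid_path n T W \<omega>)\<bar> \<le> \<delta> \<theta>}"
  proof -
    \<comment> \<open>Component and time are merged into one index: the whole path on the grid
      becomes a single Gaussian vector, and the law of the difference is obtained jointly for all
      code variables.\<close>
    define K where "K = (UNIV :: 'd set) \<times> grid n T"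
    have K: "finite K" unfolding K_def using finite_grid by simp
    define X where "X a w = w (fst a) (snd a)" for a :: "'d \<times> real" and w :: "'d \<Rightarrow> real \<Rightarrow> real"
    define Q where "Q = (PiM K (\<lambda>_. borel) :: ('d \<times> real \<Rightarrow> real) measure)"
    define H where "H = {h \<in> space Q. \<forall>\<theta>\<in>codes n. \<bar>code_var n T \<theta> (\<lambda>c t. h (c, t))\<bar> \<le> \<delta> \<theta>}"
    have H: "H \<in> sets Q"
      unfolding H_def
    proof (rule sets.sets_Collect_finite_All[OF _ finite_codes])
      fix \<theta> assume \<theta>: "\<theta> \<in> (codes n :: (nat \<times> nat \<times> 'd \<times> 'd) set)"
      have "(\<lambda>h. h (c, t)) \<in> borel_measurable Q" if "t \<in> grid n T" for c t
        unfolding Q_def using measurable_component_singleton[of "(c, t)" K "\<lambda>_. borel"] that by (simp add: K_def)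
      then have [measurable]: "(\<lambda>h. code_var n T \<theta> (\<lambda>c t. h (c, t))) \<in> borel_measurable Q"
        by (rule code_var_measurable[OF \<theta>])
      show "{h \<in> space Q. \<bar>code_var n T \<theta> (\<lambda>c t. h (c, t))\<bar> \<le> \<delta> \<theta>} \<in> sets Q" by measurable
    qed
    have Xm: "X a \<in> borel_measurable N" if "a \<in> K" for a
      using cN[of "snd a" "fst a"] that by (auto simp: X_def[abs_def] K_def)
    have "centred_normal_rv N (\<lambda>w. \<Sum>a\<in>K. u a * X a w)" for u
      unfolding Nlaw[symmetric]
    proof (rule centred_normal_rv_distr[OF pm])
      show "(\<lambda>w. \<Sum>a\<in>K. u a * X a w) \<in> borel_measurable (PiM UNIV (\<lambda>_. grid_space n T))"
        unfolding measurable_cong_sets[OF sN(1)[symmetric] refl] using Xm by (intro borel_measurable_sum borel_measurable_times) auto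
      have "(\<lambda>\<omega>. X a (grid_path n T W \<omega>)) \<in> gaussian_space T W" if "a \<in> K" for a
        unfolding X_def using that by (intro gaussian_space_grid_path[OF T G]) (auto simp: K_def)
      then show "centred_normal_rv M (\<lambda>x. \<Sum>a\<in>K. u a * X a (grid_path n T W x))"
        using K by (intro gaussian_space_normal[OF T G] gaussian_space_sum[OF T G])
    qed
    from gaussian_difference_law[OF N.prob_space_axioms K this]
    have law: "distr N Q (\<lambda>w. \<lambda>a\<in>K. X a w) = distr (N \<Otimes>\<^sub>M N) Q (\<lambda>(w, w'). \<lambda>a\<in>K. (X a w - X a w') / sqrt 2)"
      unfolding Q_def .
    have m1: "(\<lambda>w. \<lambda>a\<in>K. X a w) \<in> measurable N Q" unfolding Q_def using Xm by (intro measurable_restrict)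
    have m2: "(\<lambda>(w, w'). \<lambda>a\<in>K. (X a w - X a w') / sqrt 2) \<in> measurable (N \<Otimes>\<^sub>M N) Q"
      unfolding Q_def case_prod_beta'
      by (intro measurable_restrict borel_measurable_divide borel_measurable_diff measurable_compose[OF measurable_fst Xm] measurable_compose[OF measurable_snd Xm]) auto
    have h1: "code_var n T \<theta> (\<lambda>c t. (\<lambda>a\<in>K. X a w) (c, t)) = code_var n T \<theta> w" if "\<theta> \<in> codes n" for \<theta> w
      by (rule code_var_cong[OF that]) (simp add: K_def X_def)
    have h2: "code_var n T \<theta> (\<lambda>c t. (\<lambda>a\<in>K. (X a w - X a w') / sqrt 2) (c, t)) = code_var n T \<theta> (V w w')" if "\<theta> \<in> codes n" for \<theta> w w'
      by (rule code_var_cong[OF that]) (simp add: K_def X_def V_def)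
    have m3: "(\<lambda>\<omega>. \<lambda>a\<in>K. X a (grid_path n T W \<omega>)) \<in> measurable M Q"
      by (rule measurable_compose[OF _ m1]) (use pm in \<open>simp add: measurable_cong_sets[OF refl sN(1)]\<close>)
    have "measure (N \<Otimes>\<^sub>M N) B = measure (distr (N \<Otimes>\<^sub>M N) Q (\<lambda>(w, w'). \<lambda>a\<in>K. (X a w - X a w') / sqrt 2)) H"
      unfolding measure_distr[OF m2 H] using measurable_space[OF m2] h2
      by (intro arg_cong[where f="measure (N \<Otimes>\<^sub>M N)"]) (auto simp: B_def H_def)
    also have "\<dots> = measure (distr N Q (\<lambda>w. \<lambda>a\<in>K. X a w)) H" unfolding law ..
    also have "\<dots> = measure N {w \<in> space N. \<forall>\<theta>\<in>codes n. \<bar>code_var n T \<theta> w\<bar> \<le> \<delta> \<theta>}"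
      unfolding measure_distr[OF m1 H] using measurable_space[OF m1] h1
      by (intro arg_cong[where f="measure N"]) (auto simp: H_def)
    also have "\<dots> = measure (distr M (PiM UNIV (\<lambda>_. grid_space n T)) (grid_path n T W)) {w \<in> space N. \<forall>\<theta>\<in>codes n. \<bar>code_var n T \<theta> w\<bar> \<le> \<delta> \<theta>}"
      unfolding Nlaw ..
    also have "\<dots> = measure M {\<omega> \<in> space M. \<forall>\<theta>\<in>codes n. \<bar>code_var n T \<theta> (grid_path n T W \<omega>)\<bar> \<le> \<delta> \<theta>}"
    proof (subst measure_distr[OF pm])
      have "{w \<in> space N. \<forall>\<theta>\<in>codes n. \<bar>code_var n T \<theta> w\<bar> \<le> \<delta> \<theta>} \<in> sets N"
      proof (rule sets.sets_Collect_finite_All[OF _ finite_codes])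
        fix \<theta> assume \<theta>: "\<theta> \<in> (codes n :: (nat \<times> nat \<times> 'd \<times> 'd) set)"
        note [measurable] = yN[OF \<theta>]
        show "{w \<in> space N. \<bar>code_var n T \<theta> w\<bar> \<le> \<delta> \<theta>} \<in> sets N" by measurable
      qed
      then show "{w \<in> space N. \<forall>\<theta>\<in>codes n. \<bar>code_var n T \<theta> w\<bar> \<le> \<delta> \<theta>} \<in> sets (PiM UNIV (\<lambda>_. grid_space n T))" by (simp only: sN)
      show "measure M (grid_path n T W -` {w \<in> space N. \<forall>\<theta>\<in>codes n. \<bar>code_var n T \<theta> w\<bar> \<le> \<delta> \<theta>} \<inter> space M)
        = measure M {\<omega> \<in> space M. \<forall>\<theta>\<in>codes n. \<bar>code_var n T \<theta> (grid_path n T W \<omega>)\<bar> \<le> \<delta> \<theta>}"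
        using measurable_space[OF pm] by (intro arg_cong[where f="measure M"]) (auto simp: sN)
    qed
    finally show ?thesis .
  qed
  finally show ?thesis .
qed

end

section \<open>Small ball probabilities\<close>

definition code_width :: "(nat \<Rightarrow> real) \<Rightarrow> nat \<times> nat \<times> 'd \<times> 'd \<Rightarrow> real" where
  "code_width \<eta> \<theta> = (case \<theta> of (j, k, c, c') \<Rightarrow> if c = c' then \<eta> j else (\<eta> j)\<^sup>2)"

text \<open>Measured in units of the widths, the variables of level j have variance of order b^(J -
  j) (increments) or b^(2 (J - j)) (areas) with b = 2^(2 \<kappa>), uniformly in the level n of the
  grid. This is the situation of \<open>multilevel_code\<close>, and duplication recentres the code
  at 0.\<close>

lemma small_grid_paths_probability:
  fixes W :: "real \<Rightarrow> 'a \<Rightarrow> real^'d"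
  assumes T: "0 < T" and G: "cont_centred_gauss_indep M T W"
    and \<rho>: "1 \<le> \<rho>" "\<rho> < 2" and Mc: "0 < Mc"
    and R: "\<And>s t. 0 \<le> s \<Longrightarrow> s \<le> t \<Longrightarrow> t \<le> T \<Longrightarrow> rho_var2 (cov M W) \<rho> s t \<le> ereal (Mc * (t - s) powr (1 / \<rho>))"
    and \<kappa>: "\<kappa> = 1 / (2 * \<rho>) - \<alpha>" "0 < \<kappa>" "\<kappa> \<le> 1 / 2" and c0: "0 < c0"
  shows "\<exists>C>0. \<forall>n J \<epsilon>. 0 < \<epsilon> \<longrightarrow> 1 / \<epsilon> \<le> 2 powr (\<kappa> * real J) \<longrightarrow>
    exp (- C * 2 ^ J) \<le> measure M {\<omega> \<in> space M. \<forall>\<theta>\<in>codes n.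
      \<bar>code_var n T \<theta> (grid_path n T W \<omega>)\<bar> \<le> code_width (\<lambda>j. c0 * \<epsilon> * (T / 2 ^ j) powr \<alpha>) \<theta>}"
proof -
  \<comment> \<open>The bound b^2 \<le> 4, a consequence of \<kappa> \<le> 1/2, keeps also the areas
    within the growth 4^(J - j) allowed on coarse levels.\<close>
  define b where "b = 2 powr (2 * \<kappa>)"
  have b: "1 < b" "b\<^sup>2 \<le> 4"
  proof -
    show "1 < b" using \<kappa> powr_less_mono[of 0 "2 * \<kappa>" 2] by (simp add: b_def)
    have "b\<^sup>2 = 2 powr (4 * \<kappa>)" by (simp add: b_def powr_power)
    also have "\<dots> \<le> 2 powr 2" using \<kappa> by (intro powr_mono) auto
    finally show "b\<^sup>2 \<le> 4" by (simp add: powr_numeral)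
  qed
  \<comment> \<open>The order of the moment is chosen so large that b^(-p (j - J)) decays at least
    like 8^(-(j - J)), however small \<kappa> is.\<close>
  obtain p where p: "8 < b ^ p" using real_arch_pow[OF b(1)] by blast
  define p' where "p' = Suc p"
  have p': "8 \<le> b ^ p'" using p b mult_mono[of 1 b 8 "b ^ p"] by (simp add: p'_def)
  define s where "s = 1 - sqrt (2 powr (1 - 2 / \<rho>))"
  have s: "0 < s" "s \<le> 1"
  proof -
    have "1 - 2 / \<rho> < 0" using \<rho> by (simp add: field_simps)
    then have "2 powr (1 - 2 / \<rho>) < 1" using powr_less_mono[of "1 - 2 / \<rho>" 0 2] by simp
    then show "0 < s" by (simp add: s_def)
    show "s \<le> 1" by (simp add: s_def)
  qed
  define B where "B = 1 + Mc * T powr (2 * \<kappa>) / c0\<^sup>2"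
  have B: "1 \<le> B" using Mc by (simp add: B_def)
  define \<Lambda>0 where "\<Lambda>0 = B\<^sup>2 / s\<^sup>2"
  have s2: "0 < s\<^sup>2" "s\<^sup>2 \<le> 1" using s by (auto simp: power_le_one)
  have BL: "B \<le> \<Lambda>0"
  proof -
    have "B * 1 \<le> B * B" using B by (intro mult_left_mono) auto
    then have "B * s\<^sup>2 \<le> B\<^sup>2" using s2 B mult_left_mono[of "s\<^sup>2" 1 B] by (simp add: power2_eq_square)
    then show ?thesis using s2 by (simp add: \<Lambda>0_def pos_le_divide_eq)
  qed
  have L0: "1 \<le> \<Lambda>0" using BL B by linarith
  \<comment> \<open>cp is the moment ratio of a Gaussian increment and cp^2 bounds that of an area;
    their sum serves both.\<close>
  define cp where "cp = (fact (2 * p') / (2 ^ p' * fact p') :: real)"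
  have cp: "0 \<le> cp" by (simp add: cp_def)
  define \<Lambda> where "\<Lambda> = \<Lambda>0 + (cp + cp\<^sup>2) * \<Lambda>0 ^ p'"
  have \<Lambda>: "\<Lambda>0 \<le> \<Lambda>" "(cp + cp\<^sup>2) * \<Lambda>0 ^ p' \<le> \<Lambda>" "0 \<le> \<Lambda>" using L0 cp by (auto simp: \<Lambda>_def)
  define C0 where "C0 = 8 * (real CARD('d))\<^sup>2 * (4 * 4 ^ p' * \<Lambda> + 4) + 2"
  have C0: "0 < C0" using \<Lambda> by (simp add: C0_def add_nonneg_pos)
  define C where "C = 2 ^ CARD('d) * C0"
  show ?thesis
  proof (intro exI[of _ C] conjI allI impI)
    show "0 < C" using C0 by (simp add: C_def)
    fix n J and \<epsilon> :: real assume \<epsilon>: "0 < \<epsilon>" "1 / \<epsilon> \<le> 2 powr (\<kappa> * real J)"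
    define \<eta> where "\<eta> j = c0 * \<epsilon> * (T / 2 ^ j) powr \<alpha>" for j :: nat
    have \<eta>: "0 < \<eta> j" for j using c0 \<epsilon> T by (simp add: \<eta>_def)
    have width: "0 < code_width \<eta> \<theta>" for \<theta> :: "nat \<times> nat \<times> 'd \<times> 'd" by (cases \<theta>) (use \<eta> less_imp_neq[OF \<eta>, symmetric] in \<open>simp add: code_width_def\<close>)
    define y where "y \<theta> \<omega> = code_var n T \<theta> (grid_path n T W \<omega>) / code_width \<eta> \<theta>" for \<theta> and \<omega>
    define r where "r j = b ^ J / b ^ j" for j
    have r0: "0 < r j" for j using b by (simp add: r_def)
    \<comment> \<open>Since 1/\<rho> = 2\<kappa> + 2\<alpha>, the power of the mesh in \<eta>_j^2
      cancels and b^(-j) remains, while the choice of J gives \<epsilon>^(-2) \<le> b^J.\<close>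
    have u: "Mc * (T / 2 ^ j) powr (1 / \<rho>) / (\<eta> j)\<^sup>2 \<le> B * r j" for j
    proof -
      have "(T / 2 ^ j) powr (1 / \<rho>) = (T / 2 ^ j) powr (2 * \<kappa>) * ((T / 2 ^ j) powr \<alpha>)\<^sup>2"
      proof -
        have "1 / \<rho> = 2 * \<kappa> + (\<alpha> + \<alpha>)" using \<rho> by (simp add: \<kappa>(1) field_simps)
        then show ?thesis by (simp only: powr_add power2_eq_square)
      qed
      then have "Mc * (T / 2 ^ j) powr (1 / \<rho>) / (\<eta> j)\<^sup>2 = Mc / c0\<^sup>2 * (1 / \<epsilon>)\<^sup>2 * (T / 2 ^ j) powr (2 * \<kappa>)"
        using T c0 \<epsilon> by (simp add: \<eta>_def power_mult_distrib power_divide field_simps)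
      also have "(T / 2 ^ j) powr (2 * \<kappa>) = T powr (2 * \<kappa>) / b ^ j"
        using T by (simp add: powr_divide b_def powr_realpow[symmetric] powr_powr mult.commute)
      also have "Mc / c0\<^sup>2 * (1 / \<epsilon>)\<^sup>2 * (T powr (2 * \<kappa>) / b ^ j) \<le> Mc / c0\<^sup>2 * b ^ J * (T powr (2 * \<kappa>) / b ^ j)"
      proof (intro mult_right_mono mult_left_mono)
        have "(1 / \<epsilon>)\<^sup>2 \<le> (2 powr (\<kappa> * real J))\<^sup>2" using \<epsilon> by (intro power_mono) auto
        also have "\<dots> = b ^ J" by (simp add: b_def powr_power powr_realpow[symmetric] powr_powr mult_ac)
        finally show "(1 / \<epsilon>)\<^sup>2 \<le> b ^ J" .
      qed (use Mc b in auto)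
      also have "\<dots> = (Mc * T powr (2 * \<kappa>) / c0\<^sup>2) * r j" by (simp add: r_def)
      also have "\<dots> \<le> B * r j" using r0[of j] by (intro mult_right_mono) (auto simp: B_def)
      finally show ?thesis .
    qed
    \<comment> \<open>The normalised variance is of order r j for an increment and (r j)^2 for an
      area. The maximum is governed by the square on coarse levels, where r j > 1, and by r j itself
      on fine ones.\<close>
    have y: "y \<theta> \<in> borel_measurable M" "integrable M (\<lambda>\<omega>. (y \<theta> \<omega>)\<^sup>2)" "integrable M (\<lambda>\<omega>. y \<theta> \<omega> ^ (2 * p'))"
      and y2: "(\<integral>\<omega>. (y \<theta> \<omega>)\<^sup>2 \<partial>M) \<le> \<Lambda>0 * max (r (fst \<theta>)) ((r (fst \<theta>))\<^sup>2)"
      and yp: "(\<integral>\<omega>. y \<theta> \<omega> ^ (2 * p') \<partial>M) \<le> (cp + cp\<^sup>2) * (\<integral>\<omega>. (y \<theta> \<omega>)\<^sup>2 \<partial>M) ^ p'"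
      if \<theta>: "\<theta> \<in> codes n" for \<theta>
    proof -
      obtain j k c c' where \<theta>': "\<theta> = (j, k, c, c')" by (cases \<theta>) auto
      have jk: "j \<le> n" "k < 2 ^ j" using \<theta> by (auto simp: \<theta>' codes_def)
      define X where "X \<omega> = code_var n T \<theta> (grid_path n T W \<omega>)" for \<omega>
      define d where "d = code_width \<eta> \<theta>"
      have d: "0 < d" using width by (simp add: d_def)
      have yX: "y \<theta> \<omega> ^ q = X \<omega> ^ q / d ^ q" for \<omega> q by (simp add: y_def X_def d_def power_divide)
      have X: "X \<in> borel_measurable M \<and> integrable M (\<lambda>\<omega>. (X \<omega>)\<^sup>2) \<and> integrable M (\<lambda>\<omega>. X \<omega> ^ (2 * p'))
        \<and> (\<integral>\<omega>. (X \<omega>)\<^sup>2 \<partial>M) / d\<^sup>2 \<le> \<Lambda>0 * max (r j) ((r j)\<^sup>2)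
        \<and> (\<integral>\<omega>. X \<omega> ^ (2 * p') \<partial>M) \<le> (cp + cp\<^sup>2) * (\<integral>\<omega>. (X \<omega>)\<^sup>2 \<partial>M) ^ p'"
      proof (cases "c = c'")
        case True
        have Xe: "X = (\<lambda>\<omega>. grid_inc j T (grid_path n T W \<omega> c) k)" by (simp add: X_def code_var_def \<theta>' True fun_eq_iff)
        have Xn: "centred_normal_rv M X"
          unfolding Xe by (rule gaussian_space_normal[OF T G grid_inc_in_gaussian_space[OF T G jk]])
        have m: "X \<in> borel_measurable M" using Xn by (simp add: centred_normal_rv_def)
        have i: "integrable M (\<lambda>\<omega>. (X \<omega>)\<^sup>2)" "integrable M (\<lambda>\<omega>. X \<omega> ^ (2 * p'))"
          using centred_normal_rv_moment(1)[OF prob_M[OF T G] Xn, of 1] centred_normal_rv_moment(1)[OF prob_M[OF T G] Xn, of p'] by auto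
        have "(\<integral>\<omega>. (X \<omega>)\<^sup>2 \<partial>M) \<le> Mc * (T / 2 ^ j) powr (1 / \<rho>)"
          unfolding Xe by (rule grid_inc_variance[OF T G \<rho> Mc R jk])
        then have "(\<integral>\<omega>. (X \<omega>)\<^sup>2 \<partial>M) / d\<^sup>2 \<le> Mc * (T / 2 ^ j) powr (1 / \<rho>) / (\<eta> j)\<^sup>2"
          by (auto simp: d_def code_width_def \<theta>' True intro: divide_right_mono)
        also have "\<dots> \<le> B * r j" by (rule u)
        also have "\<dots> \<le> \<Lambda>0 * max (r j) ((r j)\<^sup>2)" using BL B r0[of j] by (intro mult_mono) auto
        finally have v: "(\<integral>\<omega>. (X \<omega>)\<^sup>2 \<partial>M) / d\<^sup>2 \<le> \<Lambda>0 * max (r j) ((r j)\<^sup>2)" .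
        have "(\<integral>\<omega>. X \<omega> ^ (2 * p') \<partial>M) = cp * (\<integral>\<omega>. (X \<omega>)\<^sup>2 \<partial>M) ^ p'"
          unfolding cp_def by (rule centred_normal_rv_moment(2)[OF prob_M[OF T G] Xn])
        also have "\<dots> \<le> (cp + cp\<^sup>2) * (\<integral>\<omega>. (X \<omega>)\<^sup>2 \<partial>M) ^ p'" by (intro mult_right_mono) auto
        finally show ?thesis using m i v by blast
      next
        case False
        have Xe: "X \<omega> = grid_area n T (k * 2 ^ (n - j)) (Suc k * 2 ^ (n - j)) (grid_path n T W \<omega> c) (grid_path n T W \<omega> c')" for \<omega>
          using False by (simp add: X_def code_var_def \<theta>' del: mult_Suc)
        note am = grid_area_moments[OF T G \<rho> Mc R False jk, folded Xe]
        have "(\<integral>\<omega>. (X \<omega>)\<^sup>2 \<partial>M) \<le> (Mc * (T / 2 ^ j) powr (1 / \<rho>))\<^sup>2 / s\<^sup>2"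
          using am(4) by (simp add: s_def)
        then have "(\<integral>\<omega>. (X \<omega>)\<^sup>2 \<partial>M) / d\<^sup>2 \<le> (Mc * (T / 2 ^ j) powr (1 / \<rho>))\<^sup>2 / s\<^sup>2 / d\<^sup>2"
          by (rule divide_right_mono) simp
        also have "\<dots> = (Mc * (T / 2 ^ j) powr (1 / \<rho>) / (\<eta> j)\<^sup>2)\<^sup>2 / s\<^sup>2"
          using False by (simp add: d_def code_width_def \<theta>' power_divide)
        also have "\<dots> \<le> (B * r j)\<^sup>2 / s\<^sup>2" using Mc u[of j] by (intro divide_right_mono power_mono) auto
        also have "\<dots> = \<Lambda>0 * (r j)\<^sup>2" by (simp add: \<Lambda>0_def power_mult_distrib)
        also have "\<dots> \<le> \<Lambda>0 * max (r j) ((r j)\<^sup>2)" using L0 by (intro mult_left_mono) auto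
        finally have v: "(\<integral>\<omega>. (X \<omega>)\<^sup>2 \<partial>M) / d\<^sup>2 \<le> \<Lambda>0 * max (r j) ((r j)\<^sup>2)" .
        have "(\<integral>\<omega>. X \<omega> ^ (2 * p') \<partial>M) \<le> cp\<^sup>2 * (\<integral>\<omega>. (X \<omega>)\<^sup>2 \<partial>M) ^ p'"
          using am(5)[of p] unfolding cp_def p'_def .
        also have "\<dots> \<le> (cp + cp\<^sup>2) * (\<integral>\<omega>. (X \<omega>)\<^sup>2 \<partial>M) ^ p'" using cp by (intro mult_right_mono) auto
        finally show ?thesis using am(1,2) am(3)[of p] v unfolding p'_def by blast
      qed
      show "y \<theta> \<in> borel_measurable M" unfolding y_def X_def[symmetric] using X by (intro borel_measurable_divide) auto
      show "integrable M (\<lambda>\<omega>. (y \<theta> \<omega>)\<^sup>2)" "integrable M (\<lambda>\<omega>. y \<theta> \<omega> ^ (2 * p'))" unfolding yX using X by auto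
      show "(\<integral>\<omega>. (y \<theta> \<omega>)\<^sup>2 \<partial>M) \<le> \<Lambda>0 * max (r (fst \<theta>)) ((r (fst \<theta>))\<^sup>2)" unfolding yX using X by (simp add: \<theta>')
      have "(\<integral>\<omega>. y \<theta> \<omega> ^ (2 * p') \<partial>M) = (\<integral>\<omega>. X \<omega> ^ (2 * p') \<partial>M) / d ^ (2 * p')" unfolding yX by simp
      also have "\<dots> \<le> (cp + cp\<^sup>2) * (\<integral>\<omega>. (X \<omega>)\<^sup>2 \<partial>M) ^ p' / d ^ (2 * p')" using X d by (intro divide_right_mono) auto
      also have "\<dots> = (cp + cp\<^sup>2) * (\<integral>\<omega>. (y \<theta> \<omega>)\<^sup>2 \<partial>M) ^ p'" unfolding yX by (simp add: power_divide power_mult)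
      finally show "(\<integral>\<omega>. y \<theta> \<omega> ^ (2 * p') \<partial>M) \<le> (cp + cp\<^sup>2) * (\<integral>\<omega>. (y \<theta> \<omega>)\<^sup>2 \<partial>M) ^ p'" .
    qed
    have coarse: "(\<integral>\<omega>. (y \<theta> \<omega>)\<^sup>2 \<partial>M) \<le> \<Lambda> * 4 ^ (J - fst \<theta>)" if \<theta>: "\<theta> \<in> codes n" "fst \<theta> < J" for \<theta>
    proof -
      define i where "i = J - fst \<theta>"
      have ri: "r (fst \<theta>) = b ^ i" using \<theta>(2) b by (simp add: r_def i_def power_diff)
      have "max (r (fst \<theta>)) ((r (fst \<theta>))\<^sup>2) \<le> 4 ^ i"
      proof -
        have "1 \<le> b ^ i" using b by (simp add: one_le_power)
        then have "b ^ i \<le> (b ^ i)\<^sup>2" using mult_left_mono[of 1 "b ^ i" "b ^ i"] by (simp add: power2_eq_square)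
        moreover have "(b ^ i)\<^sup>2 = (b\<^sup>2) ^ i" by (simp add: power_mult[symmetric] mult.commute)
        moreover have "(b\<^sup>2) ^ i \<le> 4 ^ i" using b by (intro power_mono) auto
        ultimately show ?thesis unfolding ri by simp
      qed
      then have "\<Lambda>0 * max (r (fst \<theta>)) ((r (fst \<theta>))\<^sup>2) \<le> \<Lambda> * 4 ^ i"
        using \<Lambda> L0 r0[of "fst \<theta>"] by (intro mult_mono) auto
      then show ?thesis using y2[OF \<theta>(1)] by (simp add: i_def)
    qed
    have fine: "(\<integral>\<omega>. y \<theta> \<omega> ^ (2 * p') \<partial>M) \<le> \<Lambda> / 8 ^ (fst \<theta> - J)" if \<theta>: "\<theta> \<in> codes n" "J \<le> fst \<theta>" for \<theta>
    proof -
      define i where "i = fst \<theta> - J"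
      have ri: "r (fst \<theta>) = 1 / b ^ i"
      proof -
        have "b ^ fst \<theta> = b ^ J * b ^ i" using \<theta>(2) by (simp add: i_def power_add[symmetric])
        then show ?thesis using b by (simp add: r_def)
      qed
      have r1: "r (fst \<theta>) \<le> 1" unfolding ri using b by (simp add: one_le_power)
      have "max (r (fst \<theta>)) ((r (fst \<theta>))\<^sup>2) = r (fst \<theta>)"
        using r1 r0[of "fst \<theta>"] mult_left_mono[of "r (fst \<theta>)" 1 "r (fst \<theta>)"] by (simp add: power2_eq_square max_def)
      then have v: "(\<integral>\<omega>. (y \<theta> \<omega>)\<^sup>2 \<partial>M) \<le> \<Lambda>0 * (1 / b ^ i)" using y2[OF \<theta>(1)] by (simp add: ri)
      have "(\<integral>\<omega>. y \<theta> \<omega> ^ (2 * p') \<partial>M) \<le> (cp + cp\<^sup>2) * (\<integral>\<omega>. (y \<theta> \<omega>)\<^sup>2 \<partial>M) ^ p'" by (rule yp[OF \<theta>(1)])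
      also have "\<dots> \<le> (cp + cp\<^sup>2) * (\<Lambda>0 * (1 / b ^ i)) ^ p'" using v cp by (intro mult_left_mono power_mono) auto
      also have "\<dots> = (cp + cp\<^sup>2) * \<Lambda>0 ^ p' / (b ^ p') ^ i"
        by (simp add: power_mult_distrib power_divide power_mult[symmetric] mult.commute)
      also have "\<dots> \<le> \<Lambda> / 8 ^ i"
        using \<Lambda> p' L0 cp by (intro frac_le power_mono) auto
      finally show ?thesis by (simp add: i_def)
    qed
    obtain z where z: "exp (- C0 * 2 ^ J) \<le> measure M {\<omega> \<in> space M. \<forall>\<theta>\<in>codes n. round (y \<theta> \<omega>) = z \<theta>}"
      using multilevel_code[where lev=fst and y=y and \<Theta>="codes n" and p=p' and \<Lambda>=\<Lambda> and c="(real CARD('d))\<^sup>2" and J=J,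
          OF prob_M[OF T G] finite_codes y(1) _ \<Lambda>(3) _ card_codes_level y(2,3) coarse fine]
      by (auto simp: C0_def p'_def)
    have "exp (- C0 * 2 ^ J) ^ (2 ^ CARD('d)) \<le> measure M {\<omega> \<in> space M. \<forall>\<theta>\<in>codes n. \<bar>code_var n T \<theta> (grid_path n T W \<omega>)\<bar> \<le> code_width \<eta> \<theta>}"
      using z unfolding y_def by (intro small_paths_from_code[OF T G width]) auto
    moreover have "exp (- C0 * 2 ^ J) ^ (2 ^ CARD('d)) = exp (- C * 2 ^ J)"
      by (simp add: exp_of_nat_mult[symmetric] C_def mult_ac)
    ultimately show "exp (- C * 2 ^ J) \<le> measure M {\<omega> \<in> space M. \<forall>\<theta>\<in>codes n.
      \<bar>code_var n T \<theta> (grid_path n T W \<omega>)\<bar> \<le> code_width (\<lambda>j. c0 * \<epsilon> * (T / 2 ^ j) powr \<alpha>) \<theta>}"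
      unfolding \<eta>_def by simp
  qed
qed

section \<open>From small codes to the rough path norm\<close>

lemma norm_vec_le_card:
  fixes v :: "('b::real_normed_vector)^'d"
  assumes "\<And>i. norm (v $ i) \<le> r"
  shows "norm v \<le> real CARD('d) * r"
proof -
  have "norm v \<le> (\<Sum>i\<in>UNIV. norm (v $ i))" unfolding norm_vec_def by (rule L2_set_le_sum) simp
  also have "\<dots> \<le> (\<Sum>i\<in>(UNIV :: 'd set). r)" by (intro sum_mono assms)
  finally show ?thesis by simp
qed

text \<open>The widths decay geometrically with ratio 2^(-\<alpha>), so chaining loses only a
  constant. Intervals shorter than the mesh are excluded here; any fixed interval is admissible for
  all large n.\<close>

lemma pl_bounds_from_codes:
  fixes x :: "real \<Rightarrow> real^'d"
  assumes T: "0 < T" and \<alpha>: "0 < \<alpha>" and e: "0 \<le> e"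
    and small: "\<And>\<theta>. \<theta> \<in> codes n \<Longrightarrow> \<bar>code_var n T \<theta> (\<lambda>c t. x t $ c)\<bar> \<le> code_width (\<lambda>j. e * (T / 2 ^ j) powr \<alpha>) \<theta>"
    and st: "0 \<le> s" "s < t" "t \<le> T" "T / 2 ^ n \<le> t - s"
  defines "K \<equiv> 3 / (1 - 2 powr - \<alpha>) * real CARD('d) * e * (t - s) powr \<alpha>"
  shows "norm (pl_approx n T x t - pl_approx n T x s) \<le> K \<and> norm (pl_area n T x s t) \<le> K\<^sup>2"
proof -
  let ?y = "pl_approx n T x" and ?A = "pl_area n T x"
  define q where "q = 2 powr - \<alpha>"
  have q: "0 < q" "q < 1" using \<alpha> powr_less_mono[of "- \<alpha>" 0 2] by (auto simp: q_def)
  \<comment> \<open>With \<delta> (i+1) = q \<delta> i the chaining condition reads (1 + C) q \<le>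
    C. For C = 1 / (1 - q) it amounts to (1 - q)^2 \<ge> 0.\<close>
  define C where "C = 1 / (1 - q)"
  have C: "1 \<le> C" using q by (simp add: C_def)
  define \<eta> where "\<eta> j = e * (T / 2 ^ j) powr \<alpha>" for j :: nat
  define \<delta> where "\<delta> j = real CARD('d) * \<eta> j" for j
  have \<eta>0: "0 \<le> \<eta> j" for j using e by (simp add: \<eta>_def)
  have \<delta>0: "0 \<le> \<delta> j" for j using \<eta>0 by (simp add: \<delta>_def)
  have inc: "\<bar>(x (dyad i T (Suc k)) - x (dyad i T k)) $ c\<bar> \<le> \<eta> i" if "i \<le> n" "k < 2 ^ i" for i k c
    using small[of "(i, k, c, c)"] that by (simp add: codes_def code_var_def code_width_def grid_inc_def \<eta>_def)
  have normx: "norm (x (dyad i T (Suc k)) - x (dyad i T k)) \<le> \<delta> i" if "i \<le> n" "k < 2 ^ i" for i k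
    unfolding \<delta>_def using inc[OF that] by (intro norm_vec_le_card) simp
  have cell: "norm (?y b - ?y a) \<le> \<delta> n \<and> norm (?A a b) \<le> (\<delta> n)\<^sup>2"
    if k: "k < 2 ^ n" and ab: "dyad n T k \<le> a" "a \<le> b" "b \<le> dyad n T (Suc k)" for k a b
  proof -
    let ?D = "x (dyad n T (Suc k)) - x (dyad n T k)"
    have "?y b - ?y a = ((b - dyad n T k) * 2 ^ n / T - (a - dyad n T k) * 2 ^ n / T) *\<^sub>R ?D"
      using ab by (subst (1 2) pl_approx_cell[OF T k]) (auto simp: scaleR_diff_left)
    also have "(b - dyad n T k) * 2 ^ n / T - (a - dyad n T k) * 2 ^ n / T = (b - a) * 2 ^ n / T"
      by (simp add: diff_divide_distrib[symmetric] left_diff_distrib[symmetric])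
    finally have D: "?y b - ?y a = ((b - a) * 2 ^ n / T) *\<^sub>R ?D" .
    have "b - a \<le> T / 2 ^ n" using ab dyad_Suc_diff[OF T, of n k] by linarith
    then have "(b - a) * 2 ^ n / T \<le> 1" using T by (simp add: field_simps)
    moreover have "0 \<le> (b - a) * 2 ^ n / T" using ab T by simp
    ultimately have "norm (?y b - ?y a) \<le> 1 * norm ?D"
      unfolding D norm_scaleR by (intro mult_right_mono) auto
    then have n1: "norm (?y b - ?y a) \<le> \<delta> n" using normx[OF order_refl k] by simp
    then have "norm (?y b - ?y a) * norm (?y b - ?y a) \<le> \<delta> n * \<delta> n" using \<delta>0 by (intro mult_mono) auto
    moreover have "norm (?A a b) = norm (?y b - ?y a) * norm (?y b - ?y a) / 2"
      unfolding pl_area_cell[OF T k ab] by (simp add: norm_outer)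
    moreover have "0 \<le> norm (?y b - ?y a) * norm (?y b - ?y a)" by simp
    ultimately show ?thesis using n1 unfolding power2_eq_square by linarith
  qed
  have dy: "norm (?y (dyad i T (Suc k)) - ?y (dyad i T k)) \<le> \<delta> i \<and> norm (?A (dyad i T k) (dyad i T (Suc k))) \<le> (\<delta> i)\<^sup>2"
    if i: "i \<le> n" and k: "k < 2 ^ i" for i k
  proof -
    define a where "a = k * 2 ^ (n - i)"
    define b where "b = Suc k * 2 ^ (n - i)"
    have d: "dyad i T k = dyad n T a" "dyad i T (Suc k) = dyad n T b"
      using dyad_scale[of i "n - i" T k] dyad_scale[of i "n - i" T "Suc k"] i by (simp_all add: a_def b_def)
    have "Suc k * 2 ^ (n - i) \<le> 2 ^ i * 2 ^ (n - i)" using k by (intro mult_right_mono) auto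
    then have ab: "a \<le> b" "b \<le> 2 ^ n" using i by (auto simp: a_def b_def power_add[symmetric])
    have yx: "?y (dyad n T a) = x (dyad n T a)" "?y (dyad n T b) = x (dyad n T b)"
      using ab by (auto intro!: pl_approx_grid[OF T])
    have o: "0 \<le> dyad n T a" "dyad n T a \<le> dyad n T b" "dyad n T b \<le> T"
      using T ab dyad_le_T[OF T ab(2)] by (auto simp: dyad_def field_simps)
    \<comment> \<open>Diagonal entries are half the square of an increment by the symmetry relation;
      off the diagonal the entry is itself a code variable.\<close>
    have comp: "norm (?A (dyad n T a) (dyad n T b) $ c $ c') \<le> (\<eta> i)\<^sup>2" for c c'
    proof (cases "c = c'")
      case True
      have "2 * (?A (dyad n T a) (dyad n T b) $ c $ c) = (x (dyad n T b) - x (dyad n T a)) $ c * (x (dyad n T b) - x (dyad n T a)) $ c"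
        using pl_area_sym[where x=x and n=n and i=c and j=c, OF T o] by (simp add: yx)
      moreover have "\<bar>(x (dyad n T b) - x (dyad n T a)) $ c\<bar> * \<bar>(x (dyad n T b) - x (dyad n T a)) $ c\<bar> \<le> \<eta> i * \<eta> i"
        using inc[OF that, of c] \<eta>0 by (intro mult_mono) (auto simp: d)
      ultimately have "2 * \<bar>?A (dyad n T a) (dyad n T b) $ c $ c\<bar> \<le> \<eta> i * \<eta> i"
        by (metis abs_mult abs_numeral)
      then show ?thesis using True \<eta>0[of i] unfolding power2_eq_square by simp
    next
      case False
      have "?A (dyad n T a) (dyad n T b) $ c $ c' = code_var n T (i, k, c, c') (\<lambda>c t. x t $ c)"
        using pl_area_grid[where x=x and i=c and j=c', OF T ab] False by (simp add: code_var_def a_def b_def del: mult_Suc)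
      then show ?thesis using small[of "(i, k, c, c')"] that False
        by (simp add: codes_def code_width_def \<eta>_def)
    qed
    have "norm (?A (dyad n T a) (dyad n T b)) \<le> real CARD('d) * (real CARD('d) * (\<eta> i)\<^sup>2)"
      by (intro norm_vec_le_card comp)
    then have "norm (?A (dyad n T a) (dyad n T b)) \<le> (\<delta> i)\<^sup>2" by (simp add: \<delta>_def power2_eq_square mult_ac)
    then show ?thesis using normx[OF that] by (simp add: d yx)
  qed
  have \<delta>S: "(1 + C) * \<delta> (Suc i) \<le> C * \<delta> i" for i
  proof -
    have "\<delta> (Suc i) = q * \<delta> i"
    proof -
      have "(T / 2 ^ Suc i) powr \<alpha> = (T / 2 ^ i * (1 / 2)) powr \<alpha>" by (simp add: mult.commute)
      also have "\<dots> = (T / 2 ^ i) powr \<alpha> * (1 / 2) powr \<alpha>" by (rule powr_mult)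
      also have "(1 / 2 :: real) powr \<alpha> = q" by (simp add: q_def powr_minus_divide powr_divide)
      finally show ?thesis by (simp add: \<delta>_def \<eta>_def mult_ac)
    qed
    moreover have "(1 + C) * q \<le> C"
    proof -
      have "0 \<le> (1 - q)\<^sup>2" by simp
      then have "(2 - q) * q \<le> 1" by (simp add: power2_eq_square algebra_simps)
      then have "(2 - q) * q / (1 - q) \<le> 1 / (1 - q)" using q by (intro divide_right_mono) auto
      moreover have "1 + C = (2 - q) / (1 - q)" using q by (simp add: C_def field_simps)
      ultimately show ?thesis by (simp add: C_def)
    qed
    ultimately show ?thesis using mult_right_mono[of "(1 + C) * q" C "\<delta> i"] \<delta>0 by (simp add: mult_ac)
  qed
  obtain i where i: "i \<le> n" "T / 2 ^ i \<le> t - s" "norm (?y t - ?y s) \<le> 3 * C * \<delta> i" "norm (?A s t) \<le> (3 * C * \<delta> i)\<^sup>2"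
  proof -
    have "\<exists>i\<le>n. T / 2 ^ i \<le> t - s \<and> norm (?y t - ?y s) \<le> 3 * C * \<delta> i \<and> norm (?A s t) \<le> (3 * C * \<delta> i)\<^sup>2"
      by (rule dyadic_chaining[OF T pl_area_chen[OF T] cell dy \<delta>0 \<delta>S C st])
    then show thesis by (elim exE conjE) (rule that)
  qed
  \<comment> \<open>The level i returned by chaining satisfies T / 2^i \<le> t - s, which converts
    the width of that level into the power (t - s)^\<alpha>.\<close>
  have "\<delta> i \<le> real CARD('d) * (e * (t - s) powr \<alpha>)"
    unfolding \<delta>_def \<eta>_def using i(2) \<alpha> e T by (intro mult_left_mono powr_mono2) auto
  then have "3 * C * \<delta> i \<le> 3 * C * (real CARD('d) * (e * (t - s) powr \<alpha>))" using C by (intro mult_left_mono) auto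
  then have le: "3 * C * \<delta> i \<le> K" by (simp add: K_def C_def q_def)
  moreover have "(3 * C * \<delta> i)\<^sup>2 \<le> K\<^sup>2" using le C \<delta>0[of i] by (intro power_mono) auto
  ultimately show ?thesis using i(3,4) by linarith
qed

text \<open>The interpolation at t is a convex combination of two values of x at points within one
  mesh of t, and balls are convex.\<close>

lemma pl_approx_tendsto:
  fixes x :: "real \<Rightarrow> real^'d"
  assumes T: "0 < T" and cont: "continuous_on {0..T} x" and t: "0 \<le> t" "t \<le> T"
  shows "(\<lambda>n. pl_approx n T x t) \<longlonglongrightarrow> x t"
proof (rule tendstoI)
  fix e :: real assume e: "0 < e"
  obtain d where d: "0 < d" "\<And>u. u \<in> {0..T} \<Longrightarrow> dist u t < d \<Longrightarrow> dist (x u) (x t) < e"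
    using cont e t unfolding continuous_on_iff by (metis atLeastAtMost_iff)
  have "(\<lambda>n. T * (1 / 2) ^ n) \<longlonglongrightarrow> 0" by (intro tendsto_mult_right_zero LIMSEQ_realpow_zero) auto
  from order_tendstoD(2)[OF this d(1)]
  show "\<forall>\<^sub>F n in sequentially. dist (pl_approx n T x t) (x t) < e"
  proof (rule eventually_mono)
    fix n assume n: "T * (1 / 2) ^ n < d"
    obtain k where k: "k < 2 ^ n" "dyad n T k \<le> t" "t \<le> dyad n T (Suc k)" using in_cell[OF T t] .
    have "dyad n T (Suc k) - dyad n T k < d" using n by (simp add: dyad_Suc_diff[OF T] power_divide)
    moreover have "0 \<le> dyad n T k" "dyad n T (Suc k) \<le> T" using T k dyad_le_T[OF T, of "Suc k" n] by (auto simp: dyad_def)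
    ultimately have xk: "x (dyad n T k) \<in> ball (x t) e" "x (dyad n T (Suc k)) \<in> ball (x t) e"
      using k d(2)[of "dyad n T k"] d(2)[of "dyad n T (Suc k)"] by (auto simp: dist_real_def dist_commute)
    define r where "r = (t - dyad n T k) * 2 ^ n / T"
    have "t - dyad n T k \<le> T / 2 ^ n" using k dyad_Suc_diff[OF T, of n k] by linarith
    then have r: "0 \<le> r" "r \<le> 1" using k T by (auto simp: r_def field_simps)
    have "pl_approx n T x t = (1 - r) *\<^sub>R x (dyad n T k) + r *\<^sub>R x (dyad n T (Suc k))"
      using pl_approx_cell[OF T k] by (simp add: r_def algebra_simps)
    also have "\<dots> \<in> ball (x t) e" using r xk by (intro convexD[OF convex_ball]) auto
    finally show "dist (pl_approx n T x t) (x t) < e" by (simp add: dist_commute)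
  qed
qed

lemma norm_limit_le_frequently:
  fixes f :: "nat \<Rightarrow> 'b::real_normed_vector"
  assumes "f \<longlonglongrightarrow> l" "\<exists>\<^sub>F n in sequentially. norm (f n) \<le> r"
  shows "norm l \<le> r"
proof (rule ccontr)
  assume "\<not> norm l \<le> r"
  then have "\<forall>\<^sub>F n in sequentially. r < norm (f n)"
    using tendsto_norm[OF assms(1)] by (intro order_tendstoD) auto
  then have "\<forall>\<^sub>F n in sequentially. \<not> norm (f n) \<le> r" by (rule eventually_mono) simp
  then show False using assms(2) by (simp add: frequently_def)
qed

text \<open>For fixed s < t both levels of the interpolation converge along all n, so bounds valid
  for infinitely many n survive in the limit. The symmetry relation also passes to the limit, which
  makes the upper bound for \<open>cc_norm\<close> available for the lift.\<close>

lemma rp_hoelder_norm_le: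
  fixes W :: "real \<Rightarrow> 'a \<Rightarrow> real^'d"
  assumes T: "0 < T" and \<alpha>: "0 < \<alpha>" and e: "0 \<le> e"
    and cont: "continuous_on {0..T} (\<lambda>t. W t \<omega>)"
    and lift: "\<And>s t. 0 \<le> s \<Longrightarrow> s \<le> t \<Longrightarrow> t \<le> T \<Longrightarrow> (\<lambda>n. pl_area n T (\<lambda>r. W r \<omega>) s t) \<longlonglongrightarrow> W2 s t \<omega>"
    and freq: "\<exists>\<^sub>F n in sequentially. \<forall>\<theta>\<in>codes n. \<bar>code_var n T \<theta> (grid_path n T W \<omega>)\<bar> \<le> code_width (\<lambda>j. e * (T / 2 ^ j) powr \<alpha>) \<theta>"
  shows "rp_hoelder_norm T \<alpha> W W2 \<omega> \<le> ereal ((1 + 8 * (real CARD('d))\<^sup>2) * (3 / (1 - 2 powr - \<alpha>) * real CARD('d)) * e)"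
  unfolding rp_hoelder_norm_def
proof (rule SUP_least, clarify)
  fix s t assume st: "0 \<le> s" "s < t" "t \<le> T"
  let ?x = "\<lambda>r. W r \<omega>"
  define K where "K = 3 / (1 - 2 powr - \<alpha>) * real CARD('d) * e * (t - s) powr \<alpha>"
  have "(\<lambda>n. T * (1 / 2) ^ n) \<longlonglongrightarrow> 0" by (intro tendsto_mult_right_zero LIMSEQ_realpow_zero) auto
  from order_tendstoD(2)[OF this, of "t - s"] st have "\<forall>\<^sub>F n in sequentially. T * (1 / 2) ^ n < t - s" by simp
  from frequently_eventually_frequently[OF freq this]
  have fr: "\<exists>\<^sub>F n in sequentially. norm (pl_approx n T ?x t - pl_approx n T ?x s) \<le> K \<and> norm (pl_area n T ?x s t) \<le> K\<^sup>2"
  proof (rule frequently_elim1, elim conjE)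
    fix n assume n: "\<forall>\<theta>\<in>codes n. \<bar>code_var n T \<theta> (grid_path n T W \<omega>)\<bar> \<le> code_width (\<lambda>j. e * (T / 2 ^ j) powr \<alpha>) \<theta>"
      and "T * (1 / 2) ^ n < t - s"
    then have nst: "T / 2 ^ n \<le> t - s" by (simp add: power_divide)
    have "\<bar>code_var n T \<theta> (\<lambda>c t. W t \<omega> $ c)\<bar> \<le> code_width (\<lambda>j. e * (T / 2 ^ j) powr \<alpha>) \<theta>" if \<theta>: "\<theta> \<in> codes n" for \<theta>
    proof -
      have "code_var n T \<theta> (grid_path n T W \<omega>) = code_var n T \<theta> (\<lambda>c t. W t \<omega> $ c)"
        by (rule code_var_cong[OF \<theta>]) (simp add: grid_path_def)
      then show ?thesis using n \<theta> by metis
    qed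
    then show "norm (pl_approx n T ?x t - pl_approx n T ?x s) \<le> K \<and> norm (pl_area n T ?x s t) \<le> K\<^sup>2"
      unfolding K_def by (rule pl_bounds_from_codes[OF T \<alpha> e _ st nst])
  qed
  have yl: "(\<lambda>n. pl_approx n T ?x u) \<longlonglongrightarrow> W u \<omega>" if "0 \<le> u" "u \<le> T" for u by (rule pl_approx_tendsto[OF T cont that])
  have dl: "(\<lambda>n. pl_approx n T ?x t - pl_approx n T ?x s) \<longlonglongrightarrow> W t \<omega> - W s \<omega>"
    using st by (intro tendsto_diff yl) auto
  have al: "(\<lambda>n. pl_area n T ?x s t) \<longlonglongrightarrow> W2 s t \<omega>" using st by (intro lift) auto
  have sym: "W2 s t \<omega> $ i $ j + W2 s t \<omega> $ j $ i = (W t \<omega> - W s \<omega>) $ i * (W t \<omega> - W s \<omega>) $ j" for i j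
  proof (rule LIMSEQ_unique)
    show "(\<lambda>n. pl_area n T ?x s t $ i $ j + pl_area n T ?x s t $ j $ i) \<longlonglongrightarrow> W2 s t \<omega> $ i $ j + W2 s t \<omega> $ j $ i"
      by (intro tendsto_intros al)
    show "(\<lambda>n. pl_area n T ?x s t $ i $ j + pl_area n T ?x s t $ j $ i) \<longlonglongrightarrow> (W t \<omega> - W s \<omega>) $ i * (W t \<omega> - W s \<omega>) $ j"
      using pl_area_sym[where x="?x", OF T st(1) less_imp_le[OF st(2)] st(3)] by (simp only:) (intro tendsto_intros dl)
  qed
  have "cc_norm (W t \<omega> - W s \<omega>) (W2 s t \<omega>) \<le> (1 + 8 * (real CARD('d))\<^sup>2) * K"
  proof (rule cc_norm_le[OF sym])
    show "norm (W t \<omega> - W s \<omega>) \<le> K" by (rule norm_limit_le_frequently[OF dl frequently_elim1[OF fr]]) simp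
    show "norm (W2 s t \<omega>) \<le> K\<^sup>2" by (rule norm_limit_le_frequently[OF al frequently_elim1[OF fr]]) simp
  qed
  then have "cc_norm (W t \<omega> - W s \<omega>) (W2 s t \<omega>) / (t - s) powr \<alpha> \<le> (1 + 8 * (real CARD('d))\<^sup>2) * K / (t - s) powr \<alpha>"
    by (rule divide_right_mono) simp
  also have "\<dots> = (1 + 8 * (real CARD('d))\<^sup>2) * (3 / (1 - 2 powr - \<alpha>) * real CARD('d)) * e"
    using st by (simp add: K_def)
  finally show "ereal (cc_norm (W t \<omega> - W s \<omega>) (W2 s t \<omega>) / (t - s) powr \<alpha>)
      \<le> ereal ((1 + 8 * (real CARD('d))\<^sup>2) * (3 / (1 - 2 powr - \<alpha>) * real CARD('d)) * e)" by simp
qed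

text \<open>Fatou's lemma for the upper limit of sets: the unions U m decrease to it, each contains
  S m, and probability is continuous from above. No relation between the S n is needed.\<close>

lemma (in prob_space) prob_frequently_ge:
  assumes S: "\<And>n::nat. S n \<in> sets M" and p: "\<And>n. p \<le> prob (S n)"
  shows "{x \<in> space M. \<exists>\<^sub>F n in sequentially. x \<in> S n} \<in> sets M"
    and "p \<le> prob {x \<in> space M. \<exists>\<^sub>F n in sequentially. x \<in> S n}"
proof -
  define U where "U m = (\<Union>n\<in>{m..}. S n)" for m
  have U: "U m \<in> sets M" for m unfolding U_def using S by auto
  have eq: "{x \<in> space M. \<exists>\<^sub>F n in sequentially. x \<in> S n} = (\<Inter>m. U m)"
  proof -
    have "x \<in> space M" if "x \<in> U 0" for x using that sets.sets_into_space[OF S] by (auto simp: U_def)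
    then show ?thesis unfolding frequently_sequentially U_def by (auto, blast)
  qed
  show "{x \<in> space M. \<exists>\<^sub>F n in sequentially. x \<in> S n} \<in> sets M" unfolding eq using U by auto
  have "(\<lambda>m. prob (U m)) \<longlonglongrightarrow> prob (\<Inter>m. U m)"
  proof (rule finite_Lim_measure_decseq)
    show "range U \<subseteq> sets M" using U by auto
    show "decseq U" unfolding decseq_def U_def by (intro allI impI UN_mono) auto
  qed
  moreover have "p \<le> prob (U m)" for m
    using p[of m] finite_measure_mono[of "S m" "U m"] U by (force simp: U_def)
  ultimately show "p \<le> prob {x \<in> space M. \<exists>\<^sub>F n in sequentially. x \<in> S n}"
    unfolding eq by (intro LIMSEQ_le_const) auto
qed

text \<open>J is the logarithm of \<epsilon>^(-1/\<kappa>) to base 2, rounded up; the rounding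
  accounts for the factor 2.\<close>

lemma dyadic_scale_exists:
  assumes \<epsilon>: "0 < \<epsilon>" "\<epsilon> < (1::real)" and \<kappa>: "0 < \<kappa>"
  shows "\<exists>J. 1 / \<epsilon> \<le> 2 powr (\<kappa> * real J) \<and> 2 ^ J \<le> 2 * \<epsilon> powr (- 1 / \<kappa>)"
proof -
  define J where "J = nat \<lceil>log 2 (1 / \<epsilon>) / \<kappa>\<rceil>"
  have l: "0 < log 2 (1 / \<epsilon>)" using \<epsilon> by simp
  then have l': "0 < log 2 (1 / \<epsilon>) / \<kappa>" using \<kappa> by simp
  have J: "log 2 (1 / \<epsilon>) / \<kappa> \<le> real J" "real J < log 2 (1 / \<epsilon>) / \<kappa> + 1"
    unfolding J_def using l' by linarith+
  have "log 2 (1 / \<epsilon>) \<le> \<kappa> * real J" using J(1) \<kappa> by (simp add: field_simps)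
  then have "2 powr log 2 (1 / \<epsilon>) \<le> 2 powr (\<kappa> * real J)" by simp
  then have 1: "1 / \<epsilon> \<le> 2 powr (\<kappa> * real J)" using \<epsilon> by simp
  have "2 ^ J = 2 powr real J" by (simp add: powr_realpow)
  also have "\<dots> \<le> 2 powr (log 2 (1 / \<epsilon>) / \<kappa> + 1)" using J(2) by simp
  also have "\<dots> = 2 * (2 powr log 2 (1 / \<epsilon>)) powr (1 / \<kappa>)" by (simp add: powr_add powr_powr)
  also have "2 powr log 2 (1 / \<epsilon>) = 1 / \<epsilon>" using \<epsilon> by simp
  also have "(1 / \<epsilon>) powr (1 / \<kappa>) = \<epsilon> powr (- 1 / \<kappa>)"
    using \<epsilon> by (simp add: powr_divide powr_minus_divide)
  finally show ?thesis using 1 by blast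
qed

theorem theorem4p1:
  fixes M :: "'a measure" and T \<rho> \<alpha> :: real
    and W :: "real \<Rightarrow> 'a \<Rightarrow> real^'d"
    and W2 :: "real \<Rightarrow> real \<Rightarrow> 'a \<Rightarrow> real^'d^'d"
  assumes T_pos: "0 < T"
    and gauss: "cont_centred_gauss_indep M T W"
    and rho: "1 \<le> \<rho>" "\<rho> < 3 / 2"
    and cov_reg: "\<exists>Mc::real. \<forall>s t. 0 \<le> s \<and> s \<le> t \<and> t \<le> T \<longrightarrow>
                     rho_var2 (cov M W) \<rho> s t \<le> ereal (Mc * (t - s) powr (1 / \<rho>))"
    and lift: "canonical_lift M T W W2"
    and alpha: "1 / 3 < \<alpha>" "\<alpha> < 1 / (2 * \<rho>)"
  shows "\<exists>C>0. \<forall>\<^sub>F \<epsilon> in at_right 0.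
           inner_prob M {\<omega> \<in> space M. rp_hoelder_norm T \<alpha> W W2 \<omega> < ereal \<epsilon>} > 0 \<and>
           - ln (inner_prob M {\<omega> \<in> space M. rp_hoelder_norm T \<alpha> W W2 \<omega> < ereal \<epsilon>})
             \<le> C * \<epsilon> powr (- 1 / (1 / (2 * \<rho>) - \<alpha>))"
proof -
  interpret prob_space M by (rule prob_M[OF T_pos gauss])
  obtain Mc0 where Mc0: "\<And>s t. 0 \<le> s \<Longrightarrow> s \<le> t \<Longrightarrow> t \<le> T \<Longrightarrow> rho_var2 (cov M W) \<rho> s t \<le> ereal (Mc0 * (t - s) powr (1 / \<rho>))"
    using cov_reg by blast
  \<comment> \<open>The given constant may be nonpositive; enlarging it preserves the bound and
    supplies the positivity used in the estimates.\<close>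
  define Mc where "Mc = max Mc0 1"
  have Mc: "0 < Mc" by (simp add: Mc_def)
  have R: "rho_var2 (cov M W) \<rho> s t \<le> ereal (Mc * (t - s) powr (1 / \<rho>))" if "0 \<le> s" "s \<le> t" "t \<le> T" for s t
    using Mc0[OF that] by (rule order_trans) (auto simp: Mc_def intro: mult_right_mono)
  define \<kappa> where "\<kappa> = 1 / (2 * \<rho>) - \<alpha>"
  have "1 / (2 * \<rho>) \<le> 1 / 2" using rho by (simp add: field_simps)
  then have \<kappa>: "0 < \<kappa>" "\<kappa> \<le> 1 / 2" using alpha by (auto simp: \<kappa>_def)
  have \<alpha>: "0 < \<alpha>" using alpha by simp
  define D where "D = (1 + 8 * (real CARD('d))\<^sup>2) * (3 / (1 - 2 powr - \<alpha>) * real CARD('d))"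
  have D: "0 < D"
  proof -
    have "2 powr - \<alpha> < 1" using \<alpha> powr_less_mono[of "- \<alpha>" 0 2] by simp
    then show ?thesis by (simp add: D_def add_pos_nonneg)
  qed
  \<comment> \<open>D is the constant lost between the widths of the codes and the Hoelder norm.
    Widths proportional to \<epsilon> / (2 D) keep the norm at most \<epsilon> / 2, hence strictly
    below \<epsilon>.\<close>
  define c0 where "c0 = 1 / (2 * D)"
  have c0: "0 < c0" using D by (simp add: c0_def)
  obtain C where C: "0 < C" "\<And>n J \<epsilon>. 0 < \<epsilon> \<Longrightarrow> 1 / \<epsilon> \<le> 2 powr (\<kappa> * real J) \<Longrightarrow>
    exp (- C * 2 ^ J) \<le> prob {\<omega> \<in> space M. \<forall>\<theta>\<in>codes n.
      \<bar>code_var n T \<theta> (grid_path n T W \<omega>)\<bar> \<le> code_width (\<lambda>j. c0 * \<epsilon> * (T / 2 ^ j) powr \<alpha>) \<theta>}"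
    using small_grid_paths_probability[OF T_pos gauss rho(1) _ Mc R \<kappa>_def \<kappa> c0] rho(2) by auto
  obtain N where N: "N \<in> null_sets M" "{\<omega> \<in> space M. \<not> (\<forall>s t. 0 \<le> s \<and> s \<le> t \<and> t \<le> T \<longrightarrow>
        (\<lambda>n. pl_area n T (\<lambda>r. W r \<omega>) s t) \<longlonglongrightarrow> W2 s t \<omega>)} \<subseteq> N"
    using lift unfolding canonical_lift_def eventually_ae_filter by blast
  have cont: "continuous_on {0..T} (\<lambda>t. W t \<omega>)" if "\<omega> \<in> space M" for \<omega>
    using gauss that by (simp add: cont_centred_gauss_indep_def)
  have main: "0 < inner_prob M {\<omega> \<in> space M. rp_hoelder_norm T \<alpha> W W2 \<omega> < ereal \<epsilon>} \<and>
           - ln (inner_prob M {\<omega> \<in> space M. rp_hoelder_norm T \<alpha> W W2 \<omega> < ereal \<epsilon>})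
             \<le> (2 * C) * \<epsilon> powr (- 1 / \<kappa>)" if \<epsilon>: "0 < \<epsilon>" "\<epsilon> < 1" for \<epsilon>
  proof -
    obtain J where J: "1 / \<epsilon> \<le> 2 powr (\<kappa> * real J)" "2 ^ J \<le> 2 * \<epsilon> powr (- 1 / \<kappa>)"
      using dyadic_scale_exists[OF \<epsilon> \<kappa>(1)] by blast
    define S where "S n = {\<omega> \<in> space M. \<forall>\<theta>\<in>codes n.
      \<bar>code_var n T \<theta> (grid_path n T W \<omega>)\<bar> \<le> code_width (\<lambda>j. c0 * \<epsilon> * (T / 2 ^ j) powr \<alpha>) \<theta>}" for n
    have S: "S n \<in> sets M" for n
      unfolding S_def
    proof (rule sets.sets_Collect_finite_All[OF _ finite_codes])
      fix \<theta> assume "\<theta> \<in> (codes n :: (nat \<times> nat \<times> 'd \<times> 'd) set)"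
      note [measurable] = grid_path_code_var_measurable[OF T_pos gauss this]
      show "{\<omega> \<in> space M. \<bar>code_var n T \<theta> (grid_path n T W \<omega>)\<bar> \<le> code_width (\<lambda>j. c0 * \<epsilon> * (T / 2 ^ j) powr \<alpha>) \<theta>} \<in> sets M"
        by measurable
    qed
    have Sp: "exp (- C * 2 ^ J) \<le> prob (S n)" for n unfolding S_def by (rule C(2)[OF \<epsilon>(1) J(1)])
    define L where "L = {\<omega> \<in> space M. \<exists>\<^sub>F n in sequentially. \<omega> \<in> S n}"
    have L: "L \<in> sets M" "exp (- C * 2 ^ J) \<le> prob L" unfolding L_def using prob_frequently_ge[OF S Sp] by auto
    let ?E = "{\<omega> \<in> space M. rp_hoelder_norm T \<alpha> W W2 \<omega> < ereal \<epsilon>}"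
    \<comment> \<open>\<open>?E\<close> involves an uncountable supremum of infima and its
      measurability is not established; the measurable subset L - N bounds its inner probability
      from below.\<close>
    have sub: "L - N \<subseteq> ?E"
    proof
      fix \<omega> assume \<omega>: "\<omega> \<in> L - N"
      then have sp: "\<omega> \<in> space M" by (simp add: L_def)
      have "rp_hoelder_norm T \<alpha> W W2 \<omega> \<le> ereal (D * (c0 * \<epsilon>))"
        unfolding D_def
      proof (rule rp_hoelder_norm_le[where W=W and \<omega>=\<omega>, OF T_pos \<alpha> _ cont[OF sp]])
        show "0 \<le> c0 * \<epsilon>" using c0 \<epsilon> by simp
        show "(\<lambda>n. pl_area n T (\<lambda>r. W r \<omega>) s t) \<longlonglongrightarrow> W2 s t \<omega>" if "0 \<le> s" "s \<le> t" "t \<le> T" for s t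
          using \<omega> N(2) sp that by blast
        have "\<exists>\<^sub>F n in sequentially. \<omega> \<in> S n" using \<omega> by (simp add: L_def)
        then show "\<exists>\<^sub>F n in sequentially. \<forall>\<theta>\<in>codes n. \<bar>code_var n T \<theta> (grid_path n T W \<omega>)\<bar> \<le> code_width (\<lambda>j. c0 * \<epsilon> * (T / 2 ^ j) powr \<alpha>) \<theta>"
          by (rule frequently_elim1) (simp add: S_def)
      qed
      also have "\<dots> < ereal \<epsilon>" using D \<epsilon> by (simp add: c0_def)
      finally show "\<omega> \<in> ?E" using sp by simp
    qed
    have "exp (- C * 2 ^ J) \<le> prob (L - N)"
      using L N(1) by (simp add: measure_Diff_null_set)
    also have "\<dots> \<le> inner_prob M ?E"
      unfolding inner_prob_def
    proof (rule cSUP_upper)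
      show "L - N \<in> {B \<in> events. B \<subseteq> ?E}" using sub L(1) N(1) by auto
      show "bdd_above (prob ` {B \<in> events. B \<subseteq> ?E})" by (rule bdd_aboveI2[where M=1]) simp
    qed
    finally have ge: "exp (- C * 2 ^ J) \<le> inner_prob M ?E" .
    have pos: "0 < inner_prob M ?E" by (rule less_le_trans[OF exp_gt_zero ge])
    have "- C * 2 ^ J \<le> ln (inner_prob M ?E)" using ge pos by (simp add: ln_ge_iff)
    \<comment> \<open>Rounding J up at most doubles 2^J, which is the source of the constant 2 *
      C.\<close>
    moreover have "C * 2 ^ J \<le> C * (2 * \<epsilon> powr (- 1 / \<kappa>))" using J(2) C(1) by (intro mult_left_mono) auto
    ultimately show ?thesis using pos by simp
  qed
  show ?thesis
  proof (intro exI[of _ "2 * C"] conjI)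
    show "0 < 2 * C" using C by simp
    show "\<forall>\<^sub>F \<epsilon> in at_right 0.
           inner_prob M {\<omega> \<in> space M. rp_hoelder_norm T \<alpha> W W2 \<omega> < ereal \<epsilon>} > 0 \<and>
           - ln (inner_prob M {\<omega> \<in> space M. rp_hoelder_norm T \<alpha> W W2 \<omega> < ereal \<epsilon>})
             \<le> 2 * C * \<epsilon> powr (- 1 / (1 / (2 * \<rho>) - \<alpha>))"
      unfolding eventually_at_right_field
      by (rule exI[of _ 1], use main[unfolded \<kappa>_def] in auto)
  qed
qed

end
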